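(* Let $I\subseteq A=\mathbb{C}[x_1,\dots,x_n]$ be a homogeneous ideal, let $G=\{g\in \mathrm{GL}_n(\mathbb{C}) : g.I\subseteq I\}$ be the algebraic group fixing $I$, and let $\mathfrak{g}\subseteq M_n(\mathbb{C})$ be its Lie algebra. Consider the following procedure with input $I$. (1) Compute $\mathfrak{g}$. (2) Pick $x\in\mathfrak{g}$ at random and compute $\mathfrak{c}=\ker\big((\mathrm{ad}(x))^{\dim\mathfrak{g}}\big)$. (3) If $\mathfrak{c}$ is not a Cartan subalgebra of $\mathfrak{g}$, go back to (2). (4) Decompose $\mathfrak{c}=\mathfrak{t}\oplus\mathfrak{n}$, where $\mathfrak{t}$ consists of all diagonalizable elements of $\mathfrak{c}$ and $\mathfrak{n}$ of all nilpotent elements of $\mathfrak{c}$. (5) Compute any $S\in\mathrm{GL}_n(\mathbb{C})$ that diagonalizes $\mathfrak{t}$, i.e. such that $S\mathfrak{t}S^{-1}$ consists of diagonal matrices. (6) If $S.I$ is not a binomial ideal, return $\texttt{False}$. (7) If $S.I$ is not prime, return $\texttt{False}$. (8) Return $S$. Then the procedure terminates with probability $1$ (a generic $x\in\mathfrak g$ passes the test in (3)), and it is correct. That is, if there exists $S'\in\mathrm{GL}_n(\mathbb{C})$ such that $S'.I$ is a prime ideal generated by binomials, then the procedure returns a matrix $S\in\mathrm{GL}_n(\mathbb{C})$ such that $S.I$ is prime and generated by binomials. If no such $S'$ exists (in particular if $I$ is not prime), then it returns $\texttt{False}$.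
   Context: A binomial in $\mathbb{C}[x_1,\dots,x_n]$ is an element of the form $x^a-\lambda x^b$ with $\lambda\in\mathbb{C}$ and $a,b\in\mathbb{Z}_{\ge 0}^n$ (so monomials are binomials, with $\lambda=0$). A binomial ideal is an ideal that can be generated by binomials. The group $\mathrm{GL}_n(\mathbb{C})$ acts on $A$ via $(g.f)(x)=f(g^{-1}x)$, and $g.I=\{g.f: f\in I\}$. The Lie bracket on $M_n(\mathbb{C})$ is $[X,Y]=XY-YX$, and $\mathrm{ad}(x):\mathfrak{g}\to\mathfrak{g}$ is $y\mapsto[x,y]$. A subalgebra $\mathfrak{c}\subseteq\mathfrak{g}$ is a Cartan subalgebra if (i) there is $m\in\mathbb{N}$ such that for every $x\in\mathfrak{c}$ the map $\mathrm{ad}(x)^m$ on $\mathfrak{c}$ is zero, and (ii) $\mathfrak{c}=\{x\in\mathfrak{g}:[x,\mathfrak{c}]\subseteq\mathfrak{c}\}$. For the Lie algebra of a linear algebraic group, every Cartan subalgebra $\mathfrak{c}$ decomposes as in step (4), and $\mathfrak{t}$ is simultaneously diagonalizable. "Diagonalizable" and "nilpotent" refer to elements as $n\times n$ matrices. "Generic" means: in some nonempty Zariski open subset. "At random" means drawn from a probability distribution on $\mathfrak{g}$ for which every proper Zariski closed subset of $\mathfrak{g}$ has probability zero (e.g. a linear combination of a basis with independent complex normal coefficients), with independent draws at each repetition. Each individual step is assumed to be carried out exactly. *)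

theory Defs
  imports
    "HOL-Probability.Probability"
    "HOL-Library.Poly_Mapping"
    "HOL-Algebra.Ideal"
    "HOL-Decision_Procs.Algebra_Aux"
begin

section \<open>Polynomials and ideals\<close>

text \<open>
  Polynomials over the complex numbers whose variables are indexed by the finite type \<open>'k\<close>.
  An exponent vector is a finitely supported map from \<open>'k\<close> to the naturals.  The ring
  \<open>A = \<complex>[x\<^sub>1,\<dots>,x\<^sub>n]\<close> is \<open>'n cpoly\<close> with \<open>n = CARD('n)\<close>, and \<open>('n \<times> 'n) cpoly\<close> is the
  polynomial ring in the entries of an \<open>n \<times> n\<close> matrix.
\<close>

type_synonym 'k cpoly = "('k \<Rightarrow>\<^sub>0 nat) \<Rightarrow>\<^sub>0 complex"

type_synonym 'n cmat = "complex ^ 'n ^ 'n"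

abbreviation poly_ring :: "('k::finite) cpoly ring" where
  "poly_ring \<equiv> cring_class_ops"

definition cconst :: "complex \<Rightarrow> 'k cpoly" where
  "cconst c = Poly_Mapping.single 0 c"

definition cvar :: "'k \<Rightarrow> 'k cpoly" where
  "cvar i = Poly_Mapping.single (Poly_Mapping.single i 1) 1"

text \<open>Substitution of \<open>h i\<close> for the variable \<open>i\<close>, the coefficients being mapped by \<open>\<phi>\<close>.\<close>

definition poly_subst ::
    "(complex \<Rightarrow> 'b) \<Rightarrow> ('k::finite \<Rightarrow> 'b) \<Rightarrow> 'k cpoly \<Rightarrow> 'b::comm_ring_1" where
  "poly_subst \<phi> h f =
     (\<Sum>m\<in>Poly_Mapping.keys f.
        \<phi> (Poly_Mapping.lookup f m) * (\<Prod>i\<in>UNIV. h i ^ Poly_Mapping.lookup m i))"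

definition poly_eval :: "('k::finite) cpoly \<Rightarrow> ('k \<Rightarrow> complex) \<Rightarrow> complex" where
  "poly_eval f v = poly_subst (\<lambda>c. c) v f"

definition homogeneous_poly :: "nat \<Rightarrow> ('k::finite) cpoly \<Rightarrow> bool" where
  "homogeneous_poly d f \<longleftrightarrow>
     (\<forall>m\<in>Poly_Mapping.keys f. (\<Sum>i\<in>UNIV. Poly_Mapping.lookup m i) = d)"

definition homogeneous_ideal :: "('k::finite) cpoly set \<Rightarrow> bool" where
  "homogeneous_ideal I \<longleftrightarrow>
     (\<exists>F. (\<forall>f\<in>F. \<exists>d. homogeneous_poly d f) \<and> I = Idl\<^bsub>poly_ring\<^esub> F)"

definition binomial_poly :: "'k cpoly \<Rightarrow> bool" where
  "binomial_poly f \<longleftrightarrow>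
     (\<exists>a b l. f = Poly_Mapping.single a 1 - Poly_Mapping.single b l)"

definition binomial_ideal :: "('k::finite) cpoly set \<Rightarrow> bool" where
  "binomial_ideal I \<longleftrightarrow> (\<exists>F. (\<forall>f\<in>F. binomial_poly f) \<and> I = Idl\<^bsub>poly_ring\<^esub> F)"


section \<open>Matrices\<close>

definition mat_scale :: "complex \<Rightarrow> ('n::finite) cmat \<Rightarrow> 'n cmat" where
  "mat_scale c X = map_matrix ((*) c) X"

text \<open>
  The library's \<^const>\<open>dim\<close> and \<^const>\<open>subspace\<close> on this type refer to the scalar field of
  real numbers; the complex versions are \<open>cmat.dim\<close> and \<open>cmat.subspace\<close>.
\<close>

global_interpretation cmat: vector_space "mat_scale :: complex \<Rightarrow> ('n::finite) cmat \<Rightarrow> 'n cmat"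
  by standard (simp_all add: mat_scale_def vec_eq_iff algebra_simps)

definition diagonal_matrix :: "('n::finite) cmat \<Rightarrow> bool" where
  "diagonal_matrix X \<longleftrightarrow> (\<forall>i j. i \<noteq> j \<longrightarrow> X $ i $ j = 0)"

definition diagonalizable_matrix :: "('n::finite) cmat \<Rightarrow> bool" where
  "diagonalizable_matrix X \<longleftrightarrow>
     (\<exists>S :: 'n cmat. invertible S \<and> diagonal_matrix (S ** X ** matrix_inv S))"

text \<open>The power of a matrix is iterated here, since \<open>X ^ k\<close> is the componentwise power.\<close>

definition nilpotent_matrix :: "('n::finite) cmat \<Rightarrow> bool" where
  "nilpotent_matrix X \<longleftrightarrow> (\<exists>k. (((**) X) ^^ k) (mat 1) = 0)"

definition lie_bracket :: "('n::finite) cmat \<Rightarrow> 'n cmat \<Rightarrow> 'n cmat" where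
  "lie_bracket X Y = X ** Y - Y ** X"

definition lie_subalgebra :: "('n::finite) cmat set \<Rightarrow> 'n cmat set \<Rightarrow> bool" where
  "lie_subalgebra c g \<longleftrightarrow>
     c \<subseteq> g \<and> cmat.subspace c \<and> (\<forall>X\<in>c. \<forall>Y\<in>c. lie_bracket X Y \<in> c)"

definition cartan_subalgebra :: "('n::finite) cmat set \<Rightarrow> 'n cmat set \<Rightarrow> bool" where
  "cartan_subalgebra c g \<longleftrightarrow>
     lie_subalgebra c g \<and>
     (\<exists>m. \<forall>X\<in>c. \<forall>Y\<in>c. (lie_bracket X ^^ m) Y = 0) \<and>
     c = {X\<in>g. \<forall>Y\<in>c. lie_bracket X Y \<in> c}"

definition ad_kernel :: "('n::finite) cmat set \<Rightarrow> 'n cmat \<Rightarrow> 'n cmat set" where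
  "ad_kernel g x = {Y\<in>g. (lie_bracket x ^^ cmat.dim g) Y = 0}"

definition direct_sum :: "('n::finite) cmat set \<Rightarrow> 'n cmat set \<Rightarrow> 'n cmat set \<Rightarrow> bool" where
  "direct_sum c t n \<longleftrightarrow>
     cmat.subspace t \<and> cmat.subspace n \<and> t \<inter> n = {0} \<and> c = {X + Y |X Y. X \<in> t \<and> Y \<in> n}"

definition mat_eval :: "('n \<times> 'n::finite) cpoly \<Rightarrow> 'n cmat \<Rightarrow> complex" where
  "mat_eval p X = poly_eval p (\<lambda>(i, j). X $ i $ j)"

definition zariski_closed_in :: "('n::finite) cmat set \<Rightarrow> 'n cmat set \<Rightarrow> bool" where
  "zariski_closed_in g Z \<longleftrightarrow> (\<exists>F. Z = {X\<in>g. \<forall>p\<in>F. mat_eval p X = 0})"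

definition zariski_open_in :: "('n::finite) cmat set \<Rightarrow> 'n cmat set \<Rightarrow> bool" where
  "zariski_open_in g U \<longleftrightarrow> U \<subseteq> g \<and> zariski_closed_in g (g - U)"


section \<open>The group fixing an ideal and its Lie algebra\<close>

text \<open>The action \<open>(S.f)(x) = f(S\<^sup>-\<^sup>1 x)\<close>; see lemma \<open>poly_eval_act\<close> below.\<close>

definition act :: "('n::finite) cmat \<Rightarrow> 'n cpoly \<Rightarrow> 'n cpoly" where
  "act S f =
     poly_subst cconst (\<lambda>i. \<Sum>j\<in>UNIV. cconst (matrix_inv S $ i $ j) * cvar j) f"

lemma poly_eval_eq_sum:
  assumes "finite K" "Poly_Mapping.keys f \<subseteq> K"
  shows "poly_eval f v =
    (\<Sum>m\<in>K. Poly_Mapping.lookup f m * (\<Prod>i\<in>UNIV. v i ^ Poly_Mapping.lookup m i))"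
  unfolding poly_eval_def poly_subst_def
  by (rule sum.mono_neutral_left) (use assms in \<open>auto simp: in_keys_iff\<close>)

lemma poly_eval_single:
  "poly_eval (Poly_Mapping.single m c) v = c * (\<Prod>i\<in>UNIV. v i ^ Poly_Mapping.lookup m i)"
  by (subst poly_eval_eq_sum[of "{m}"]) auto

lemma poly_eval_add: "poly_eval (p + q) v = poly_eval p v + poly_eval q v"
proof -
  let ?K = "Poly_Mapping.keys p \<union> Poly_Mapping.keys q"
  have "Poly_Mapping.keys (p + q) \<subseteq> ?K"
    by (rule Poly_Mapping.keys_add)
  then show ?thesis
    by (simp add: poly_eval_eq_sum[of ?K] lookup_add distrib_right sum.distrib)
qed

lemma poly_eval_sum: "poly_eval (sum f A) v = (\<Sum>x\<in>A. poly_eval (f x) v)"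
proof -
  have "poly_eval 0 v = 0"
    by (simp add: poly_eval_def poly_subst_def)
  then show ?thesis
    by (induction A rule: infinite_finite_induct) (simp_all add: poly_eval_add)
qed

lemma poly_eval_mult: "poly_eval (p * q) v = poly_eval p v * poly_eval q v"
proof -
  have upd: "Poly_Mapping.update a b f = Poly_Mapping.single a b + f"
    if "a \<notin> Poly_Mapping.keys f" for a b and f :: "'a cpoly"
    by (rule poly_mapping_eqI)
      (use that in \<open>auto simp: lookup_update lookup_add lookup_single when_def in_keys_iff\<close>)
  have zero: "poly_eval 0 v = 0"
    by (simp add: poly_eval_def poly_subst_def)
  have single: "poly_eval (Poly_Mapping.single a c * q) v =
      poly_eval (Poly_Mapping.single a c) v * poly_eval q v" for a c q
  proof (induction q rule: update_induct)
    case const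
    then show ?case
      by (simp add: zero)
  next
    case (update f b d)
    then show ?case
      by (simp add: upd distrib_left poly_eval_add mult_single poly_eval_single lookup_add
          power_add prod.distrib)
  qed
  show ?thesis
  proof (induction p rule: update_induct)
    case const
    then show ?case
      by (simp add: zero)
  next
    case (update f b d)
    then show ?case
      by (simp add: upd single distrib_right poly_eval_add)
  qed
qed

lemma poly_eval_1: "poly_eval 1 v = 1"
  using poly_eval_single[of 0 1 v] by simp

lemma poly_eval_power: "poly_eval (p ^ k) v = poly_eval p v ^ k"
  by (induction k) (simp_all add: poly_eval_1 poly_eval_mult)

lemma poly_eval_prod: "poly_eval (prod f A) v = (\<Prod>x\<in>A. poly_eval (f x) v)"
  by (induction A rule: infinite_finite_induct) (simp_all add: poly_eval_1 poly_eval_mult)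

lemma poly_eval_cconst: "poly_eval (cconst c) v = c"
  by (simp add: cconst_def poly_eval_single)

lemma poly_eval_cvar: "poly_eval (cvar j) v = v j"
proof -
  have "(\<Prod>i\<in>UNIV. v i ^ Poly_Mapping.lookup (Poly_Mapping.single j (1::nat)) i) =
      (\<Prod>i\<in>UNIV. if i = j then v i else 1)"
    by (rule prod.cong) (auto simp: lookup_single when_def)
  then show ?thesis
    by (simp add: cvar_def poly_eval_single)
qed

lemma poly_eval_act:
  "poly_eval (act S f) (\<lambda>i. v $ i) = poly_eval f (\<lambda>i. (matrix_inv S *v v) $ i)"
  by (simp add: act_def poly_subst_def poly_eval_sum poly_eval_mult poly_eval_prod
      poly_eval_power poly_eval_cconst poly_eval_cvar matrix_vector_mult_def
      poly_eval_def[of f])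

definition act_ideal :: "('n::finite) cmat \<Rightarrow> 'n cpoly set \<Rightarrow> 'n cpoly set" where
  "act_ideal S I = act S ` I"

definition stabilizer :: "('n::finite) cpoly set \<Rightarrow> 'n cmat set" where
  "stabilizer I = {S. invertible S \<and> act_ideal S I \<subseteq> I}"

text \<open>
  The Lie algebra of a linear algebraic group as its Zariski tangent space at the identity: the
  differential at \<open>1\<close> of each polynomial vanishing on \<open>G\<close> vanishes on \<open>X\<close>.  As \<open>GL\<^sub>n\<close> is open
  in the space of all matrices, polynomials in the matrix entries suffice, i.e. the inverse of the
  determinant need not be included.
\<close>

definition lie_algebra :: "('n::finite) cmat set \<Rightarrow> 'n cmat set" where
  "lie_algebra G =
     {X. \<forall>p. (\<forall>S\<in>G. mat_eval p S = 0) \<longrightarrow>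
           ((\<lambda>s. mat_eval p (mat 1 + mat_scale s X)) has_field_derivative 0) (at 0)}"


section \<open>The procedure\<close>

text \<open>
  The procedure is a transition system whose states record the step to be executed next and the
  data that are still needed: \<open>Sample k g\<close> is step (2) for the \<open>k\<close>-th draw, and \<open>Test k g c\<close> is
  step (3).  The outcome \<open>Done None\<close> stands for returning \<open>False\<close>, and \<open>Done (Some S)\<close> for
  returning \<open>S\<close>.  The only nondeterminism, for a given sequence \<open>xs\<close> of draws, is the choice of
  \<open>S\<close> in step (5).  If the required decomposition or the required \<open>S\<close> does not exist, then the
  procedure is stuck in \<open>Decompose\<close> or \<open>Diagonalize\<close>, which counts as a failure to terminate.
\<close>

datatype 'm state =
    Compute_Lie_Algebra
  | Sample nat "'m set"
  | Test nat "'m set" "'m set"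
  | Decompose "'m set"
  | Diagonalize "'m set"
  | Check_Binomial 'm
  | Check_Prime 'm
  | Return_Matrix 'm
  | Done "'m option"

inductive step ::
    "('n::finite) cpoly set \<Rightarrow> (nat \<Rightarrow> 'n cmat) \<Rightarrow> 'n cmat state \<Rightarrow> 'n cmat state \<Rightarrow> bool"
  for I xs where
  compute: "step I xs Compute_Lie_Algebra (Sample 0 (lie_algebra (stabilizer I)))"
| sample: "step I xs (Sample k g) (Test k g (ad_kernel g (xs k)))"
| reject: "\<not> cartan_subalgebra c g \<Longrightarrow> step I xs (Test k g c) (Sample (Suc k) g)"
| accept: "cartan_subalgebra c g \<Longrightarrow> step I xs (Test k g c) (Decompose c)"
| decompose:
    "t = {X\<in>c. diagonalizable_matrix X} \<Longrightarrow> n = {X\<in>c. nilpotent_matrix X} \<Longrightarrow>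
     direct_sum c t n \<Longrightarrow> step I xs (Decompose c) (Diagonalize t)"
| diagonalize:
    "invertible S \<Longrightarrow> (\<forall>X\<in>t. diagonal_matrix (S ** X ** matrix_inv S)) \<Longrightarrow>
     step I xs (Diagonalize t) (Check_Binomial S)"
| not_binomial:
    "\<not> binomial_ideal (act_ideal S I) \<Longrightarrow> step I xs (Check_Binomial S) (Done None)"
| binomial:
    "binomial_ideal (act_ideal S I) \<Longrightarrow> step I xs (Check_Binomial S) (Check_Prime S)"
| not_prime:
    "\<not> primeideal (act_ideal S I) poly_ring \<Longrightarrow> step I xs (Check_Prime S) (Done None)"
| prime:
    "primeideal (act_ideal S I) poly_ring \<Longrightarrow> step I xs (Check_Prime S) (Return_Matrix S)"
| return_matrix: "step I xs (Return_Matrix S) (Done (Some S))"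

definition terminates :: "('n::finite) cpoly set \<Rightarrow> (nat \<Rightarrow> 'n cmat) \<Rightarrow> bool" where
  "terminates I xs \<longleftrightarrow>
     (\<nexists>s. s 0 = Compute_Lie_Algebra \<and> (\<forall>i. step I xs (s i) (s (Suc i)))) \<and>
     (\<forall>s. (step I xs)\<^sup>*\<^sup>* Compute_Lie_Algebra s \<longrightarrow>
        (\<exists>s'. step I xs s s') \<or> (\<exists>r. s = Done r))"

definition returns ::
    "('n::finite) cpoly set \<Rightarrow> (nat \<Rightarrow> 'n cmat) \<Rightarrow> 'n cmat option \<Rightarrow> bool" where
  "returns I xs r \<longleftrightarrow> (step I xs)\<^sup>*\<^sup>* Compute_Lie_Algebra (Done r)"

text \<open>
  \<open>X 0, X 1, \<dots>\<close> are independent draws from one probability distribution \<open>D\<close> on \<open>g\<close> for which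
  every proper Zariski closed subset of \<open>g\<close> has probability zero.
\<close>

definition random_draws ::
    "('n::finite) cmat set \<Rightarrow> 'w measure \<Rightarrow> (nat \<Rightarrow> 'w \<Rightarrow> 'n cmat) \<Rightarrow> bool" where
  "random_draws g P X \<longleftrightarrow>
     prob_space P \<and>
     (\<exists>D. prob_space D \<and> sets D = sets (restrict_space borel g) \<and>
        (\<forall>Z. zariski_closed_in g Z \<and> Z \<noteq> g \<longrightarrow> emeasure D Z = 0) \<and>
        prob_space.indep_vars P (\<lambda>_. D) X UNIV \<and>
        (\<forall>k. distr P D (X k) = D))"

end

theory Submission
  imports
    Defs
    "HOL-Complex_Analysis.Cauchy_Integral_Formula"
    "HOL-Computational_Algebra.Fundamental_Theorem_Algebra"
begin

text \<open>
  The Lie algebra of the stabilizer of \<open>I\<close> consists of the matrices whose derivation preserves \<open>I\<close>: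
  for such an \<open>X\<close> every functional killing \<open>I\<close> has vanishing Taylor coefficients along \<open>exp(sX)\<close>.
  Hence it contains the semisimple parts of its elements, and a Cartan subalgebra \<open>c\<close> is the sum of its
  diagonalizable elements, which are central in \<open>c\<close>, and its nilpotent ones.

  If \<open>S'.I\<close> is prime and binomial, some diagonal matrix acts on \<open>A / S'.I\<close> with one-dimensional weight
  spaces, because the exponent lattice of a prime binomial ideal is saturated.  Cartan subalgebras are
  conjugate under the stabilizer, since the conjugates of one of them near a regular element fill a
  neighbourhood and the regular elements of a complex line form a connected set.  So \<open>t\<close> contains a
  conjugate of that matrix.  Diagonalizing \<open>t\<close> therefore makes the monomials weight vectors for
  one-dimensional weight spaces, and then any two monomials of equal weight are proportional modulo \<open>S.I\<close>
  or one of them vanishes, which makes \<open>S.I\<close> binomial.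
\<close>

section \<open>Generalized eigenvectors\<close>

text \<open>Ideals are infinite-dimensional here, and no quotient is ever formed. Membership is
  tested by a functional that kills the ideal, which leaves a statement about polynomial or entire
  functions, or by splitting elements into generalized eigenvectors, whose components stay in every
  invariant subspace. The second device carries semisimple parts from the variables to all
  polynomials and splits ideals by weight.

  Step (3) accepts any Cartan subalgebra, whereas genericity speaks of regular elements, those whose
  \<open>ad_kernel\<close> has least dimension. Density reconciles the two: regular elements near
  \<open>x\<close> are conjugate into \<open>ad_kernel g x\<close>, and nilpotency then forces
  equality of the subalgebras. The conjugacy is analytic and uses a group that contains
  \<open>exp(g)\<close> and normalizes \<open>g\<close>.

  One diagonal matrix can stand for a whole torus because a rational vector space embeds linearly
  into the complex numbers. Equal weight then means that a multiple of the exponent difference lies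
  in the lattice, and primeness removes the multiple.\<close>

lemma additive_funpow:
  fixes A :: "'a::ab_group_add \<Rightarrow> 'a"
  assumes "\<And>x y. A (x + y) = A x + A y"
  shows "(A ^^ k) (x + y) = (A ^^ k) x + (A ^^ k) y" "(A ^^ k) 0 = 0"
    "(A ^^ k) (x - y) = (A ^^ k) x - (A ^^ k) y"
proof -
  have 0: "A 0 = 0"
    using assms[of 0 0] by simp
  have d: "A (x - y) = A x - A y" for x y
    using assms[of "x - y" y] by (simp add: algebra_simps)
  show "(A ^^ k) (x + y) = (A ^^ k) x + (A ^^ k) y" "(A ^^ k) 0 = 0"
    "(A ^^ k) (x - y) = (A ^^ k) x - (A ^^ k) y"
    by (induction k) (simp_all add: assms 0 d)
qed

lemma funpow_commute:
  assumes "\<And>x. A (B x) = B (A x)"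
  shows "(A ^^ k) (B x) = B ((A ^^ k) x)"
  by (induction k) (simp_all add: assms)

lemma funpow_eq_0_mono:
  fixes A :: "'a::ab_group_add \<Rightarrow> 'a"
  assumes "\<And>x y. A (x + y) = A x + A y" "(A ^^ k) x = 0" "k \<le> l"
  shows "(A ^^ l) x = 0"
proof -
  have "(A ^^ l) x = (A ^^ (l - k)) ((A ^^ k) x)"
    using assms(3) by (simp flip: funpow_add comp_apply[of "A ^^ (l - k)"])
  then show ?thesis
    by (simp add: assms(2) additive_funpow(2)[OF assms(1)])
qed

text \<open>In the Leibniz expansion of \<open>C^(a+b)\<close> every term has at least
  \<open>a\<close> factors \<open>A\<close> or at least \<open>b\<close> factors \<open>B\<close>;
  induction on \<open>a + b\<close> gets there without binomial coefficients. It serves brackets in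
  a Fitting component and products of generalized eigenvectors of a derivation.\<close>

lemma funpow_leibniz_eq_0:
  fixes A :: "'a::ab_group_add \<Rightarrow> 'a" and B :: "'b::ab_group_add \<Rightarrow> 'b"
    and C :: "'c::ab_group_add \<Rightarrow> 'c"
  assumes C: "\<And>x y. C (x + y) = C x + C y"
    and L: "\<And>u v. C (\<beta> u v) = \<beta> (A u) v + \<beta> u (B v)"
    and z: "\<And>v. \<beta> 0 v = 0" "\<And>u. \<beta> u 0 = 0"
  shows "(A ^^ a) u = 0 \<Longrightarrow> (B ^^ b) v = 0 \<Longrightarrow> (C ^^ (a + b)) (\<beta> u v) = 0"
proof (induction "a + b" arbitrary: a b u v)
  case 0
  then show ?case by (simp add: z)
next
  case (Suc n)
  consider "a = 0" | "b = 0" | a' b' where "a = Suc a'" "b = Suc b'"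
    by (metis not0_implies_Suc)
  then show ?case
  proof cases
    case 3
    have "(C ^^ (a' + b)) (\<beta> (A u) v) = 0" "(C ^^ (a + b')) (\<beta> u (B v)) = 0"
      using Suc.hyps(1)[of a' b "A u" v] Suc.hyps(1)[of a b' u "B v"] Suc.hyps(2) Suc.prems 3
      by (simp_all only: funpow_Suc_right o_apply)
    moreover have "(C ^^ (a + b)) (\<beta> u v) = (C ^^ (a' + b)) (\<beta> (A u) v) + (C ^^ (a + b')) (\<beta> u (B v))"
      
    proof -
      have "a + b = Suc (a' + b)" "a + b' = a' + b" using 3 by auto
      then show ?thesis
        by (simp only: funpow_Suc_right o_apply L additive_funpow(1)[OF C])
    qed
    ultimately show ?thesis by simp
  qed (use Suc.prems in \<open>simp_all add: z additive_funpow(2)[OF C]\<close>)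
qed

text \<open>The same induction, now for the expansion of a power of \<open>A - B\<close>. The cases
  used are \<open>ad N\<close> as left minus right multiplication and
  \<open>ad S = ad X - ad N\<close>.\<close>

lemma funpow_commuting_diff_eq_0:
  fixes A B C :: "'a::ab_group_add \<Rightarrow> 'a"
  assumes A: "\<And>x y. A (x + y) = A x + A y" and B: "\<And>x y. B (x + y) = B x + B y"
    and AB: "\<And>x. A (B x) = B (A x)" and C: "\<And>x. C x = A x - B x"
  shows "(A ^^ a) u = 0 \<Longrightarrow> (B ^^ b) u = 0 \<Longrightarrow> (C ^^ (a + b)) u = 0"
proof (induction "a + b" arbitrary: a b u)
  case 0
  then show ?case by simp
next
  case (Suc n)
  have C': "C (x + y) = C x + C y" for x y
    by (simp add: A B C)
  consider "a = 0" | "b = 0" | a' b' where "a = Suc a'" "b = Suc b'"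
    by (metis not0_implies_Suc)
  then show ?case
  proof cases
    case 3
    have "(B ^^ b) (A u) = 0" "(A ^^ a) (B u) = 0"
      using Suc.prems A B AB funpow_commute[of B A] funpow_commute[of A B] additive_funpow(2)
      by (metis add_0 add_cancel_right_left)+
    then have "(C ^^ (a' + b)) (A u) = 0" "(C ^^ (a + b')) (B u) = 0"
      using Suc.hyps(1)[of a' b "A u"] Suc.hyps(1)[of a b' "B u"] Suc.hyps(2) Suc.prems 3
      by (simp_all only: funpow_Suc_right o_apply)
    moreover have "(C ^^ (a + b)) u = (C ^^ (a' + b)) (A u) - (C ^^ (a + b')) (B u)"
      
    proof -
      have "a + b = Suc (a' + b)" "a + b' = a' + b" using 3 by auto
      moreover have "(C ^^ k) (C u) = (C ^^ k) (A u) - (C ^^ k) (B u)" for k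
        by (subst C) (rule additive_funpow(3)[OF C'])
      ultimately show ?thesis
        by (simp only: funpow_Suc_right o_apply)
    qed
    ultimately show ?thesis by simp
  qed (use Suc.prems in \<open>simp_all add: additive_funpow(2)[OF C']\<close>)
qed

text \<open>The scaling \<open>s\<close> is a parameter so that column vectors and polynomials,
  which carry different scalar multiplications, share one theory.\<close>

definition shift :: "('c \<Rightarrow> 'b \<Rightarrow> 'b::ab_group_add) \<Rightarrow> ('b \<Rightarrow> 'b) \<Rightarrow> 'c \<Rightarrow> 'b \<Rightarrow> 'b" where
  "shift s T l x = T x - s l x"

definition gev :: "('c \<Rightarrow> 'b \<Rightarrow> 'b::ab_group_add) \<Rightarrow> ('b \<Rightarrow> 'b) \<Rightarrow> 'c \<Rightarrow> 'b \<Rightarrow> bool" where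
  "gev s T l x \<longleftrightarrow> (\<exists>k. (shift s T l ^^ k) x = 0)"

section \<open>Linear algebra without finiteness: dependence, functionals, projections, invariant
  subspaces\<close>

context vector_space
begin

text \<open>Coefficients attached to indices instead of vectors also cover a sequence with
  repetitions, where \<open>f i = f j\<close> supplies the coefficients 1 and -1.\<close>

lemma funpow_dependent:
  fixes f :: "nat \<Rightarrow> 'b"
  assumes "finite B" "card B \<le> N" "\<And>k. k \<le> N \<Longrightarrow> f k \<in> span B"
  obtains c where "\<exists>k\<le>N. c k \<noteq> 0" "(\<Sum>k\<le>N. scale (c k) (f k)) = 0"
proof (cases "inj_on f {..N}")
  case False
  then obtain i j where ij: "i \<le> N" "j \<le> N" "i \<noteq> j" "f i = f j"
    by (auto simp: inj_on_def)
  define c :: "nat \<Rightarrow> 'a" where "c k = (if k = i then 1 else 0) - (if k = j then 1 else 0)" for k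
  have "(\<Sum>k\<le>N. scale (c k) (f k)) = (\<Sum>k\<le>N. (if k = i then f k else 0)) - (\<Sum>k\<le>N. (if k = j then f k else 0))"
    unfolding sum_subtractf[symmetric] by (rule sum.cong) (auto simp: c_def)
  also have "\<dots> = 0"
    using ij by simp
  finally show ?thesis
    using ij by (intro that[of c]) (auto simp: c_def intro!: exI[of _ i])
next
  case True
  have "dependent (f ` {..N})"
  proof (rule ccontr)
    assume "\<not> dependent (f ` {..N})"
    then have "card (f ` {..N}) \<le> card B"
      using independent_span_bound[of B "f ` {..N}"] assms by auto
    then show False
      using True assms(2) by (simp add: card_image)
  qed
  then obtain u where u: "\<exists>v\<in>f ` {..N}. u v \<noteq> 0" "(\<Sum>v\<in>f ` {..N}. scale (u v) v) = 0"
    using dependent_finite[of "f ` {..N}"] by auto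
  then have "(\<Sum>k\<le>N. scale (u (f k)) (f k)) = 0"
    using True by (simp add: sum.reindex)
  then show ?thesis
    using u(1) that[of "\<lambda>k. u (f k)"] by auto
qed

text \<open>Turns non-membership in a subspace, typically an ideal, into a scalar equation to which
  polynomial or analytic arguments apply.\<close>

lemma functional_separating:
  assumes "subspace W" "v \<notin> W"
  obtains l where "Vector_Spaces.linear scale (*) l" "\<And>w. w \<in> W \<Longrightarrow> l w = 0" "l v = 1"
proof -
  interpret fs: vector_space "(*) :: 'a \<Rightarrow> 'a \<Rightarrow> 'a"
    by standard (simp_all add: algebra_simps)
  interpret p: vector_space_pair scale "(*) :: 'a \<Rightarrow> 'a \<Rightarrow> 'a" ..
  obtain B where B: "B \<subseteq> W" "independent B" "W \<subseteq> span B"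
    using maximal_independent_subset by blast
  have sB: "span B = W"
    using B assms(1) by (simp add: span_subspace)
  have "independent (insert v B)"
    using B(2) assms(2) sB by (intro independent_insertI) auto
  then obtain l where l: "Vector_Spaces.linear scale (*) l" "\<And>x. x \<in> insert v B \<Longrightarrow> l x = (if x = v then 1 else 0)"
    using p.linear_independent_extend[of "insert v B" "\<lambda>x. if x = v then 1 else 0"] by blast
  interpret l: Vector_Spaces.linear scale "(*)" l by fact
  have "l w = 0" if "w \<in> W" for w
  proof -
    have "w \<in> span B" using that sB by simp
    then show ?thesis
    proof (induction rule: span_induct_alt)
      case (step c x y)
      have "x \<noteq> v" using step(1) B(1) assms(2) by auto
      then show ?case using step l(2)[of x] by (simp add: l.add l.scale)
    qed (simp add: l.zero)
  qed
  then show ?thesis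
    using that l by auto
qed

lemma independent_Un:
  assumes "independent B" "independent C" "span B \<inter> span C = {0}"
  shows "independent (B \<union> C)"
proof -
  have "a \<notin> span (B \<union> C - {a})"
    if "a \<in> B" "independent B" "span B \<inter> span C = {0}" for a and B C :: "'b set"
  proof
    assume "a \<in> span (B \<union> C - {a})"
    then have "a \<in> span ((B - {a}) \<union> C)"
      by (rule span_mono[THEN subsetD, rotated]) auto
    then obtain b c where bc: "a = b + c" "b \<in> span (B - {a})" "c \<in> span C"
      unfolding span_Un by blast
    have "b \<in> span B"
      using bc(2) span_mono[of "B - {a}" B] by blast
    then have "a - b \<in> span B"
      by (rule span_diff[OF span_base[OF that(1)]])
    then have "c = 0"
      using bc that(3) by auto
    then show False
      using bc that(1,2) by (auto simp: dependent_def)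
  qed
  from this[of _ B C] this[of _ C B] show ?thesis
    using assms by (auto simp: dependent_def Un_commute Int_commute)
qed

text \<open>\<open>V\<close> and \<open>W\<close> may fail to span the space. The range clause keeps
  the values in \<open>V\<close> even at arguments outside \<open>V + W\<close>, as the Fitting
  projections will require on matrices outside the Lie algebra.\<close>

lemma projection_along:
  assumes "subspace V" "subspace W" "V \<inter> W = {0}"
  obtains p where "Vector_Spaces.linear scale scale p" "\<And>v. v \<in> V \<Longrightarrow> p v = v"
    "\<And>w. w \<in> W \<Longrightarrow> p w = 0" "range p \<subseteq> V"
proof -
  interpret p: vector_space_pair scale scale ..
  obtain B where B: "B \<subseteq> V" "independent B" "V \<subseteq> span B"
    using maximal_independent_subset by blast
  obtain C where C: "C \<subseteq> W" "independent C" "W \<subseteq> span C"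
    using maximal_independent_subset by blast
  have sp: "span B = V" "span C = W"
    using B C assms by (simp_all add: span_subspace)
  have BC: "B \<inter> C = {}"
  proof -
    have "B \<inter> C \<subseteq> {0}"
      using B(1) C(1) assms(3) by auto
    moreover have "0 \<notin> B"
      using B(2) dependent_zero by auto
    ultimately show ?thesis by auto
  qed
  have "independent (B \<union> C)"
    using B(2) C(2) assms(3) sp by (intro independent_Un) auto
  then obtain p where p: "Vector_Spaces.linear scale scale p"
    "\<And>x. x \<in> B \<union> C \<Longrightarrow> p x = (if x \<in> B then x else 0)"
    and rp: "range p = span ((\<lambda>x. if x \<in> B then x else 0) ` (B \<union> C))"
    using p.linear_independent_extend_subspace[of "B \<union> C" "\<lambda>x. if x \<in> B then x else 0"] by blast
  interpret l: Vector_Spaces.linear scale scale p by fact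
  have "p v = v" if "v \<in> span B" for v
    using that
    by (induction rule: span_induct_alt) (simp_all add: l.zero l.add l.scale p(2))
  moreover have "p w = 0" if "w \<in> span C" for w
    using that
  proof (induction rule: span_induct_alt)
    case (step c x y)
    then show ?case using p(2)[of x] BC by (auto simp add: l.add l.scale)
  qed (simp add: l.zero)
  moreover have "range p \<subseteq> span B"
    unfolding rp by (intro span_minimal) (auto intro: span_base span_zero)
  ultimately show ?thesis
    using that p(1) sp by metis
qed

lemma shift_linear:
  assumes "Vector_Spaces.linear scale scale T"
  shows "Vector_Spaces.linear scale scale (shift scale T l)"
proof -
  interpret T: Vector_Spaces.linear scale scale T by fact
  show ?thesis
    by unfold_locales (simp_all add: shift_def T.add T.scale algebra_simps)
qed

lemma funpow_linear:
  assumes "Vector_Spaces.linear scale scale T"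
  shows "Vector_Spaces.linear scale scale (T ^^ k)"
proof -
  interpret T: Vector_Spaces.linear scale scale T by fact
  have "(T ^^ k) (x + y) = (T ^^ k) x + (T ^^ k) y" "(T ^^ k) (scale c x) = scale c ((T ^^ k) x)" for x y c
    by (induction k) (simp_all add: T.add T.scale)
  then show ?thesis
    by unfold_locales
qed

lemma funpow_in_subspace:
  "(\<And>w. w \<in> W \<Longrightarrow> T w \<in> W) \<Longrightarrow> w \<in> W \<Longrightarrow> (T ^^ k) w \<in> W"
  by (induction k) auto

lemma shift_commute:
  assumes "Vector_Spaces.linear scale scale T"
  shows "shift scale T l (shift scale T m x) = shift scale T m (shift scale T l x)"
proof -
  interpret T: Vector_Spaces.linear scale scale T by fact
  show ?thesis
    by (simp add: shift_def T.diff T.scale algebra_simps)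
qed

context
  fixes T W
  assumes T: "Vector_Spaces.linear scale scale T" and W: "subspace W" and TW: "\<And>w. w \<in> W \<Longrightarrow> T w \<in> W"
begin

lemma shift_in_subspace: "w \<in> W \<Longrightarrow> shift scale T l w \<in> W"
  unfolding shift_def by (intro subspace_diff[OF W] subspace_scale[OF W] TW)

text \<open>This is the injectivity of \<open>T - m\<close> on the generalized eigenspace for
  \<open>l\<close>, phrased modulo an invariant \<open>W\<close> so that no quotient is formed. The
  two shifts of \<open>u\<close> differ by \<open>(l - m) u\<close>.\<close>

lemma in_subspace_if_shift_in_subspace:
  "(shift scale T l ^^ k) u = 0 \<Longrightarrow> shift scale T m u \<in> W \<Longrightarrow> m \<noteq> l \<Longrightarrow> u \<in> W"
proof (induction k arbitrary: u)
  case 0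
  then show ?case using subspace_0[OF W] by simp
next
  case (Suc k)
  have "shift scale T l u \<in> W"
  proof (rule Suc.IH)
    show "(shift scale T l ^^ k) (shift scale T l u) = 0"
      using Suc.prems(1) by (simp add: funpow_swap1)
    show "shift scale T m (shift scale T l u) \<in> W"
      using shift_in_subspace[OF Suc.prems(2)] by (simp add: shift_commute[OF T])
  qed (fact Suc.prems)
  then have "shift scale T m u - shift scale T l u \<in> W"
    using Suc.prems(2) by (intro subspace_diff[OF W])
  then have "scale (l - m) u \<in> W"
    by (simp add: shift_def scale_left_diff_distrib)
  then have "scale (inverse (l - m)) (scale (l - m) u) \<in> W"
    by (rule subspace_scale[OF W])
  then show ?case using Suc.prems(3) by simp
qed

lemma gev_funpow_shift:
  assumes "gev scale T l u"
  shows "gev scale T l ((shift scale T m ^^ j) u)"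
proof -
  obtain k where "(shift scale T l ^^ k) u = 0"
    using assms by (auto simp: gev_def)
  moreover have "(shift scale T l ^^ k) ((shift scale T m ^^ j) u) = (shift scale T m ^^ j) ((shift scale T l ^^ k) u)"
    by (rule funpow_commute, rule funpow_commute[symmetric], rule shift_commute[OF T])
  ultimately show ?thesis
    using module_hom.zero[OF Vector_Spaces.linear.axioms(3)[OF funpow_linear[OF shift_linear[OF T]]]]
    by (auto simp: gev_def)
qed

lemma gev_in_subspace_if_funpow_shift:
  "gev scale T l u \<Longrightarrow> (shift scale T m ^^ j) u \<in> W \<Longrightarrow> m \<noteq> l \<Longrightarrow> u \<in> W"
proof (induction j)
  case (Suc j)
  have "gev scale T l ((shift scale T m ^^ j) u)"
    by (rule gev_funpow_shift) fact
  then have "(shift scale T m ^^ j) u \<in> W"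
    using in_subspace_if_shift_in_subspace Suc.prems(2,3) by (auto simp: gev_def)
  then show ?case using Suc by blast
qed simp

text \<open>A power of \<open>T - m\<close> kills the component for \<open>m\<close>; the induction
  hypothesis puts the images of the others into \<open>W\<close>, and they can be pulled back
  because their eigenvalues differ from \<open>m\<close>. Later \<open>W\<close> is an ideal, a
  joint eigenspace or another generalized eigenspace.\<close>

lemma gev_components_in_subspace:
  assumes "finite L" "\<And>l. l \<in> L \<Longrightarrow> gev scale T l (u l)" "(\<Sum>l\<in>L. u l) \<in> W" "l \<in> L"
  shows "u l \<in> W"
  using assms
proof (induction L arbitrary: u l rule: finite_induct)
  case (insert m L)
  obtain k where k: "(shift scale T m ^^ k) (u m) = 0"
    using insert.prems(1)[of m] by (auto simp: gev_def)
  interpret S: Vector_Spaces.linear scale scale "shift scale T m ^^ k"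
    by (intro funpow_linear shift_linear T)
  have "(shift scale T m ^^ k) (\<Sum>l\<in>insert m L. u l) \<in> W"
    using insert.prems(2) by (intro funpow_in_subspace[where T = "shift scale T m" and W = W] shift_in_subspace)
  then have "(\<Sum>l\<in>L. (shift scale T m ^^ k) (u l)) \<in> W"
    using insert.hyps by (simp add: S.add S.sum k)
  then have Sl: "(shift scale T m ^^ k) (u l) \<in> W" if "l \<in> L" for l
    using insert.IH[of "\<lambda>l. (shift scale T m ^^ k) (u l)"] insert.prems(1) that gev_funpow_shift by auto
  have L: "u l \<in> W" if "l \<in> L" for l
  proof -
    have "m \<noteq> l" using insert.hyps that by auto
    then show ?thesis
      using gev_in_subspace_if_funpow_shift[OF insert.prems(1)[of l] Sl[OF that]] that by simp
  qed
  then have "(\<Sum>l\<in>L. u l) \<in> W"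
    by (rule subspace_sum[OF W])
  then have "(\<Sum>l\<in>insert m L. u l) - (\<Sum>l\<in>L. u l) \<in> W"
    using insert.prems(2) by (intro subspace_diff[OF W])
  then have "u m \<in> W"
    using insert.hyps by simp
  then show ?case using L insert.prems(3) by auto
qed simp

end

lemma span_Union_decompose:
  assumes "\<And>l. subspace (E l)" "v \<in> span (\<Union>l. E l)"
  obtains L u where "finite L" "\<And>l. l \<in> L \<Longrightarrow> u l \<in> E l" "v = (\<Sum>l\<in>L. u l)"
proof -
  have "\<exists>L u. finite L \<and> (\<forall>l\<in>L. u l \<in> E l) \<and> v = (\<Sum>l\<in>L. u l)"
    using assms(2)
  proof (induction rule: span_induct_alt)
    case base
    show ?case by (intro exI[of _ "{}"]) simp
  next
    case (step c x y)
    obtain L u where L: "finite L" "\<forall>l\<in>L. u l \<in> E l" "y = (\<Sum>l\<in>L. u l)"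
      using step.IH by blast
    obtain m where m: "x \<in> E m" using step.hyps by blast
    define u' where "u' l = (if l \<in> L then u l else 0) + (if l = m then scale c x else 0)" for l
    have "(\<Sum>l\<in>insert m L. u' l) = (\<Sum>l\<in>insert m L. if l \<in> L then u l else 0) + scale c x"
      using L(1) by (simp add: u'_def sum.distrib)
    also have "(\<Sum>l\<in>insert m L. if l \<in> L then u l else 0) = y"
      unfolding L(3) by (intro sum.mono_neutral_cong_right) (use L in auto)
    finally have "scale c x + y = (\<Sum>l\<in>insert m L. u' l)" by simp
    moreover have "u' l \<in> E l" if "l \<in> insert m L" for l
      using L(2) m that assms(1) by (auto simp: u'_def intro!: subspace_add subspace_scale subspace_0)
    ultimately show ?case
      using L(1) by (intro exI[of _ "insert m L"] exI[of _ u']) auto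
  qed
  then show ?thesis using that by blast
qed

lemma gev_subspace:
  assumes "Vector_Spaces.linear scale scale T"
  shows "subspace {u. gev scale T l u}"
proof (rule subspaceI)
  note lin = shift_linear[OF assms, of l]
  interpret S: Vector_Spaces.linear scale scale "shift scale T l" by fact
  have Sk: "Vector_Spaces.linear scale scale (shift scale T l ^^ k)" for k
    by (intro funpow_linear lin)
  show "0 \<in> {u. gev scale T l u}"
    by (auto simp: gev_def intro: exI[of _ 0])
  fix x y c assume x: "x \<in> {u. gev scale T l u}" 
  show "scale c x \<in> {u. gev scale T l u}"
    using x by (auto simp: gev_def module_hom.scale[OF Vector_Spaces.linear.axioms(3)[OF Sk]] intro: exI)
  assume "y \<in> {u. gev scale T l u}"
  then obtain i j where "(shift scale T l ^^ i) x = 0" "(shift scale T l ^^ j) y = 0"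
    using x by (auto simp: gev_def)
  then have "(shift scale T l ^^ (i + j)) x = 0" "(shift scale T l ^^ (i + j)) y = 0"
    by (auto intro: funpow_eq_0_mono S.add)
  then have "(shift scale T l ^^ (i + j)) (x + y) = 0"
    by (simp add: additive_funpow(1)[OF S.add])
  then show "x + y \<in> {u. gev scale T l u}"
    by (auto simp: gev_def)
qed

end

text \<open>Since \<open>(m - l) u = (T - l) u - (T - m) u\<close> and \<open>(T - m) u\<close> has
  a smaller nilpotency exponent, the induction hypothesis writes the second term as an image under
  \<open>T - l\<close> as well.\<close>

lemma (in vector_space) gev_shift_solve:
  assumes T: "Vector_Spaces.linear scale scale T" and "m \<noteq> l"
  shows "(shift scale T m ^^ k) u = 0 \<Longrightarrow> \<exists>w. gev scale T m w \<and> shift scale T l w = u"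
proof (induction k arbitrary: u)
  case 0
  interpret S: Vector_Spaces.linear scale scale "shift scale T l" by (rule shift_linear[OF T])
  show ?case
    using 0 by (intro exI[of _ 0]) (auto simp: S.zero gev_def intro: exI[of _ 0])
next
  case (Suc k)
  interpret S: Vector_Spaces.linear scale scale "shift scale T l" by (rule shift_linear[OF T])
  note sub = gev_subspace[OF T, of m]
  have "(shift scale T m ^^ k) (shift scale T m u) = 0"
    using Suc.prems by (simp add: funpow_swap1)
  then obtain w where w: "gev scale T m w" "shift scale T l w = shift scale T m u"
    using Suc.IH by blast
  let ?w = "scale (inverse (m - l)) (u - w)"
  have "gev scale T m u"
    using Suc.prems by (auto simp: gev_def simp del: funpow.simps)
  then have "gev scale T m ?w"
    using w(1) subspace_scale[OF sub subspace_diff[OF sub]] by simp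
  moreover have "shift scale T l ?w = scale (inverse (m - l)) (shift scale T l u - shift scale T m u)"
    by (simp add: S.scale S.diff w(2))
  moreover have "shift scale T l u - shift scale T m u = scale (m - l) u"
    by (simp add: shift_def scale_left_diff_distrib)
  ultimately show ?case
    using assms(2) by (intro exI[of _ ?w]) simp
qed

section \<open>Generalized eigenvectors span complex n-space\<close>

definition poly_apply :: "(complex^'n::finite \<Rightarrow> complex^'n) \<Rightarrow> complex poly \<Rightarrow> complex^'n \<Rightarrow> complex^'n" where
  "poly_apply T p v = (\<Sum>k\<le>degree p. coeff p k *s (T ^^ k) v)"

lemma poly_apply_bound:
  assumes "degree p \<le> n"
  shows "poly_apply T p v = (\<Sum>k\<le>n. coeff p k *s (T ^^ k) v)"
  unfolding poly_apply_def
  by (rule sum.mono_neutral_left) (use assms in \<open>auto simp: coeff_eq_0\<close>)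

lemma poly_apply_linear_factor:
  assumes "Vector_Spaces.linear (*s) (*s) T"
  shows "poly_apply T ([:-l, 1:] * q) v = poly_apply T q (shift (*s) T l v)"
proof -
  let ?n = "degree q"
  have lin: "Vector_Spaces.linear (*s) (*s) (T ^^ k)" for k
    by (rule vec.funpow_linear[OF assms])
  have e: "(T ^^ k) (shift (*s) T l v) = (T ^^ Suc k) v - l *s (T ^^ k) v" for k
    by (simp add: shift_def funpow_swap1 module_hom.diff[OF Vector_Spaces.linear.axioms(3)[OF lin]]
        module_hom.scale[OF Vector_Spaces.linear.axioms(3)[OF lin]])
  have "degree ([:-l, 1:] * q) \<le> Suc ?n"
    using degree_mult_le[of "[:-l, 1:]" q] by simp
  then have "poly_apply T ([:-l, 1:] * q) v
      = (\<Sum>k\<le>Suc ?n. coeff ([:-l, 1:] * q) k *s (T ^^ k) v)"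
    by (rule poly_apply_bound)
  also have "\<dots> = (\<Sum>k\<le>Suc ?n. coeff (pCons 0 q) k *s (T ^^ k) v) - l *s (\<Sum>k\<le>Suc ?n. coeff q k *s (T ^^ k) v)"
    by (simp add: sum_subtractf[symmetric] vec.scale_sum_right vec.scale_left_diff_distrib sum.distrib sum_negf vec.scale_left_distrib)
  also have "(\<Sum>k\<le>Suc ?n. coeff (pCons 0 q) k *s (T ^^ k) v) = (\<Sum>k\<le>?n. coeff q k *s (T ^^ Suc k) v)"
    by (subst sum.atMost_Suc_shift) simp
  also have "(\<Sum>k\<le>Suc ?n. coeff q k *s (T ^^ k) v) = (\<Sum>k\<le>?n. coeff q k *s (T ^^ k) v)"
    by (simp add: coeff_eq_0)
  finally show ?thesis
    unfolding poly_apply_def e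
    by (simp add: sum_subtractf[symmetric] vec.scale_sum_right vec.scale_right_diff_distrib mult.commute)
qed

text \<open>Each vector is annihilated by some nonzero \<open>p(T)\<close>, as \<open>n + 1\<close>
  iterates are dependent. Splitting a root \<open>l\<close> off \<open>p\<close> puts
  \<open>(T - l) v\<close> into the span by induction on the degree, and it remains to undo one
  application of \<open>T - l\<close>.\<close>

lemma span_gev:
  fixes T :: "complex^'n::finite \<Rightarrow> complex^'n"
  assumes T: "Vector_Spaces.linear (*s) (*s) T"
  shows "vec.span {u. \<exists>l. gev (*s) T l u} = UNIV"
proof -
  let ?G = "{u. \<exists>l. gev (*s) T l u}"
  \<comment> \<open>Modulo the image of the span under \<open>T - l\<close> only components for the
    eigenvalue \<open>l\<close> survive, because \<open>T - l\<close> is onto on the other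
    generalized eigenspaces.\<close>
  have split: "\<exists>w\<in>vec.span ?G. gev (*s) T l (u - shift (*s) T l w)" if "u \<in> vec.span ?G" for u l
    using that
  proof (induction rule: vec.span_induct_alt)
    case base
    show ?case
      by (intro bexI[of _ 0]) (auto simp: gev_def shift_def vec.span_zero
          module_hom.zero[OF Vector_Spaces.linear.axioms(3)[OF T]] intro: exI[of _ 0])
  next
    case (step c x y)
    interpret S: Vector_Spaces.linear "(*s)" "(*s)" "shift (*s) T l" by (rule vec.shift_linear[OF T])
    note sub = vec.gev_subspace[OF T, of l]
    obtain w where w: "w \<in> vec.span ?G" "gev (*s) T l (y - shift (*s) T l w)"
      using step.IH by blast
    obtain m where m: "gev (*s) T m x" using step.hyps by blast
    have "\<exists>z\<in>vec.span ?G. gev (*s) T l (x - shift (*s) T l z)"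
    proof (cases "m = l")
      case True
      then show ?thesis using m by (intro bexI[of _ 0]) (auto simp: S.zero vec.span_zero)
    next
      case False
      then obtain z where z: "gev (*s) T m z" "shift (*s) T l z = x"
        using m vec.gev_shift_solve[OF T False] unfolding gev_def by blast
      then show ?thesis
        using vec.subspace_0[OF sub] by (intro bexI[of _ z]) (auto intro: vec.span_base)
    qed
    then obtain z where z: "z \<in> vec.span ?G" "gev (*s) T l (x - shift (*s) T l z)" by blast
    have "gev (*s) T l (c *s (x - shift (*s) T l z) + (y - shift (*s) T l w))"
      using vec.subspace_add[OF sub vec.subspace_scale[OF sub], of "x - shift (*s) T l z" "y - shift (*s) T l w" c]
        z(2) w(2) by (simp only: mem_Collect_eq)
    also have "c *s (x - shift (*s) T l z) + (y - shift (*s) T l w) = c *s x + y - shift (*s) T l (c *s z + w)"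
      by (simp add: S.add S.scale vec.scale_right_diff_distrib)
    finally show ?case
      using z(1) w(1) by (intro bexI[of _ "c *s z + w"]) (auto intro: vec.span_add vec.span_scale)
  qed
  have main: "v \<in> vec.span ?G" if "p \<noteq> 0" "poly_apply T p v = 0" "degree p = n" for p v n
    using that
  proof (induction n arbitrary: p v)
    case 0
    then obtain c where "p = [:c:]" by (metis degree_eq_zeroE)
    with 0 have "v = 0" by (simp add: poly_apply_def)
    then show ?case by (simp add: vec.span_zero)
  next
    case (Suc n)
    obtain l where "poly p l = 0"
      using Suc.prems fundamental_theorem_of_algebra[of p] by (auto simp: constant_degree)
    then obtain q where q: "p = [:-l, 1:] * q"
      by (auto simp: poly_eq_0_iff_dvd)
    have "q \<noteq> 0" using Suc.prems q by auto
    then have "degree q = n"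
      using Suc.prems(3) q degree_mult_eq[of "[:-l, 1:]" q] by simp
    moreover have "poly_apply T q (shift (*s) T l v) = 0"
      using Suc.prems(2) unfolding q poly_apply_linear_factor[OF T] .
    ultimately have "shift (*s) T l v \<in> vec.span ?G"
      using Suc.IH \<open>q \<noteq> 0\<close> by blast
    then obtain w where w: "w \<in> vec.span ?G" "gev (*s) T l (shift (*s) T l v - shift (*s) T l w)"
      using split by blast
    interpret S: Vector_Spaces.linear "(*s)" "(*s)" "shift (*s) T l" by (rule vec.shift_linear[OF T])
    obtain k where "(shift (*s) T l ^^ k) (shift (*s) T l (v - w)) = 0"
      using w(2) by (auto simp: gev_def S.diff)
    then have "(shift (*s) T l ^^ Suc k) (v - w) = 0"
      by (simp add: funpow_swap1)
    then have "v - w \<in> vec.span ?G"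
      unfolding gev_def by (intro vec.span_base) blast
    then have "v - w + w \<in> vec.span ?G"
      using w(1) by (rule vec.span_add)
    then show ?case by simp
  qed
  have "v \<in> vec.span ?G" for v
  proof -
    let ?N = "CARD('n)"
    have "card (cart_basis :: (complex^'n) set) \<le> ?N"
      using vec_dim_card[where 'n='n and 'a=complex] by simp
    then obtain c where c: "\<exists>k\<le>?N. c k \<noteq> 0" "(\<Sum>k\<le>?N. c k *s (T ^^ k) v) = 0"
      using vec.funpow_dependent[of cart_basis ?N "\<lambda>k. (T ^^ k) v"] by (auto simp: finite_cart_basis)
    define p where "p = (\<Sum>k\<le>?N. monom (c k) k)"
    have cp: "coeff p k = (if k \<le> ?N then c k else 0)" for k
      unfolding p_def coeff_sum by (simp add: if_distrib cong: if_cong)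
    then have "p \<noteq> 0" using c(1) by (metis coeff_0)
    moreover have "degree p \<le> ?N"
      using cp by (intro degree_le) auto
    then have "poly_apply T p v = (\<Sum>k\<le>?N. coeff p k *s (T ^^ k) v)"
      by (rule poly_apply_bound)
    then have "poly_apply T p v = 0"
      using c(2) by (simp add: cp)
    ultimately show ?thesis using main by blast
  qed
  then show ?thesis by blast
qed

section \<open>Diagonalizable and nilpotent matrices\<close>

lemma invertible_inv:
  fixes P :: "'n::finite cmat"
  assumes "invertible P"
  shows "P ** matrix_inv P = mat 1" "matrix_inv P ** P = mat 1" "invertible (matrix_inv P)"
proof -
  have "\<exists>Q. P ** Q = mat 1 \<and> Q ** P = mat 1"
    using assms by (simp add: invertible_def)
  then have "P ** matrix_inv P = mat 1 \<and> matrix_inv P ** P = mat 1"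
    unfolding matrix_inv_def by (rule someI_ex)
  then show "P ** matrix_inv P = mat 1" "matrix_inv P ** P = mat 1" "invertible (matrix_inv P)"
    by (auto simp: invertible_def)
qed

lemma matrix_inv_unique:
  fixes P :: "'n::finite cmat"
  assumes "P ** Q = mat 1"
  shows "matrix_inv P = Q"
proof -
  have "invertible P"
    using assms by (auto simp: invertible_right_inverse)
  then show ?thesis
    by (metis assms invertible_inv(2) matrix_mul_assoc matrix_mul_lid matrix_mul_rid)
qed

lemma matrix_inv_inv:
  fixes P :: "'n::finite cmat"
  shows "invertible P \<Longrightarrow> matrix_inv (matrix_inv P) = P"
  by (intro matrix_inv_unique invertible_inv)

lemma invertible_mul:
  fixes P Q :: "'n::finite cmat"
  assumes "invertible P" "invertible Q"
  shows "invertible (P ** Q)" "matrix_inv (P ** Q) = matrix_inv Q ** matrix_inv P"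
proof -
  have "(P ** Q) ** (matrix_inv Q ** matrix_inv P) = P ** (Q ** matrix_inv Q) ** matrix_inv P"
    by (simp add: matrix_mul_assoc)
  then have *: "(P ** Q) ** (matrix_inv Q ** matrix_inv P) = mat 1"
    by (simp add: invertible_inv assms)
  show "invertible (P ** Q)"
    using * invertible_right_inverse by blast
  show "matrix_inv (P ** Q) = matrix_inv Q ** matrix_inv P"
    by (rule matrix_inv_unique) fact
qed

definition conjm :: "'n::finite cmat \<Rightarrow> 'n cmat \<Rightarrow> 'n cmat" where
  "conjm P X = P ** X ** matrix_inv P"

definition diagm :: "('n \<Rightarrow> complex) \<Rightarrow> 'n::finite cmat" where
  "diagm d = (\<chi> i j. if i = j then d i else 0)"

lemma mat_mul_distrib:
  fixes A B C :: "'n::finite cmat"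
  shows "A ** (B + C) = A ** B + A ** C" "(A + B) ** C = A ** C + B ** C"
    "A ** (B - C) = A ** B - A ** C" "(A - B) ** C = A ** C - B ** C"
    "A ** mat_scale c B = mat_scale c (A ** B)" "mat_scale c A ** B = mat_scale c (A ** B)"
    "A ** 0 = 0" "0 ** A = 0"
  by (simp_all add: vec_eq_iff matrix_matrix_mult_def mat_scale_def algebra_simps sum.distrib
      sum_subtractf sum_distrib_left)

lemma mat_scale_nth [simp]: "mat_scale c X $ i $ j = c * X $ i $ j"
  by (simp add: mat_scale_def)

lemma mat_scale_vec: "mat_scale c X *v v = c *s (X *v v)"
  by (simp add: vec_eq_iff matrix_vector_mult_def sum_distrib_left mult.assoc)

lemma conjm_mult:
  assumes "invertible P"
  shows "conjm P (X ** Y) = conjm P X ** conjm P Y"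
proof -
  have "conjm P X ** conjm P Y = P ** X ** (matrix_inv P ** P) ** Y ** matrix_inv P"
    by (simp add: conjm_def matrix_mul_assoc)
  then show ?thesis
    by (simp add: invertible_inv assms conjm_def matrix_mul_assoc)
qed

lemma conjm_linear:
  "conjm P (X + Y) = conjm P X + conjm P Y" "conjm P (X - Y) = conjm P X - conjm P Y"
  "conjm P (mat_scale c X) = mat_scale c (conjm P X)" "conjm P 0 = 0"
  by (simp_all add: conjm_def mat_mul_distrib)

lemma conjm_conjm:
  "invertible P \<Longrightarrow> invertible Q \<Longrightarrow> conjm P (conjm Q X) = conjm (P ** Q) X"
  by (simp add: conjm_def invertible_mul matrix_mul_assoc)

lemma conjm_mat1: "conjm (mat 1) X = X"
  using matrix_inv_unique[of "mat 1" "mat 1 :: 'a cmat"] by (simp add: conjm_def)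

lemma conjm_inv [simp]:
  assumes "invertible P"
  shows "conjm P (conjm (matrix_inv P) X) = X" "conjm (matrix_inv P) (conjm P X) = X"
  by (simp_all add: conjm_conjm assms invertible_inv conjm_mat1)

lemma diagonal_matrix_iff: "diagonal_matrix X \<longleftrightarrow> (\<exists>d. X = diagm d)"
proof
  assume "diagonal_matrix X"
  then have "X = diagm (\<lambda>i. X $ i $ i)"
    by (auto simp: diagonal_matrix_def diagm_def vec_eq_iff)
  then show "\<exists>d. X = diagm d" by blast
qed (auto simp: diagonal_matrix_def diagm_def)

lemma diagonalizable_iff:
  "diagonalizable_matrix X \<longleftrightarrow> (\<exists>P d. invertible P \<and> X = conjm P (diagm d))"
proof
  assume "diagonalizable_matrix X"
  then obtain S d where "invertible S" "conjm S X = diagm d"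
    by (auto simp: diagonalizable_matrix_def diagonal_matrix_iff conjm_def)
  then show "\<exists>P d. invertible P \<and> X = conjm P (diagm d)"
    by (metis conjm_inv(2) invertible_inv(3))
next
  assume "\<exists>P d. invertible P \<and> X = conjm P (diagm d)"
  then obtain P d where "invertible P" "X = conjm P (diagm d)" by blast
  then show "diagonalizable_matrix X"
    unfolding diagonalizable_matrix_def diagonal_matrix_iff
    by (intro exI[of _ "matrix_inv P"]) (auto simp: invertible_inv conjm_def[symmetric])
qed

lemma diagm_mult: "diagm d ** X = (\<chi> i j. d i * X $ i $ j)" "X ** diagm d = (\<chi> i j. X $ i $ j * d j)"
  by (simp_all add: vec_eq_iff diagm_def matrix_matrix_mult_def if_distrib[where f="\<lambda>x. x * _"]
      if_distrib[where f="\<lambda>x. _ * x"] cong: if_cong)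

lemma diagm_vec: "diagm d *v v = (\<chi> i. d i * v $ i)"
  by (simp add: vec_eq_iff diagm_def matrix_vector_mult_def if_distrib[where f="\<lambda>x. x * _"] cong: if_cong)

lemma funpow_matrix_mult: "((**) (X :: 'n::finite cmat) ^^ k) Y = ((**) X ^^ k) (mat 1) ** Y"
  by (induction k) (simp_all add: matrix_mul_assoc)

lemma funpow_matrix_vector: "((**) (X :: 'n::finite cmat) ^^ k) (mat 1) *v v = (((*v) X) ^^ k) v"
  by (induction k) (simp_all flip: matrix_vector_mul_assoc)

text \<open>The passage from a spanning set of ordinary or generalized eigenvectors to a conjugating
  matrix.\<close>

lemma spanning_set_matrix:
  fixes E :: "(complex^'n::finite) set"
  assumes "vec.span E = UNIV"
  obtains P :: "'n cmat" where "invertible P" "\<And>i. column i P \<in> E" "inj (\<lambda>i. column i P)"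
proof -
  obtain B where B: "B \<subseteq> E" "vec.independent B" "E \<subseteq> vec.span B"
    using vec.maximal_independent_subset by blast
  have sB: "vec.span B = UNIV"
    using B(3) assms vec.span_mono[of E "vec.span B"] by (metis top.extremum_uniqueI vec.span_span)
  then have "card B = CARD('n)"
    using vec.dim_span_eq_card_independent[OF B(2)] vec_dim_card[where 'n='n and 'a=complex] by simp
  moreover have "finite B" using B(2) by (rule vec.finiteI_independent)
  ultimately obtain b where b: "bij_betw b (UNIV :: 'n set) B"
    using finite_same_card_bij[of "UNIV :: 'n set" B] by auto
  define P :: "'n cmat" where "P = (\<chi> i j. b j $ i)"
  have c: "column j P = b j" for j
    by (simp add: P_def column_def vec_eq_iff)
  have "columns P = B"
    using b by (auto simp: columns_def c bij_betw_def)
  then have "invertible P"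
    using matrix_right_invertible_span_columns[of P] sB by (simp add: invertible_right_inverse)
  moreover have "column i P \<in> E" for i
    using b B(1) by (auto simp: c bij_betw_def)
  moreover have "inj (\<lambda>i. column i P)"
    using b by (simp add: c bij_betw_def)
  ultimately show ?thesis using that by blast
qed

lemma column_mult: "column i (X ** P) = X *v column i (P :: 'n::finite cmat)"
  by (simp add: column_def matrix_matrix_mult_def matrix_vector_mult_def vec_eq_iff)

lemma matrix_eq_columns: "(\<And>i. column i X = column i Y) \<Longrightarrow> X = (Y :: 'n::finite cmat)"
  by (simp add: column_def vec_eq_iff)

lemma conjm_diagm_if_eigenvectors:
  assumes "invertible P" "\<And>i. X *v column i P = d i *s column i P"
  shows "X = conjm P (diagm d)"
proof -
  have "column i (P ** diagm d) = d i *s column i P" for i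
    by (simp add: diagm_mult column_def vec_eq_iff mult.commute)
  then have "X ** P = P ** diagm d"
    by (intro matrix_eq_columns) (simp add: column_mult assms(2))
  then have "X ** P ** matrix_inv P = conjm P (diagm d)"
    by (simp add: conjm_def)
  then show ?thesis
    by (simp flip: matrix_mul_assoc add: invertible_inv assms(1))
qed

text \<open>The coordinates of \<open>v\<close> in the basis of columns of \<open>P\<close> are
  grouped by eigenvalue, so the components are indexed by distinct values and fit
  \<open>gev_components_in_subspace\<close>.\<close>

lemma conjm_diagm_decompose:
  assumes "invertible P"
  obtains u where "\<And>m. conjm P (diagm d) *v u m = m *s u m" "v = (\<Sum>m\<in>range d. u m)"
    "\<And>m. u m \<in> vec.span {column i P | i. d i = m}"
proof -
  define c where "c = matrix_inv P *v v"
  define u where "u m = P *v (\<chi> i. if d i = m then c $ i else 0)" for m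
  have "conjm P (diagm d) *v u m = m *s u m" for m
  proof -
    have "conjm P (diagm d) *v u m = P *v (diagm d *v ((matrix_inv P ** P) *v (\<chi> i. if d i = m then c $ i else 0)))"
      by (simp add: u_def conjm_def matrix_vector_mul_assoc matrix_mul_assoc)
    also have "\<dots> = P *v (m *s (\<chi> i. if d i = m then c $ i else 0))"
      by (simp add: invertible_inv assms diagm_vec, rule arg_cong[where f="(*v) P"])
        (simp add: vec_eq_iff)
    finally show ?thesis
      by (simp add: u_def vec.scale)
  qed
  moreover have "v = (\<Sum>m\<in>range d. u m)"
  proof -
    have "(\<Sum>m\<in>range d. u m) = P *v (\<Sum>m\<in>range d. (\<chi> i. if d i = m then c $ i else 0))"
      unfolding u_def by (simp add: vec.sum)
    also have "(\<Sum>m\<in>range d. (\<chi> i. if d i = m then c $ i else 0)) = c"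
      by (simp add: vec_eq_iff sum_component)
    also have "P *v c = v"
      by (simp add: c_def matrix_vector_mul_assoc invertible_inv assms)
    finally show ?thesis by simp
  qed
  moreover have "u m \<in> vec.span {column i P | i. d i = m}" for m
    unfolding u_def matrix_mult_sum
  proof (rule vec.span_sum)
    fix i
    show "(\<chi> i. if d i = m then c $ i else 0) $ i *s column i P \<in> vec.span {column i P | i. d i = m}"
    proof (cases "d i = m")
      case True
      then have "column i P \<in> vec.span {column i P | i. d i = m}"
        by (intro vec.span_base) blast
      then show ?thesis using True by (simp add: vec.span_scale)
    qed (simp add: vec.span_zero)
  qed
  ultimately show ?thesis using that by blast
qed


lemma mat1_funpow_eq_0_iff:
  "((**) (X :: 'n::finite cmat) ^^ k) (mat 1) = 0 \<longleftrightarrow> (\<forall>v. (((*v) X) ^^ k) v = 0)"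
  by (simp flip: funpow_matrix_vector add: matrix_eq)

text \<open>The semisimple part gives each vector of a basis of generalized eigenvectors its
  eigenvalue. The point is that it then acts by \<open>l\<close> on the whole generalized eigenspace
  for \<open>l\<close>, not just on the chosen basis vectors: commutation and nilpotency both look
  at its action on images of basis vectors.\<close>

lemma jordan_decomposition:
  fixes X :: "'n::finite cmat"
  obtains P d where "invertible P" "nilpotent_matrix (X - conjm P (diagm d))"
    "X ** conjm P (diagm d) = conjm P (diagm d) ** X"
proof -
  let ?T = "(*v) X"
  note T = matrix_vector_mul_linear_gen[of X]
  obtain P :: "'n cmat" where P: "invertible P" "\<And>i. column i P \<in> {u. \<exists>l. gev (*s) ?T l u}"
    using spanning_set_matrix[OF span_gev[OF T]] by metis
  then have "\<forall>i. \<exists>l. gev (*s) ?T l (column i P)" by simp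
  then obtain d where d: "\<And>i. gev (*s) ?T (d i) (column i P)"
    by metis
  define Y where "Y = conjm P (diagm d)"
  have Y: "Y *v v = l *s v" if v: "gev (*s) ?T l v" for l v
  proof -
    obtain u where u: "\<And>m. Y *v u m = m *s u m" "v = (\<Sum>m\<in>range d. u m)"
      "\<And>m. u m \<in> vec.span {column i P | i. d i = m}"
      by (rule conjm_diagm_decompose[OF P(1), of d v, folded Y_def]) (rule that)
    have gu: "gev (*s) ?T m (u m)" for m
    proof -
      have "vec.span {column i P | i. d i = m} \<subseteq> {x. gev (*s) ?T m x}"
        by (rule vec.span_minimal[OF _ vec.gev_subspace[OF T]]) (use d in auto)
      then show ?thesis using u(3) by blast
    qed
    have inv: "?T w \<in> {x. gev (*s) ?T l x}" if "w \<in> {x. gev (*s) ?T l x}" for w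
    proof -
      have "gev (*s) ?T l ((shift (*s) ?T l ^^ 1) w)"
        using vec.gev_funpow_shift[OF T vec.subspace_UNIV, where m = l and j = 1] that by simp
      then have "shift (*s) ?T l w + l *s w \<in> {x. gev (*s) ?T l x}"
        using that by (intro vec.subspace_add[OF vec.gev_subspace[OF T]] vec.subspace_scale[OF vec.gev_subspace[OF T]]) auto
      then show ?thesis by (simp add: shift_def)
    qed
    \<comment> \<open>The component lies in the generalized eigenspaces for both \<open>m\<close>
      and \<open>l\<close>: the second one contains \<open>v\<close> and is invariant under
      \<open>X\<close>, so it contains the components of \<open>v\<close>.\<close>
    have z: "u m = 0" if "m \<in> range d" "m \<noteq> l" for m
    proof -
      have "u m \<in> {x. gev (*s) ?T l x}"
        by (rule vec.gev_components_in_subspace[OF T vec.gev_subspace[OF T] inv _ gu])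
          (use u(2) v that in auto)
      then obtain j where "(shift (*s) ?T l ^^ j) (u m) = 0" by (auto simp: gev_def)
      then have "u m \<in> {0}"
        using vec.gev_in_subspace_if_funpow_shift[OF T vec.subspace_single_0, where l = m and m = l and j = j and u = "u m"] gu that by auto
      then show ?thesis by simp
    qed
    have "Y *v v = (\<Sum>m\<in>range d. m *s u m)"
      by (subst u(2)) (simp add: vec.sum u(1))
    also have "\<dots> = (\<Sum>m\<in>range d. l *s u m)"
      by (rule sum.cong) (use z in force)+
    also have "\<dots> = l *s v"
      by (simp add: u(2) flip: vec.scale_sum_right)
    finally show ?thesis .
  qed
  have inv: "gev (*s) ?T l (X *v v)" if "gev (*s) ?T l v" for l v
  proof -
    have "gev (*s) ?T l ((shift (*s) ?T 0 ^^ 1) v)"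
      by (rule vec.gev_funpow_shift[OF T vec.subspace_UNIV]) (use that in auto)
    then show ?thesis by (simp add: shift_def)
  qed
  have "column i (X ** Y ** P) = column i (Y ** X ** P)" for i
    using Y[OF d] Y[OF inv[OF d]] by (simp add: column_mult vec.scale flip: matrix_vector_mul_assoc)
  then have "X ** Y ** P = Y ** X ** P"
    by (rule matrix_eq_columns)
  then have "X ** Y ** (P ** matrix_inv P) = Y ** X ** (P ** matrix_inv P)"
    by (simp add: matrix_mul_assoc)
  then have comm: "X ** Y = Y ** X"
    by (simp add: invertible_inv P(1))
  \<comment> \<open>On the generalized eigenspace for \<open>l\<close>, \<open>X - Y\<close>
    coincides with \<open>X - l\<close>.\<close>
  have N: "((*v) (X - Y) ^^ k) v = (shift (*s) ?T l ^^ k) v" if "gev (*s) ?T l v" for l v k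
  proof (induction k)
    case (Suc k)
    have "gev (*s) ?T l ((shift (*s) ?T l ^^ k) v)"
      by (rule vec.gev_funpow_shift[OF T vec.subspace_UNIV]) (use that in auto)
    then have "(X - Y) *v (shift (*s) ?T l ^^ k) v = shift (*s) ?T l ((shift (*s) ?T l ^^ k) v)"
      by (simp only: matrix_vector_mult_diff_rdistrib Y shift_def[of "(*s)" ?T l "(shift (*s) ?T l ^^ k) v"])
    then show ?case
      by (simp only: funpow.simps o_apply Suc)
  qed simp
  have "\<forall>i. \<exists>k. ((*v) (X - Y) ^^ k) (column i P) = 0"
    using d N unfolding gev_def by metis
  then obtain k where k: "\<And>i. ((*v) (X - Y) ^^ k i) (column i P) = 0"
    by metis
  define K where "K = (\<Sum>i\<in>UNIV. k i)"
  have "((*v) (X - Y) ^^ K) (column i P) = 0" for i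
    by (rule funpow_eq_0_mono[OF _ k]) (auto simp: K_def vec.add intro: member_le_sum)
  then have "column i (((**) (X - Y) ^^ K) (mat 1) ** P) = column i 0" for i
    by (simp add: column_mult funpow_matrix_vector) (simp add: column_def vec_eq_iff)
  then have "((**) (X - Y) ^^ K) (mat 1) ** P = 0"
    by (rule matrix_eq_columns)
  then have "((**) (X - Y) ^^ K) (mat 1) ** (P ** matrix_inv P) = 0"
    by (simp add: matrix_mul_assoc mat_mul_distrib)
  then have nil: "nilpotent_matrix (X - Y)"
    by (auto simp: invertible_inv P(1) nilpotent_matrix_def)
  show ?thesis
    by (rule that[OF P(1) nil[unfolded Y_def] comm[unfolded Y_def]])
qed

lemma trace_conjm: "invertible P \<Longrightarrow> trace (conjm P X) = trace X"
  unfolding conjm_def by (subst trace_mul_sym) (simp add: matrix_mul_assoc invertible_inv)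

text \<open>A basis adapted to the kernels of the powers of \<open>N\<close> makes the diagonal of \<open>N\<close> vanish.\<close>

lemma trace_nilpotent:
  fixes N :: "'n::finite cmat"
  assumes "nilpotent_matrix N"
  shows "trace N = 0"
proof -
  \<comment> \<open>Strict triangularity without an ordering: the expansion of \<open>N b\<close>
    avoids \<open>b\<close> itself. The basis is extended from one kernel to the next, and the new
    elements are sent into the span of the old ones.\<close>
  have "\<exists>B. vec.independent B \<and> vec.span B = {v. (((*v) N) ^^ k) v = 0} \<and> (\<forall>b\<in>B. N *v b \<in> vec.span (B - {b}))" for k
  proof (induction k)
    case 0
    show ?case by (intro exI[of _ "{}"]) (auto simp: vec.independent_empty)
  next
    case (Suc k)
    then obtain B where B: "vec.independent B" "vec.span B = {v. (((*v) N) ^^ k) v = 0}"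
      "\<And>b. b \<in> B \<Longrightarrow> N *v b \<in> vec.span (B - {b})" by blast
    let ?K = "{v. (((*v) N) ^^ Suc k) v = 0}"
    have lin: "Vector_Spaces.linear (*s) (*s) ((*v) N ^^ j)" for j
      by (intro vec.funpow_linear matrix_vector_mul_linear_gen)
    interpret L: Vector_Spaces.linear "(*s)" "(*s)" "(*v) N ^^ Suc k" by (rule lin)
    have sub: "vec.subspace ?K"
      by (rule vec.subspaceI) (auto simp del: funpow.simps simp: L.zero L.add L.scale)
    have "B \<subseteq> ?K"
      using B(2) vec.span_superset[of B] by (auto simp: vec.zero)
    then obtain C where C: "B \<subseteq> C" "C \<subseteq> ?K" "vec.independent C" "?K \<subseteq> vec.span C"
      using vec.maximal_independent_subset_extend[of B ?K] B(1) by blast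
    have "vec.span C = ?K"
      using vec.span_minimal[OF C(2) sub] C(4) by blast
    moreover have "N *v b \<in> vec.span (C - {b})" if "b \<in> C" for b
    proof (cases "b \<in> B")
      case True
      then show ?thesis
        using B(3)[OF True] vec.span_mono[of "B - {b}" "C - {b}"] C(1) by blast
    next
      case False
      have "(((*v) N) ^^ k) (N *v b) = 0"
        using that C(2) by (auto simp: funpow_swap1)
      then have "N *v b \<in> vec.span B" using B(2) by simp
      then show ?thesis
        using vec.span_mono[of B "C - {b}"] C(1) False by blast
    qed
    ultimately show ?case using C(3) by blast
  qed
  moreover obtain k where "((**) N ^^ k) (mat 1) = 0"
    using assms by (auto simp: nilpotent_matrix_def)
  then have "{v. (((*v) N) ^^ k) v = 0} = UNIV"
    by (simp add: mat1_funpow_eq_0_iff)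
  ultimately obtain B where B: "vec.independent B" "vec.span B = UNIV" "\<And>b. b \<in> B \<Longrightarrow> N *v b \<in> vec.span (B - {b})"
    by metis
  obtain P :: "'n cmat" where P: "invertible P" "\<And>i. column i P \<in> B" "inj (\<lambda>i. column i P)"
    using spanning_set_matrix[OF B(2)] by metis
  have BP: "B = range (\<lambda>i. column i P)"
  proof -
    have "card (range (\<lambda>i. column i P)) = CARD('n)"
      using P(3) by (simp add: card_image)
    moreover have "card B = CARD('n)"
      using vec.dim_span_eq_card_independent[OF B(1)] B(2) vec_dim_card[where 'n='n and 'a=complex] by simp
    ultimately show ?thesis
      using card_subset_eq[of B "range (\<lambda>i. column i P)"] P(2) vec.finiteI_independent[OF B(1)] by auto
  qed
  have e: "matrix_inv P *v column j P = column j (mat 1)" for j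
    using invertible_inv(2)[OF P(1)] by (simp flip: column_mult)
  have "(matrix_inv P ** N ** P) $ i $ i = 0" for i
  proof -
    \<comment> \<open>The kernel of the \<open>i\<close>-th coordinate in the basis of columns; it
      contains every basis vector except the \<open>i\<close>-th.\<close>
    let ?Z = "{v. (matrix_inv P *v v) $ i = 0}"
    have "vec.subspace ?Z"
      by (rule vec.subspaceI) (auto simp: vec.zero vec.add vec.scale)
    moreover have "B - {column i P} \<subseteq> ?Z"
      by (auto simp: BP e) (auto simp: column_def mat_def)
    ultimately have "vec.span (B - {column i P}) \<subseteq> ?Z"
      by (intro vec.span_minimal)
    then have "(matrix_inv P *v (N *v column i P)) $ i = 0"
      using B(3)[OF P(2)[of i]] by blast
    also have "matrix_inv P *v (N *v column i P) = column i (matrix_inv P ** N ** P)"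
      by (simp add: column_mult matrix_vector_mul_assoc)
    finally show ?thesis by (simp add: column_def)
  qed
  then have "trace (matrix_inv P ** N ** P) = 0"
    by (simp add: trace_def)
  moreover have "matrix_inv P ** N ** P = conjm (matrix_inv P) N"
    by (simp add: conjm_def matrix_inv_inv P(1))
  ultimately show ?thesis
    using trace_conjm[of "matrix_inv P" N] by (simp add: invertible_inv P(1))
qed

lemma mat_scale_eigen_subspace:
  "cmat.subspace {X :: 'n::finite cmat. \<exists>l. X *v v = l *s v}"
proof (rule cmat.subspaceI)
  show "0 \<in> {X :: 'n cmat. \<exists>l. X *v v = l *s v}"
    by (auto intro: exI[of _ 0])
  fix X Y :: "'n cmat" and c assume "X \<in> {X. \<exists>l. X *v v = l *s v}"
  then obtain l where l: "X *v v = l *s v" by blast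
  show "mat_scale c X \<in> {X. \<exists>l. X *v v = l *s v}"
    by (auto simp: mat_scale_vec l intro: exI[of _ "c * l"])
  assume "Y \<in> {X. \<exists>l. X *v v = l *s v}"
  then obtain m where m: "Y *v v = m *s v" by blast
  show "X + Y \<in> {X. \<exists>l. X *v v = l *s v}"
    using l m by (auto simp: matrix_vector_mult_add_rdistrib vec.scale_left_distrib intro!: exI[of _ "l + m"])
qed

section \<open>Matrices as a finite-dimensional complex space, and simultaneous
  diagonalization\<close>

definition matrix_units :: "'n::finite cmat set" where
  "matrix_units = (\<lambda>(i, j). \<chi> k l. if k = i \<and> l = j then 1 else 0) ` UNIV"

lemma matrix_units_expand:
  "X = (\<Sum>(i, j)\<in>UNIV. mat_scale (X $ i $ j) (\<chi> k l. if k = i \<and> l = j then 1 else 0))"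
proof -
  have "(\<Sum>(i, j)\<in>UNIV. mat_scale (X $ i $ j) (\<chi> k l. if k = i \<and> l = j then 1 else 0)) $ a $ b
    = (\<Sum>p\<in>UNIV. if p = (a, b) then X $ a $ b else 0)" for a b
    unfolding sum_component by (rule sum.cong) (auto split: if_splits simp: zero_neq_one)
  then show ?thesis by (simp add: vec_eq_iff)
qed

interpretation cmat: finite_dimensional_vector_space "mat_scale :: complex \<Rightarrow> 'n::finite cmat \<Rightarrow> 'n cmat" matrix_units
proof
  show "finite (matrix_units :: 'n cmat set)"
    by (simp add: matrix_units_def)
  let ?E = "\<lambda>(i, j). (\<chi> k l. if k = i \<and> l = j then 1 else 0) :: 'n cmat"
  have inj: "inj ?E"
  proof (rule injI, safe)
    fix a b c d :: 'n assume "(\<chi> k l. if k = a \<and> l = b then 1 else 0) = ((\<chi> k l. if k = c \<and> l = d then 1 else 0) :: 'n cmat)"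
    then have "(if a = c \<and> b = d then 1 else 0) = (1 :: complex)"
      unfolding vec_eq_iff by (drule_tac spec[of _ a], drule_tac spec[of _ b]) (auto split: if_splits)
    then show "a = c" "b = d" by (auto split: if_splits)
  qed
  show "cmat.independent (matrix_units :: 'n cmat set)"
  proof (rule cmat.independent_if_scalars_zero)
    fix f :: "'n cmat \<Rightarrow> complex" and x :: "'n cmat" assume f: "(\<Sum>x\<in>matrix_units. mat_scale (f x) x) = 0" and x: "x \<in> matrix_units"
    obtain a b where ab: "x = ?E (a, b)" using x by (auto simp: matrix_units_def)
    have "0 = (\<Sum>p\<in>UNIV. mat_scale (f (?E p)) (?E p)) $ a $ b"
      using f inj by (simp add: matrix_units_def sum.reindex)
    also have "\<dots> = (\<Sum>p\<in>UNIV. if p = (a, b) then f (?E p) else 0)"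
      unfolding sum_component by (rule sum.cong) (auto split: if_splits)
    finally show "f x = 0" unfolding ab by simp
  qed (simp add: matrix_units_def)
  show "cmat.span (matrix_units :: 'n cmat set) = UNIV"
  proof -
    have "X \<in> cmat.span matrix_units" for X :: "'n cmat"
    proof (subst matrix_units_expand[of X], rule cmat.span_sum)
      fix p :: "'n \<times> 'n"
      have "?E p \<in> cmat.span matrix_units"
        by (intro cmat.span_base) (simp add: matrix_units_def)
      then show "(case p of (i, j) \<Rightarrow> mat_scale (X $ i $ j) (\<chi> k l. if k = i \<and> l = j then 1 else 0)) \<in> cmat.span matrix_units"
        by (cases p) (auto intro: cmat.span_scale)
    qed
    then show ?thesis by blast
  qed
qed

text \<open>When \<open>X\<close> joins a finite family, the joint eigenspace that contains a common
  eigenvector \<open>v\<close> is invariant under \<open>X\<close>, so it also contains the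
  components of \<open>v\<close> for the eigenvalues of \<open>X\<close>. Infinite families reduce
  to a basis of their span, since being an eigenvector for an unspecified eigenvalue passes to
  linear combinations.\<close>

lemma simultaneous_diagonalization:
  fixes F :: "'n::finite cmat set"
  assumes comm: "\<And>X Y. X \<in> F \<Longrightarrow> Y \<in> F \<Longrightarrow> X ** Y = Y ** X"
    and diag: "\<And>X. X \<in> F \<Longrightarrow> diagonalizable_matrix X"
  obtains P where "invertible P" "\<And>X. X \<in> F \<Longrightarrow> \<exists>d. X = conjm P (diagm d)"
proof -
  let ?J = "\<lambda>F. {v. \<forall>X\<in>F. \<exists>l. X *v v = l *s v}"
  have fin: "vec.span (?J F') = UNIV" if "finite F'" "F' \<subseteq> F" for F'
    using that
  proof (induction rule: finite_induct)
    case (insert X F')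
    have XF: "X \<in> F" using insert.prems by simp
    obtain P d where P: "invertible P" "X = conjm P (diagm d)"
      using diag[OF XF] by (auto simp: diagonalizable_iff)
    have "v \<in> vec.span (?J (insert X F'))" if v: "v \<in> ?J F'" for v
    proof -
      have "\<forall>Y. \<exists>l. Y \<in> F' \<longrightarrow> Y *v v = l *s v" using v by blast
      then obtain \<mu> where \<mu>: "\<And>Y. Y \<in> F' \<Longrightarrow> Y *v v = \<mu> Y *s v" by metis
      define W where "W = {u. \<forall>Y\<in>F'. Y *v u = \<mu> Y *s u}"
      have subW: "vec.subspace W"
        unfolding W_def by (rule vec.subspaceI) (auto simp: vec.add vec.scale vec.scale_right_distrib mult.commute)
      have XW: "X *v w \<in> W" if "w \<in> W" for w
        unfolding W_def
      proof safe
        fix Y assume Y: "Y \<in> F'"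
        then have "Y *v (X *v w) = X *v (Y *v w)"
          using comm[OF XF, of Y] insert.prems by (auto simp: matrix_vector_mul_assoc)
        then show "Y *v (X *v w) = \<mu> Y *s (X *v w)"
          using Y that by (simp add: W_def vec.scale)
      qed
      obtain u where u: "\<And>m. X *v u m = m *s u m" "v = (\<Sum>m\<in>range d. u m)"
        by (rule conjm_diagm_decompose[OF P(1), of d v, folded P(2)]) (rule that)
      have g: "gev (*s) ((*v) X) m (u m)" for m
        unfolding gev_def by (intro exI[of _ 1]) (simp add: shift_def u)
      have "u m \<in> W" if "m \<in> range d" for m
        by (rule vec.gev_components_in_subspace[OF matrix_vector_mul_linear_gen subW XW _ g])
          (use that u(2) \<mu> in \<open>auto simp: W_def\<close>)
      then have "u m \<in> ?J (insert X F')" if "m \<in> range d" for m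
        using that u(1) unfolding W_def by blast
      then show ?thesis
        unfolding u(2) by (intro vec.span_sum vec.span_base) auto
    qed
    then have "vec.span (?J F') \<subseteq> vec.span (?J (insert X F'))"
      by (intro vec.span_minimal vec.subspace_span) blast
    then show ?case using insert by auto
  qed simp
  obtain B where B: "B \<subseteq> F" "cmat.independent B" "F \<subseteq> cmat.span B"
    using cmat.maximal_independent_subset by blast
  have "finite B" using B(2) by (rule cmat.finiteI_independent)
  then have sJ: "vec.span (?J B) = UNIV" using fin B(1) by blast
  obtain P :: "'n cmat" where P: "invertible P" "\<And>i. column i P \<in> ?J B"
    by (rule spanning_set_matrix[OF sJ]) (rule that)
  have "\<exists>d. X = conjm P (diagm d)" if "X \<in> F" for X
  proof -
    have "\<exists>l. X *v column i P = l *s column i P" for i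
    proof -
      have "cmat.span B \<subseteq> {X. \<exists>l. X *v column i P = l *s column i P}"
        by (rule cmat.span_minimal[OF _ mat_scale_eigen_subspace]) (use P(2) in auto)
      then show ?thesis using B(3) that by blast
    qed
    then obtain d where d: "\<And>i. X *v column i P = d i *s column i P" by metis
    show ?thesis by (intro exI[of _ d] conjm_diagm_if_eigenvectors[OF P(1)] d)
  qed
  then show ?thesis using that P(1) by blast
qed

section \<open>Substitutions and linear derivations of polynomials\<close>

lemma cconst_simps:
  "cconst (a + b) = cconst a + cconst b" "cconst (a - b) = cconst a - cconst b" "cconst (- a) = - cconst a"
  "cconst (a * b) = cconst a * cconst b" "cconst 0 = 0" "cconst 1 = 1"
  by (simp_all add: cconst_def single_add single_diff mult_single single_uminus)

lemma cconst_sum: "cconst (sum f A) = (\<Sum>x\<in>A. cconst (f x))"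
  by (induction A rule: infinite_finite_induct) (simp_all add: cconst_simps)

interpretation cpoly: vector_space "\<lambda>c (f :: 'k::finite cpoly). cconst c * f"
  by standard (simp_all add: cconst_simps algebra_simps)

lemma mono_eq_prod: "Poly_Mapping.single a 1 = (\<Prod>i\<in>UNIV. cvar i ^ Poly_Mapping.lookup a i)"
  for a :: "'k::finite \<Rightarrow>\<^sub>0 nat"
proof -
  have pw: "cvar i ^ k = Poly_Mapping.single (Poly_Mapping.single i k) 1" for i :: 'k and k
    by (induction k) (simp_all add: cvar_def mult_single flip: single_add)
  have "(\<Prod>i\<in>A. cvar i ^ Poly_Mapping.lookup a i) = Poly_Mapping.single (\<Sum>i\<in>A. Poly_Mapping.single i (Poly_Mapping.lookup a i)) 1"
    if "finite A" for A
    using that by (induction A) (simp_all add: pw mult_single)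
  moreover have "(\<Sum>i\<in>UNIV. Poly_Mapping.single i (Poly_Mapping.lookup a i)) = a"
    by (rule poly_mapping_eqI) (simp add: lookup_sum lookup_single when_def)
  ultimately show ?thesis by simp
qed

lemma single_eq_cconst_mult: "Poly_Mapping.single a c = cconst c * Poly_Mapping.single a 1"
  by (simp add: cconst_def mult_single)

lemma cpoly_monomial_induct [case_names zero add]:
  assumes "P 0" "\<And>a c f. P f \<Longrightarrow> P (Poly_Mapping.single a c + f)"
  shows "P (f :: 'k::finite cpoly)"
proof (induction f rule: update_induct)
  case const
  then show ?case by (simp add: assms)
next
  case (update f a c)
  have "Poly_Mapping.update a c f = Poly_Mapping.single a c + f"
    by (rule poly_mapping_eqI)
      (use update.hyps in \<open>auto simp: lookup_update lookup_add lookup_single when_def in_keys_iff\<close>)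
  then show ?case using assms update by simp
qed

lemma cpoly_expand: "f = (\<Sum>a\<in>Poly_Mapping.keys f. cconst (Poly_Mapping.lookup f a) * Poly_Mapping.single a 1)"
  by (rule poly_mapping_eqI)
    (simp add: lookup_sum single_eq_cconst_mult[symmetric] lookup_single when_def in_keys_iff)

lemma cpoly_induct [case_names const var add mult]:
  assumes const: "\<And>c. P (cconst c)" and var: "\<And>i. P (cvar i)"
    and add: "\<And>f g. P f \<Longrightarrow> P g \<Longrightarrow> P (f + g)" and mult: "\<And>f g. P f \<Longrightarrow> P g \<Longrightarrow> P (f * g)"
  shows "P (f :: 'k::finite cpoly)"
proof (rule cpoly_monomial_induct[of P])
  show "P 0" using const[of 0] by (simp add: cconst_simps)
next
  fix a c f assume "P f"
  have 1: "P 1" using const[of 1] by (simp add: cconst_simps)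
  have pw: "P (cvar i ^ k)" for i k
    by (induction k) (simp_all add: 1 mult var)
  have "P (\<Prod>i\<in>A. cvar i ^ Poly_Mapping.lookup a i)" if "finite A" for A
    using that by (induction A) (simp_all add: 1 mult pw)
  then show "P (Poly_Mapping.single a c + f)"
    using \<open>P f\<close> unfolding single_eq_cconst_mult[of a c] mono_eq_prod by (intro add mult const) auto
qed

text \<open>Instantiated twice: \<open>sub\<close> substitutes linear forms into polynomials, and
  \<open>eps_sub\<close> takes values in polynomials in one more variable.\<close>

locale subst_hom =
  fixes \<phi> :: "complex \<Rightarrow> 'b::comm_ring_1" and h :: "'k::finite \<Rightarrow> 'b"
  assumes \<phi>_add: "\<phi> (a + b) = \<phi> a + \<phi> b" and \<phi>_mult: "\<phi> (a * b) = \<phi> a * \<phi> b" and \<phi>_1: "\<phi> 1 = 1"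
begin

lemma \<phi>_0: "\<phi> 0 = 0"
  using \<phi>_add[of 0 0] by simp

lemma eq_sum:
  assumes "finite K" "Poly_Mapping.keys f \<subseteq> K"
  shows "poly_subst \<phi> h f = (\<Sum>m\<in>K. \<phi> (Poly_Mapping.lookup f m) * (\<Prod>i\<in>UNIV. h i ^ Poly_Mapping.lookup m i))"
  unfolding poly_subst_def
  by (rule sum.mono_neutral_left) (use assms in \<open>auto simp: in_keys_iff \<phi>_0\<close>)

lemma zero: "poly_subst \<phi> h 0 = 0"
  by (simp add: poly_subst_def)

lemma single: "poly_subst \<phi> h (Poly_Mapping.single m c) = \<phi> c * (\<Prod>i\<in>UNIV. h i ^ Poly_Mapping.lookup m i)"
  by (subst eq_sum[of "{m}"]) auto

lemma add: "poly_subst \<phi> h (p + q) = poly_subst \<phi> h p + poly_subst \<phi> h q"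
proof -
  let ?K = "Poly_Mapping.keys p \<union> Poly_Mapping.keys q"
  have "Poly_Mapping.keys (p + q) \<subseteq> ?K"
    by (rule Poly_Mapping.keys_add)
  then show ?thesis
    by (simp add: eq_sum[of ?K] lookup_add distrib_right sum.distrib \<phi>_add)
qed

lemma mult: "poly_subst \<phi> h (p * q) = poly_subst \<phi> h p * poly_subst \<phi> h q"
proof -
  have s: "poly_subst \<phi> h (Poly_Mapping.single a c * q) =
      poly_subst \<phi> h (Poly_Mapping.single a c) * poly_subst \<phi> h q" for a c q
    by (induction q rule: cpoly_monomial_induct)
      (simp_all add: zero distrib_left add mult_single single lookup_add power_add prod.distrib \<phi>_mult)
  show ?thesis
    by (induction p rule: cpoly_monomial_induct) (simp_all add: zero s distrib_right add)
qed

lemma const: "poly_subst \<phi> h (cconst c) = \<phi> c"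
  by (simp add: cconst_def single)

lemma var: "poly_subst \<phi> h (cvar j) = h j"
proof -
  have "(\<Prod>i\<in>UNIV. h i ^ Poly_Mapping.lookup (Poly_Mapping.single j (1::nat)) i) =
      (\<Prod>i\<in>UNIV. if i = j then h i else 1)"
    by (rule prod.cong) (auto simp: lookup_single when_def)
  then show ?thesis
    by (simp add: cvar_def single \<phi>_1)
qed

end

definition lin :: "complex^'n::finite \<Rightarrow> 'n cpoly" where
  "lin v = (\<Sum>j\<in>UNIV. cconst (v $ j) * cvar j)"

text \<open>Unlike \<open>act\<close> it involves no inverse, so it depends polynomially on the
  entries of \<open>M\<close> and makes sense for singular \<open>M\<close>. Pulling back functions
  reverses composition.\<close>

definition sub :: "'n::finite cmat \<Rightarrow> 'n cpoly \<Rightarrow> 'n cpoly" where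
  "sub M = poly_subst cconst (\<lambda>i. lin (M $ i))"

lemma act_eq_sub: "act S = sub (matrix_inv S)"
  by (simp add: fun_eq_iff act_def sub_def lin_def)

interpretation sub: subst_hom cconst "\<lambda>i. lin ((M :: 'n::finite cmat) $ i)" for M
  by standard (simp_all add: cconst_simps)

lemma sub_simps:
  "sub M (f + g) = sub M f + sub M g" "sub M (f * g) = sub M f * sub M g" "sub M (cconst c) = cconst c"
  "sub M (cvar i) = lin (M $ i)" "sub M 0 = 0"
  unfolding sub_def by (rule sub.add sub.mult sub.const sub.var sub.zero)+

lemma sub_diff: "sub M (f - g) = sub M f - sub M g"
  using sub_simps(1)[of M "f - g" g] by (simp add: algebra_simps)

lemma sub_sum: "sub M (sum f A) = (\<Sum>x\<in>A. sub M (f x))"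
  by (induction A rule: infinite_finite_induct) (simp_all add: sub_simps)

lemma lin_simps: "lin (v + w) = lin v + lin w" "lin (c *s v) = cconst c * lin v" "lin (v - w) = lin v - lin w" "lin 0 = 0"
  by (simp_all add: lin_def cconst_simps sum.distrib sum_distrib_left algebra_simps sum_subtractf)

lemma lin_sum: "lin (sum f A) = (\<Sum>x\<in>A. lin (f x))"
  by (induction A rule: infinite_finite_induct) (simp_all add: lin_simps)

lemma sub_lin: "sub M (lin v) = lin (v v* M)"
proof -
  have "sub M (lin v) = (\<Sum>j\<in>UNIV. cconst (v $ j) * lin (M $ j))"
    by (simp add: lin_def[of v] sub_sum sub_simps)
  also have "\<dots> = lin (\<Sum>j\<in>UNIV. v $ j *s M $ j)"
    by (simp add: lin_sum lin_simps)
  also have "(\<Sum>j\<in>UNIV. v $ j *s M $ j) = v v* M"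
    by (simp add: vec_eq_iff vector_matrix_mult_def sum_component mult.commute)
  finally show ?thesis .
qed

lemma vector_matrix_row: "A $ i v* B = (A ** B) $ i" for A B :: "'n::finite cmat"
  by (simp add: vec_eq_iff vector_matrix_mult_def matrix_matrix_mult_def mult.commute)

lemma sub_sub: "sub M (sub N f) = sub (N ** M) f"
  by (induction f rule: cpoly_induct) (simp_all add: sub_simps sub_lin vector_matrix_row)

lemma lin_mat1: "lin (mat 1 $ i) = cvar i"
proof -
  have "lin (mat 1 $ i) = (\<Sum>j\<in>UNIV. if j = i then cvar j else 0)"
    unfolding lin_def by (rule sum.cong) (auto simp: mat_def cconst_simps)
  then show ?thesis by simp
qed

lemma sub_mat1: "sub (mat 1) f = f"
  by (induction f rule: cpoly_induct) (simp_all add: sub_simps lin_mat1)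

lemma act_simps:
  "act S (f + g) = act S f + act S g" "act S (f * g) = act S f * act S g" "act S (cconst c) = cconst c" "act S 0 = 0"
  "act S (f - g) = act S f - act S g"
  by (simp_all add: act_eq_sub sub_simps sub_diff)

lemma act_act:
  assumes "invertible S" "invertible T"
  shows "act S (act T f) = act (S ** T) f"
  by (simp add: act_eq_sub sub_sub invertible_mul assms)

lemma act_mat1: "act (mat 1) f = f"
  using matrix_inv_unique[of "mat 1" "mat 1 :: 'a cmat"] by (simp add: act_eq_sub sub_mat1)

lemma act_inv [simp]:
  assumes "invertible S"
  shows "act S (act (matrix_inv S) f) = f" "act (matrix_inv S) (act S f) = f"
  by (simp_all add: act_act assms invertible_inv act_mat1)

text \<open>The derivation is read off from the substitution \<open>x \<mapsto> x + \<epsilon> X x\<close> over the dual numbers.\<close>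

definition eps_sub :: "'n::finite cmat \<Rightarrow> 'n cpoly \<Rightarrow> 'n cpoly poly" where
  "eps_sub X = poly_subst (\<lambda>c. [:cconst c:]) (\<lambda>i. [:cvar i, lin (X $ i):])"

definition der :: "'n::finite cmat \<Rightarrow> 'n cpoly \<Rightarrow> 'n cpoly" where
  "der X f = coeff (eps_sub X f) 1"

interpretation eps: subst_hom "\<lambda>c. [:cconst c:]" "\<lambda>i. [:cvar i, lin ((X :: 'n::finite cmat) $ i):]" for X
  by standard (simp_all add: cconst_simps one_pCons)

lemma eps_sub_simps:
  "eps_sub X (f + g) = eps_sub X f + eps_sub X g" "eps_sub X (f * g) = eps_sub X f * eps_sub X g"
  "eps_sub X (cconst c) = [:cconst c:]" "eps_sub X (cvar i) = [:cvar i, lin (X $ i):]"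
  unfolding eps_sub_def by (rule eps.add eps.mult eps.const eps.var)+

lemma coeff_eps_sub_0: "coeff (eps_sub X f) 0 = f"
  by (induction f rule: cpoly_induct) (simp_all add: eps_sub_simps coeff_mult_0)

text \<open>Keeping all powers of the extra variable, instead of reducing modulo its square, gives
  the substitution along the whole line \<open>1 + s X\<close>. This ties \<open>der X\<close> to
  the tangent directions in the definition of \<open>lie_algebra\<close>.\<close>

lemma poly_eps_sub: "poly (eps_sub X f) (cconst s) = sub (mat 1 + mat_scale s X) f"
proof (induction f rule: cpoly_induct)
  case (var i)
  have "(mat 1 + mat_scale s X) $ i = mat 1 $ i + s *s X $ i"
    by (simp add: vec_eq_iff)
  then show ?case
    by (simp add: eps_sub_simps sub_simps lin_simps lin_mat1)
qed (simp_all add: eps_sub_simps sub_simps)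

lemma der_simps:
  "der X (f + g) = der X f + der X g" "der X (f * g) = der X f * g + f * der X g"
  "der X (cconst c) = 0" "der X (cvar i) = lin (X $ i)"
  by (simp_all add: der_def eps_sub_simps coeff_mult coeff_eps_sub_0 algebra_simps)

lemma der_cmult: "der X (cconst c * f) = cconst c * der X f"
  by (simp add: der_simps)

lemma der_0: "der X 0 = 0"
  using der_simps(3)[of X 0] by (simp add: cconst_simps)

lemma der_diff: "der X (f - g) = der X f - der X g"
  using der_simps(1)[of X "f - g" g] by (simp add: algebra_simps)

lemma der_sum: "der X (sum f A) = (\<Sum>x\<in>A. der X (f x))"
  by (induction A rule: infinite_finite_induct) (simp_all add: der_simps der_0)

lemma der_linear: "Vector_Spaces.linear (\<lambda>c f. cconst c * f) (\<lambda>c f. cconst c * f) (der X)"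
  by unfold_locales (simp_all add: der_simps algebra_simps)

lemma der_lin: "der X (lin v) = lin (v v* X)"
proof -
  have "der X (lin v) = (\<Sum>j\<in>UNIV. cconst (v $ j) * lin (X $ j))"
    by (simp add: lin_def[of v] der_sum der_simps)
  also have "\<dots> = lin (\<Sum>j\<in>UNIV. v $ j *s X $ j)"
    by (simp add: lin_sum lin_simps)
  also have "(\<Sum>j\<in>UNIV. v $ j *s X $ j) = v v* X"
    by (simp add: vec_eq_iff vector_matrix_mult_def sum_component mult.commute)
  finally show ?thesis .
qed

lemma der_add: "der (X + Y) f = der X f + der Y f"
  by (induction f rule: cpoly_induct) (simp_all add: der_simps lin_simps algebra_simps)

lemma der_scale: "der (mat_scale c X) f = cconst c * der X f"
proof (induction f rule: cpoly_induct)
  case (var i)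
  have "mat_scale c X $ i = c *s X $ i" by (simp add: vec_eq_iff)
  then show ?case by (simp add: der_simps lin_simps)
qed (simp_all add: der_simps algebra_simps)

lemma der_matrix_diff: "der (X - Y) f = der X f - der Y f"
  using der_add[of "X - Y" Y f] by (simp add: algebra_simps)

text \<open>The order on the right is reversed because derivations act on functions by pullback,
  which makes \<open>der\<close> an anti-homomorphism.\<close>

lemma der_lie_bracket: "der (lie_bracket X Y) f = der Y (der X f) - der X (der Y f)"
proof (induction f rule: cpoly_induct)
  case (mult f g)
  then show ?case
    by (simp only: der_simps der_diff) (simp only: algebra_simps)
qed (simp_all add: der_simps der_0 lie_bracket_def lin_simps der_lin vector_matrix_row)

lemma sub_der_sub:
  assumes "N ** M = mat 1"
  shows "sub M (der X (sub N f)) = der (N ** X ** M) f"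
  by (induction f rule: cpoly_induct)
    (simp_all add: der_simps sub_simps der_lin sub_lin vector_matrix_row sub_sub assms sub_mat1)

lemma act_der:
  assumes "invertible S"
  shows "act S (der X f) = der (conjm S X) (act S f)"
proof -
  have "act S (der X (sub S (act S f))) = der (conjm S X) (act S f)"
    unfolding act_eq_sub conjm_def by (rule sub_der_sub) (simp add: invertible_inv assms)
  moreover have "sub S (act S f) = f"
    by (simp add: act_eq_sub sub_sub invertible_inv assms sub_mat1)
  ultimately show ?thesis by simp
qed

section \<open>Ideals\<close>

text \<open>A form of \<open>ideal I poly_ring\<close> in the type class operations, free of
  carriers and records.\<close>

definition pideal :: "'k::finite cpoly set \<Rightarrow> bool" where
  "pideal I \<longleftrightarrow> 0 \<in> I \<and> (\<forall>f\<in>I. \<forall>g\<in>I. f + g \<in> I) \<and> (\<forall>f\<in>I. \<forall>g. g * f \<in> I)"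

lemma pidealD:
  assumes "pideal I"
  shows "0 \<in> I" "f \<in> I \<Longrightarrow> g \<in> I \<Longrightarrow> f + g \<in> I" "f \<in> I \<Longrightarrow> g * f \<in> I" "f \<in> I \<Longrightarrow> f * g \<in> I"
    "f \<in> I \<Longrightarrow> - f \<in> I" "f \<in> I \<Longrightarrow> g \<in> I \<Longrightarrow> f - g \<in> I"
proof -
  show 1: "0 \<in> I" "f \<in> I \<Longrightarrow> g \<in> I \<Longrightarrow> f + g \<in> I" "f \<in> I \<Longrightarrow> g * f \<in> I" "f \<in> I \<Longrightarrow> f * g \<in> I" for f g
    using assms by (simp_all add: pideal_def mult.commute)
  show 2: "f \<in> I \<Longrightarrow> - f \<in> I" for f
    using 1(3)[of f "- 1"] by simp
  show "f \<in> I \<Longrightarrow> g \<in> I \<Longrightarrow> f - g \<in> I"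
    using 1(2)[of f "- g"] 2 by simp
qed

lemma pideal_sum: "pideal I \<Longrightarrow> (\<And>x. x \<in> A \<Longrightarrow> f x \<in> I) \<Longrightarrow> sum f A \<in> I"
  by (induction A rule: infinite_finite_induct) (auto intro: pidealD)

lemma pideal_subspace: "pideal I \<Longrightarrow> cpoly.subspace I"
  by (rule cpoly.subspaceI) (auto intro: pidealD)

lemma ideal_iff_pideal: "ideal I poly_ring \<longleftrightarrow> pideal I"
proof
  assume "ideal I poly_ring"
  then interpret ideal I poly_ring .
  show "pideal I"
    unfolding pideal_def using zero_closed a_closed I_l_closed by (simp add: class_simps)
next
  assume I: "pideal I"
  show "ideal I poly_ring"
  proof (rule idealI)
    show "ring poly_ring" using cring_class cring.axioms(1) by blast
    show "subgroup I (add_monoid poly_ring)"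
    proof (rule group.subgroupI)
      show "Group.group (add_monoid (poly_ring :: 'a cpoly ring))"
        by (intro abelian_group.a_group ring.is_abelian_group) (use cring_class cring.axioms(1) in blast)
      show "I \<noteq> {}" using pidealD(1)[OF I] by auto
      fix a assume "a \<in> I"
      then have "\<ominus>\<^bsub>poly_ring\<^esub> a \<in> I" using pidealD(5)[OF I] by (simp add: class_simps)
      then show "inv\<^bsub>add_monoid poly_ring\<^esub> a \<in> I" by (simp add: a_inv_def)
    qed (use I in \<open>auto simp: cring_class_ops_def pideal_def\<close>)
  qed (use I in \<open>auto simp: class_simps pidealD\<close>)
qed

lemma primeideal_iff:
  "primeideal I poly_ring \<longleftrightarrow> pideal I \<and> I \<noteq> UNIV \<and> (\<forall>f g. f * g \<in> I \<longrightarrow> f \<in> I \<or> g \<in> I)"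
  unfolding primeideal_def primeideal_axioms_def ideal_iff_pideal
  using cring_class by (auto simp: class_simps cring_class_ops_def)

lemma Idl_pideal: "pideal (Idl\<^bsub>poly_ring\<^esub> F)" 
proof -
  have "ideal (Idl\<^bsub>poly_ring\<^esub> F) poly_ring"
    by (rule ring.genideal_ideal) (use cring_class cring.axioms(1) in \<open>auto simp: cring_class_ops_def\<close>)
  then show ?thesis by (simp add: ideal_iff_pideal)
qed

lemma Idl_minimal: "pideal J \<Longrightarrow> F \<subseteq> J \<Longrightarrow> Idl\<^bsub>poly_ring\<^esub> F \<subseteq> J"
  unfolding genideal_def ideal_iff_pideal by blast

lemma Idl_superset: "F \<subseteq> Idl\<^bsub>poly_ring\<^esub> F"
  unfolding genideal_def by blast

lemma mem_act_ideal_iff: "invertible S \<Longrightarrow> f \<in> act_ideal S I \<longleftrightarrow> act (matrix_inv S) f \<in> I"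
  by (force simp: act_ideal_def image_iff intro: bexI[of _ "act (matrix_inv S) f"])

lemma act_ideal_act_ideal: "invertible S \<Longrightarrow> invertible T \<Longrightarrow> act_ideal S (act_ideal T I) = act_ideal (S ** T) I"
  by (auto simp: act_ideal_def image_image act_act)

lemma pideal_act_ideal: "invertible S \<Longrightarrow> pideal I \<Longrightarrow> pideal (act_ideal S I)"
  unfolding pideal_def[of "act_ideal S I"] by (auto simp: mem_act_ideal_iff act_simps pidealD)

lemma primeideal_act_ideal:
  assumes S: "invertible S" and I: "primeideal I poly_ring"
  shows "primeideal (act_ideal S I) poly_ring"
proof -
  obtain f where "f \<notin> I" using I by (auto simp: primeideal_iff)
  then have "act S f \<notin> act_ideal S I"
    by (simp add: mem_act_ideal_iff S)
  then have "act_ideal S I \<noteq> UNIV" by blast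
  then show ?thesis
    using I pideal_act_ideal[OF S] S by (auto simp: primeideal_iff mem_act_ideal_iff act_simps)
qed

definition lieI :: "'n::finite cpoly set \<Rightarrow> 'n cmat set" where
  "lieI I = {X. \<forall>f\<in>I. der X f \<in> I}"

lemma lieI_subspace: "pideal I \<Longrightarrow> cmat.subspace (lieI I)"
  by (rule cmat.subspaceI) (auto simp: lieI_def der_add der_scale pidealD[of I] der_matrix_diff[of 0 0, simplified])

lemma lieI_lie_bracket: "pideal I \<Longrightarrow> X \<in> lieI I \<Longrightarrow> Y \<in> lieI I \<Longrightarrow> lie_bracket X Y \<in> lieI I"
  by (auto simp: lieI_def der_lie_bracket intro: pidealD)

lemma conjm_lieI:
  assumes "invertible S" "X \<in> lieI I"
  shows "conjm S X \<in> lieI (act_ideal S I)"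
  using assms by (auto simp: lieI_def act_ideal_def act_der[symmetric])

section \<open>Polynomial functions of a matrix\<close>

definition polyfun :: "('n::finite cmat \<Rightarrow> complex) \<Rightarrow> bool" where
  "polyfun F \<longleftrightarrow> (\<exists>p. \<forall>X. mat_eval p X = F X)"

lemma mat_eval_simps:
  "mat_eval (p + q) X = mat_eval p X + mat_eval q X" "mat_eval (p * q) X = mat_eval p X * mat_eval q X"
  "mat_eval (cconst c) X = c" "mat_eval (cvar (i, j)) X = X $ i $ j"
  by (simp_all add: mat_eval_def poly_eval_add poly_eval_mult poly_eval_cconst poly_eval_cvar)

lemma polyfun_const: "polyfun (\<lambda>X. c)"
  unfolding polyfun_def by (intro exI[of _ "cconst c"]) (simp add: mat_eval_simps)

lemma polyfun_nth: "polyfun (\<lambda>X. X $ i $ j)"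
  unfolding polyfun_def by (intro exI[of _ "cvar (i, j)"]) (simp add: mat_eval_simps)

lemma polyfun_add: "polyfun F \<Longrightarrow> polyfun G \<Longrightarrow> polyfun (\<lambda>X. F X + G X)"
  unfolding polyfun_def by (elim exE, rule_tac x = "p + pa" in exI) (simp add: mat_eval_simps)

lemma polyfun_mult: "polyfun F \<Longrightarrow> polyfun G \<Longrightarrow> polyfun (\<lambda>X. F X * G X)"
  unfolding polyfun_def by (elim exE, rule_tac x = "p * pa" in exI) (simp add: mat_eval_simps)

lemma polyfun_diff: "polyfun F \<Longrightarrow> polyfun G \<Longrightarrow> polyfun (\<lambda>X. F X - G X)"
  using polyfun_add[of F "\<lambda>X. (-1) * G X"] polyfun_mult[OF polyfun_const[of "-1"], of G] by simp

lemma polyfun_sum: "(\<And>i. i \<in> A \<Longrightarrow> polyfun (F i)) \<Longrightarrow> polyfun (\<lambda>X. \<Sum>i\<in>A. F i X)"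
  by (induction A rule: infinite_finite_induct) (auto intro: polyfun_const polyfun_add)

lemma polyfun_prod: "(\<And>i. i \<in> A \<Longrightarrow> polyfun (F i)) \<Longrightarrow> polyfun (\<lambda>X. \<Prod>i\<in>A. F i X)"
  by (induction A rule: infinite_finite_induct) (auto intro: polyfun_const polyfun_mult)

lemma polyfun_induct [consumes 1, case_names const nth add mult]:
  assumes "polyfun F" and "\<And>c. P (\<lambda>X. c)" "\<And>i j. P (\<lambda>X. X $ i $ j)"
    "\<And>F G. P F \<Longrightarrow> P G \<Longrightarrow> P (\<lambda>X. F X + G X)" "\<And>F G. P F \<Longrightarrow> P G \<Longrightarrow> P (\<lambda>X. F X * G X)"
  shows "P F"
proof -
  obtain p where p: "F = mat_eval p"
    using assms(1) unfolding polyfun_def by (metis ext)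
  have "P (mat_eval q)" for q
  proof (induction q rule: cpoly_induct)
    case (var ij)
    then show ?case
      using assms(3)[of "fst ij" "snd ij"] by (cases ij) (simp add: mat_eval_simps[abs_def])
  qed (use assms in \<open>simp_all add: mat_eval_simps[abs_def]\<close>)
  then show ?thesis by (simp add: p)
qed

lemma polyfun_continuous: "polyfun F \<Longrightarrow> continuous_on UNIV F"
  by (induction rule: polyfun_induct) (intro continuous_intros; assumption)+

lemma polyfun_line:
  assumes "polyfun F"
  shows "\<exists>q. \<forall>s. F (A + mat_scale s B) = poly q s"
  using assms
proof (induction rule: polyfun_induct)
  case (nth i j)
  show ?case by (intro exI[of _ "[:A $ i $ j, B $ i $ j:]"]) simp
next
  case (add F G)
  then show ?case by (metis poly_add)
next
  case (mult F G)
  then show ?case by (metis poly_mult)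
qed (metis poly_pCons mult_zero_right add_0_right poly_0)

text \<open>Polynomial dependence on \<open>M\<close> through finitely many fixed directions
  \<open>u\<close>. Two consequences are wanted: functionals of such a family are polynomial
  functions of \<open>M\<close>, and all its values lie in one finite-dimensional space.\<close>

inductive polyfam :: "('n::finite cmat \<Rightarrow> 'n cpoly) \<Rightarrow> bool" where
  base: "polyfun p \<Longrightarrow> polyfam (\<lambda>M. cconst (p M) * u)"
| add: "polyfam F \<Longrightarrow> polyfam G \<Longrightarrow> polyfam (\<lambda>M. F M + G M)"

lemma polyfam_mult:
  assumes "polyfam F" "polyfam G"
  shows "polyfam (\<lambda>M. F M * G M)"
  using assms(1)
proof induction
  case (base p u)
  show ?case
    using assms(2)
  proof induction
    case (base q v)
    have "(\<lambda>M. cconst (p M) * u * (cconst (q M) * v)) = (\<lambda>M. cconst (p M * q M) * (u * v))"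
      by (simp add: cconst_simps algebra_simps)
    then show ?case
      using polyfam.base[OF polyfun_mult[OF \<open>polyfun p\<close> base]] by simp
  qed (simp add: distrib_left polyfam.add)
qed (simp add: distrib_right polyfam.add)

lemma polyfam_const: "polyfam (\<lambda>M. f)"
  using polyfam.base[OF polyfun_const[of 1], of f] by (simp add: cconst_simps)

lemma polyfam_sum: "finite A \<Longrightarrow> (\<And>i. i \<in> A \<Longrightarrow> polyfam (F i)) \<Longrightarrow> polyfam (\<lambda>M. \<Sum>i\<in>A. F i M)"
  by (induction A rule: finite_induct) (auto intro: polyfam_const polyfam.add)

lemma polyfam_sub: "polyfam (\<lambda>M. sub M f)"
proof (induction f rule: cpoly_induct)
  case (var i)
  show ?case
    unfolding sub_simps lin_def by (intro polyfam_sum polyfam.base polyfun_nth) simp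
qed (simp_all add: sub_simps polyfam_const polyfam.add polyfam_mult)

lemma polyfam_functional:
  assumes "polyfam F" "Vector_Spaces.linear (\<lambda>c f. cconst c * f) (*) l"
  shows "polyfun (\<lambda>M. l (F M))"
proof -
  interpret l: Vector_Spaces.linear "\<lambda>c f. cconst c * f" "(*)" l by fact
  show ?thesis
    using assms(1) by induction (simp_all add: l.scale l.add polyfun_mult polyfun_const polyfun_add)
qed

lemma polyfam_finite_span:
  "polyfam F \<Longrightarrow> \<exists>U. finite U \<and> (\<forall>M. F M \<in> cpoly.span U)"
proof (induction rule: polyfam.induct)
  case (base p u)
  show ?case
    by (intro exI[of _ "{u}"]) (auto intro: cpoly.span_scale cpoly.span_base)
next
  case (add F G)
  then obtain U V where "finite U" "\<forall>M. F M \<in> cpoly.span U" "finite V" "\<forall>M. G M \<in> cpoly.span V" by blast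
  then show ?case
    using cpoly.span_mono[of U "U \<union> V"] cpoly.span_mono[of V "U \<union> V"]
    by (intro exI[of _ "U \<union> V"]) (auto intro!: cpoly.span_add)
qed

section \<open>The matrix exponential\<close>

definition mpow :: "'n::finite cmat \<Rightarrow> nat \<Rightarrow> 'n cmat" where
  "mpow X k = ((**) X ^^ k) (mat 1)"

definition mexp :: "'n::finite cmat \<Rightarrow> 'n cmat" where
  "mexp X = (\<chi> i j. suminf (\<lambda>k. mpow X k $ i $ j / fact k))"

definition mnorm :: "'n::finite cmat \<Rightarrow> real" where
  "mnorm X = (\<Sum>i\<in>UNIV. \<Sum>j\<in>UNIV. cmod (X $ i $ j))"

lemma mpow_simps: "mpow X 0 = mat 1" "mpow X (Suc k) = X ** mpow X k"
  by (simp_all add: mpow_def)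

lemma mpow_commute: "X ** mpow X k = mpow X k ** X"
proof (induction k)
  case (Suc k)
  have "X ** mpow X (Suc k) = X ** (mpow X k ** X)" by (simp add: mpow_simps Suc)
  also have "\<dots> = mpow X (Suc k) ** X" by (simp add: mpow_simps matrix_mul_assoc)
  finally show ?case .
qed (simp add: mpow_simps)

lemma mpow_scale: "mpow (mat_scale s X) k = mat_scale (s ^ k) (mpow X k)"
  by (induction k) (simp_all add: mpow_simps mat_mul_distrib mult.commute)

lemma mnorm_nonneg: "0 \<le> mnorm X"
  by (simp add: mnorm_def sum_nonneg)

lemma row_sum_le_mnorm: "(\<Sum>j\<in>UNIV. cmod (X $ i $ j)) \<le> mnorm X"
  unfolding mnorm_def by (rule member_le_sum[where f = "\<lambda>i. \<Sum>j\<in>UNIV. cmod (X $ i $ j)"]) (auto intro: sum_nonneg)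

lemma mpow_bound: "cmod (mpow X k $ i $ j) \<le> mnorm X ^ k"
proof (induction k arbitrary: i)
  case 0
  show ?case by (simp add: mpow_simps mat_def)
next
  case (Suc k)
  have "cmod (mpow X (Suc k) $ i $ j) \<le> (\<Sum>l\<in>UNIV. cmod (X $ i $ l) * cmod (mpow X k $ l $ j))"
    unfolding mpow_simps matrix_matrix_mult_def by (simp flip: norm_mult) (rule norm_sum)
  also have "\<dots> \<le> (\<Sum>l\<in>UNIV. cmod (X $ i $ l) * mnorm X ^ k)"
    by (intro sum_mono mult_left_mono Suc) auto
  also have "\<dots> \<le> mnorm X * mnorm X ^ k"
    unfolding sum_distrib_right[symmetric] by (intro mult_right_mono row_sum_le_mnorm) (simp add: mnorm_nonneg)
  finally show ?case by simp
qed

lemma summable_mexp: "summable (\<lambda>k. mpow X k $ i $ j / fact k)"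
proof (rule summable_comparison_test')
  show "summable (\<lambda>k. mnorm X ^ k / fact k)"
    using summable_exp[of "mnorm X"] by (simp add: field_simps)
  show "norm (mpow X k $ i $ j / fact k) \<le> mnorm X ^ k / fact k" for k
    using mpow_bound[of X k i j] by (simp add: norm_divide divide_right_mono)
qed

lemma mexp_0: "mexp 0 = mat 1"
proof -
  have "mpow 0 k = (if k = 0 then mat 1 else (0 :: 'a cmat))" for k
    by (cases k) (simp_all add: mpow_simps mat_mul_distrib)
  then have "(\<lambda>k. mpow 0 k $ i $ j / fact k) = (\<lambda>k. if k = 0 then (mat 1 :: 'a cmat) $ i $ j else 0)" for i j
    by (simp add: fun_eq_iff)
  moreover have "suminf (\<lambda>k. if k = 0 then z else 0) = z" for z :: complex
    using sums_unique[OF sums_single[of 0 "\<lambda>_. z"]] by simp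
  ultimately show ?thesis
    by (simp add: mexp_def vec_eq_iff)
qed

text \<open>Termwise differentiation of an everywhere convergent power series; the factorial turns
  the coefficient at \<open>k + 1\<close> into \<open>X\<close> times the coefficient at
  \<open>k\<close>.\<close>

lemma mexp_derivative:
  "((\<lambda>s. mexp (mat_scale s X) $ i $ j) has_field_derivative (X ** mexp (mat_scale s X)) $ i $ j) (at s)"
proof -
  define c where "c = (\<lambda>i k. mpow X k $ i $ j / fact k)"
  have e: "mexp (mat_scale s X) $ i $ j = suminf (\<lambda>k. c i k * s ^ k)" for s i
    by (simp add: mexp_def mpow_scale c_def mult.commute)
  have sm: "summable (\<lambda>k. c i k * s ^ k)" for s i
    using summable_mexp[of "mat_scale s X" i j] by (simp add: mpow_scale c_def mult.commute)
  have "((\<lambda>s. suminf (\<lambda>k. c i k * s ^ k)) has_field_derivative suminf (\<lambda>k. diffs (c i) k * s ^ k)) (at s)"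
    by (rule termdiffs_strong_converges_everywhere) (rule sm)
  moreover have "diffs (c i) k * s ^ k = (\<Sum>l\<in>UNIV. X $ i $ l * (c l k * s ^ k))" for k
  proof -
    have "diffs (c i) k = mpow X (Suc k) $ i $ j / fact k"
      by (simp only: diffs_def c_def fact_Suc times_divide_eq_right mult_divide_mult_cancel_left[OF of_nat_neq_0])
    also have "\<dots> = (\<Sum>l\<in>UNIV. X $ i $ l * c l k)"
      by (simp add: mpow_simps matrix_matrix_mult_def c_def sum_divide_distrib)
    finally show ?thesis by (simp add: sum_distrib_right mult.assoc)
  qed
  moreover have "suminf (\<lambda>k. \<Sum>l\<in>UNIV. X $ i $ l * (c l k * s ^ k)) = (X ** mexp (mat_scale s X)) $ i $ j"
    by (simp add: suminf_sum sm summable_mult suminf_mult matrix_matrix_mult_def e)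
  ultimately show ?thesis by (simp add: e)
qed

lemma mexp_commute: "X ** mexp X = mexp X ** X"
proof -
  have "(X ** mexp X) $ i $ j = suminf (\<lambda>k. (X ** mpow X k) $ i $ j / fact k)" for i j
  proof -
    have "(\<Sum>l\<in>UNIV. suminf (\<lambda>k. X $ i $ l * (mpow X k $ l $ j / fact k))) =
      suminf (\<lambda>k. \<Sum>l\<in>UNIV. X $ i $ l * (mpow X k $ l $ j / fact k))"
      by (rule suminf_sum[symmetric]) (rule summable_mult[OF summable_mexp])
    moreover have "(X ** mexp X) $ i $ j = (\<Sum>l\<in>UNIV. suminf (\<lambda>k. X $ i $ l * (mpow X k $ l $ j / fact k)))"
      by (simp only: suminf_mult[OF summable_mexp]) (simp add: matrix_matrix_mult_def mexp_def)
    ultimately show ?thesis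
      by (simp add: matrix_matrix_mult_def sum_divide_distrib)
  qed
  moreover have "(mexp X ** X) $ i $ j = suminf (\<lambda>k. (mpow X k ** X) $ i $ j / fact k)" for i j
  proof -
    have "(\<Sum>l\<in>UNIV. suminf (\<lambda>k. mpow X k $ i $ l / fact k * X $ l $ j)) =
      suminf (\<lambda>k. \<Sum>l\<in>UNIV. mpow X k $ i $ l / fact k * X $ l $ j)"
      by (rule suminf_sum[symmetric]) (rule summable_mult2[OF summable_mexp])
    moreover have "(mexp X ** X) $ i $ j = (\<Sum>l\<in>UNIV. suminf (\<lambda>k. mpow X k $ i $ l / fact k * X $ l $ j))"
      by (simp only: suminf_mult2[OF summable_mexp, symmetric]) (simp add: matrix_matrix_mult_def mexp_def)
    ultimately show ?thesis
      by (simp add: matrix_matrix_mult_def sum_divide_distrib)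
  qed
  ultimately show ?thesis by (simp add: vec_eq_iff mpow_commute)
qed

text \<open>The product of \<open>exp(s X)\<close> and \<open>exp(-s X)\<close> has derivative zero
  because \<open>X\<close> commutes with \<open>exp(s X)\<close>, so it keeps its value from
  \<open>s = 0\<close> to \<open>s = 1\<close>.\<close>

lemma mexp_minus: "mexp X ** mexp (- X) = mat 1"
proof -
  define E where "E s = mexp (mat_scale s X)" for s
  define F where "F s = mexp (mat_scale s (- X))" for s
  have 1: "((\<lambda>s. (E s ** F s) $ i $ j) has_field_derivative 0) (at s)" for i j s
  proof -
    have "((\<lambda>s. \<Sum>l\<in>UNIV. E s $ i $ l * F s $ l $ j) has_field_derivative
        (\<Sum>l\<in>UNIV. (X ** E s) $ i $ l * F s $ l $ j + ((- X) ** F s) $ l $ j * E s $ i $ l)) (at s)"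
      unfolding E_def F_def by (intro DERIV_sum DERIV_mult mexp_derivative)
    also have "(\<Sum>l\<in>UNIV. (X ** E s) $ i $ l * F s $ l $ j + ((- X) ** F s) $ l $ j * E s $ i $ l)
      = (X ** E s ** F s + E s ** ((- X) ** F s)) $ i $ j"
      by (simp add: matrix_matrix_mult_def[of _ "F s"] matrix_matrix_mult_def[of "E s"] sum.distrib mult.commute)
    also have "X ** E s = E s ** X"
    \<comment> \<open>\<open>mexp_commute\<close> for \<open>s X\<close> yields the identity
      multiplied by \<open>s\<close>, which says nothing at \<open>s = 0\<close>.\<close>
    proof (cases "s = 0")
      case False
      have "mat_scale s (X ** E s) = mat_scale s (E s ** X)"
        using mexp_commute[of "mat_scale s X"] by (simp add: E_def mat_mul_distrib)
      then show ?thesis using False by (simp add: vec_eq_iff)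
    qed (simp add: E_def mexp_0)
    also have "E s ** X ** F s + E s ** ((- X) ** F s) = E s ** ((X - X) ** F s)"
      by (simp only: mat_mul_distrib matrix_mul_assoc[symmetric] diff_conv_add_uminus)
    finally show ?thesis by (simp add: matrix_matrix_mult_def)
  qed
  have "(E 1 ** F 1) $ i $ j = (E 0 ** F 0) $ i $ j" for i j
    using has_field_derivative_zero_constant[of UNIV "\<lambda>s. (E s ** F s) $ i $ j"] 1 by (metis UNIV_I convex_UNIV)
  then show ?thesis
    by (simp add: vec_eq_iff E_def F_def mexp_0)
qed

lemma invertible_mexp: "invertible (mexp X)" "matrix_inv (mexp X) = mexp (- X)"
  using mexp_minus[of X] invertible_right_inverse matrix_inv_unique by blast+

lemma cconst_power: "cconst (a ^ k) = cconst a ^ k"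
  by (induction k) (simp_all add: cconst_simps)

section \<open>The Lie algebra of the stabilizer of an ideal\<close>

text \<open>A differentiable family paired with its derivative, again through finitely many fixed
  directions. Differentiation takes place in scalar coefficients and commutes with every linear
  functional, so no topology on polynomials enters.\<close>

inductive dfam :: "(complex \<Rightarrow> 'n::finite cpoly) \<Rightarrow> (complex \<Rightarrow> 'n cpoly) \<Rightarrow> bool" where
  base: "(\<And>s. (a has_field_derivative a' s) (at s)) \<Longrightarrow> dfam (\<lambda>s. cconst (a s) * u) (\<lambda>s. cconst (a' s) * u)"
| add: "dfam F F' \<Longrightarrow> dfam G G' \<Longrightarrow> dfam (\<lambda>s. F s + G s) (\<lambda>s. F' s + G' s)"

lemma dfam_mult:
  assumes "dfam F F'" "dfam G G'"
  shows "dfam (\<lambda>s. F s * G s) (\<lambda>s. F' s * G s + F s * G' s)"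
  using assms(1)
proof induction
  case (base a a' u)
  show ?case
    using assms(2)
  proof induction
    case (base b b' v)
    have "dfam (\<lambda>s. cconst (a s * b s) * (u * v)) (\<lambda>s. cconst (a' s * b s + b' s * a s) * (u * v))"
      by (intro dfam.base DERIV_mult \<open>\<And>s. (a has_field_derivative a' s) (at s)\<close> base)
    then show ?case
      by (simp add: cconst_simps algebra_simps)
  next
    case (add G G' H H')
    then show ?case
      using dfam.add[OF add.IH] by (simp add: algebra_simps)
  qed
next
  case (add H H' K K')
  then show ?case
    using dfam.add[OF add.IH] by (simp add: algebra_simps)
qed

lemma dfam_const: "dfam (\<lambda>s. f) (\<lambda>s. 0)"
  using dfam.base[of "\<lambda>s. 1" "\<lambda>s. 0" f] by (simp add: cconst_simps)

lemma dfam_sum: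
  "finite A \<Longrightarrow> (\<And>i. i \<in> A \<Longrightarrow> dfam (F i) (F' i)) \<Longrightarrow> dfam (\<lambda>s. \<Sum>i\<in>A. F i s) (\<lambda>s. \<Sum>i\<in>A. F' i s)"
  by (induction A rule: finite_induct) (auto intro: dfam_const dfam.add)

lemma dfam_functional:
  assumes "dfam F F'" "Vector_Spaces.linear (\<lambda>c f. cconst c * f) (*) l"
  shows "((\<lambda>s. l (F s)) has_field_derivative l (F' s)) (at s)"
proof -
  interpret l: Vector_Spaces.linear "\<lambda>c f. cconst c * f" "(*)" l by fact
  show ?thesis
    using assms(1)
  proof induction
    case (base a a' u)
    then show ?case by (simp add: l.scale DERIV_cmult_right)
  next
    case (add F F' G G')
    then show ?case by (simp add: l.add DERIV_add)
  qed
qed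

lemma dfam_sub_mexp:
  "dfam (\<lambda>s. sub (mexp (mat_scale s X)) f) (\<lambda>s. sub (mexp (mat_scale s X)) (der X f))"
proof (induction f rule: cpoly_induct)
  case (var i)
  show ?case
    unfolding sub_simps der_simps sub_lin vector_matrix_row
    unfolding lin_def
    by (intro dfam_sum dfam.base mexp_derivative) simp
next
  case (mult f g)
  then show ?case
    using dfam_mult[OF mult] by (simp add: sub_simps der_simps)
qed (simp_all add: sub_simps der_simps dfam_const dfam.add)

lemma sub_mexp_mem:
  assumes I: "pideal I" and X: "X \<in> lieI I" and f: "f \<in> I"
  shows "sub (mexp X) f \<in> I"
proof (rule ccontr)
  assume "sub (mexp X) f \<notin> I"
  then obtain l where l: "Vector_Spaces.linear (\<lambda>c f. cconst c * f) (*) l"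
    "\<And>g. g \<in> I \<Longrightarrow> l g = 0" "l (sub (mexp X) f) = 1"
    using cpoly.functional_separating[OF pideal_subspace[OF I]] by metis
  define \<phi> where "\<phi> g s = l (sub (mexp (mat_scale s X)) g)" for g s
  have d: "(\<phi> g has_field_derivative \<phi> (der X g) s) (at s)" for g s
    unfolding \<phi>_def[abs_def] by (rule dfam_functional[OF dfam_sub_mexp l(1)])
  have dn: "(deriv ^^ n) (\<phi> g) = \<phi> ((der X ^^ n) g)" for n g
  proof (induction n)
    case (Suc n)
    have "deriv (\<phi> h) = \<phi> (der X h)" for h
      by (rule ext) (rule DERIV_imp_deriv[OF d])
    then show ?case by (simp add: Suc)
  qed simp
  have m: "(der X ^^ n) f \<in> I" for n
    by (induction n) (use X f in \<open>auto simp: lieI_def\<close>)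
  have "\<phi> f 1 = 0"
  proof (rule holomorphic_fun_eq_0_on_connected[of "\<phi> f" UNIV 0 1])
    show "\<phi> f holomorphic_on UNIV"
      using d by (auto simp: holomorphic_on_def field_differentiable_def)
    show "(deriv ^^ n) (\<phi> f) 0 = 0" for n
      unfolding dn by (simp add: \<phi>_def mexp_0 sub_mat1 l(2) m)
  qed auto
  then show False using l(3) by (simp add: \<phi>_def)
qed

lemma act_mexp_ideal:
  assumes I: "pideal I" and X: "X \<in> lieI I"
  shows "act_ideal (mexp X) I = I"
proof -
  have mX: "- X \<in> lieI I"
    using cmat.subspace_neg[OF lieI_subspace[OF I] X] .
  show ?thesis
  proof (intro equalityI subsetI)
    fix f assume "f \<in> act_ideal (mexp X) I"
    then show "f \<in> I"
      using sub_mexp_mem[OF I mX] by (auto simp: act_ideal_def act_eq_sub invertible_mexp)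
  next
    fix f assume "f \<in> I"
    then show "f \<in> act_ideal (mexp X) I"
      using sub_mexp_mem[OF I X]
      by (simp add: mem_act_ideal_iff invertible_mexp act_eq_sub)
  qed
qed

text \<open>The orbit \<open>act S\<^sup>k f\<close> spans a finite-dimensional space, so a linear relation among its
  elements expresses \<open>act S\<^sup>-\<^sup>1 f\<close> by nonnegative powers.\<close>

lemma stabilizer_inverse:
  assumes I: "pideal I" and S: "S \<in> stabilizer I" and f: "f \<in> I"
  shows "sub S f \<in> I"
proof -
  have inv: "invertible S" and SI: "\<And>g. g \<in> I \<Longrightarrow> act S g \<in> I"
    using S by (auto simp: stabilizer_def act_ideal_def)
  have pw: "(act S ^^ k) f = sub (mpow (matrix_inv S) k) f" for k
    by (induction k) (simp_all add: mpow_simps sub_mat1 act_eq_sub sub_sub mpow_commute)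
  obtain U where U: "finite U" "\<And>M. sub M f \<in> cpoly.span U"
    using polyfam_finite_span[OF polyfam_sub] by blast
  obtain c where c: "\<exists>k\<le>card U. c k \<noteq> 0" "(\<Sum>k\<le>card U. cconst (c k) * (act S ^^ k) f) = 0"
    by (rule cpoly.funpow_dependent[OF U(1) order_refl, of "\<lambda>k. (act S ^^ k) f"]) (auto simp: pw U(2))
  define N where "N = card U"
  \<comment> \<open>The lowest term of the relation. Applying the inverse \<open>k + 1\<close> times
    turns it into a multiple of \<open>act (matrix_inv S) f\<close>, and all later terms into
    nonnegative powers of \<open>act S\<close> applied to \<open>f\<close>, which lie in
    \<open>I\<close>.\<close>
  define k where "k = (LEAST k. c k \<noteq> 0)"
  obtain k0 where k0: "k0 \<le> N" "c k0 \<noteq> 0" using c(1) by (auto simp: N_def)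
  have k: "c k \<noteq> 0" "\<And>j. j < k \<Longrightarrow> c j = 0"
    unfolding k_def by (rule LeastI[of "\<lambda>k. c k \<noteq> 0", OF k0(2)]) (use not_less_Least[of _ "\<lambda>k. c k \<noteq> 0"] in blast)
  have kN: "k \<le> N" unfolding k_def using k0 Least_le[of "\<lambda>k. c k \<noteq> 0" k0] by auto
  let ?B = "act (matrix_inv S)"
  have Bk: "(?B ^^ j) ((act S ^^ (j + i)) g) = (act S ^^ i) g" for i j g
    by (induction j) (simp_all add: funpow_swap1[of ?B] inv)
  have Badd: "(?B ^^ j) (g + h) = (?B ^^ j) g + (?B ^^ j) h" "(?B ^^ j) (cconst a * g) = cconst a * (?B ^^ j) g" for g h j a
    by (induction j) (simp_all add: act_simps)
  have Bsum: "(?B ^^ j) (sum g A) = (\<Sum>x\<in>A. (?B ^^ j) (g x))" for g :: "nat \<Rightarrow> _" and A j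
    using additive_funpow(2)[of ?B, OF act_simps(1)]
    by (induction A rule: infinite_finite_induct) (simp_all add: Badd)
  have "(\<Sum>i\<in>{k..N}. cconst (c i) * (act S ^^ i) f) = (\<Sum>i\<le>N. cconst (c i) * (act S ^^ i) f)"
    by (rule sum.mono_neutral_left) (use k(2) in \<open>auto simp: cconst_simps not_le\<close>)
  then have "(?B ^^ Suc k) (\<Sum>i\<in>{k..N}. cconst (c i) * (act S ^^ i) f) = 0"
    using c(2) additive_funpow(2)[of ?B, OF act_simps(1)] by (simp add: N_def del: funpow.simps)
  then have "(\<Sum>i\<in>{k..N}. cconst (c i) * (?B ^^ Suc k) ((act S ^^ i) f)) = 0"
    by (simp only: Bsum Badd)
  moreover have "{k..N} = insert k {Suc k..N}" using kN by auto
  moreover have "(?B ^^ Suc k) ((act S ^^ k) f) = ?B f"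
    using Bk[of k 0 f] by simp
  ultimately have "cconst (c k) * ?B f + (\<Sum>i\<in>{Suc k..N}. cconst (c i) * (?B ^^ Suc k) ((act S ^^ i) f)) = 0"
    by (simp del: funpow.simps)
  moreover have "(\<Sum>i\<in>{Suc k..N}. cconst (c i) * (?B ^^ Suc k) ((act S ^^ i) f)) \<in> I"
  proof (intro pideal_sum[OF I] pidealD(3)[OF I])
    fix i assume "i \<in> {Suc k..N}"
    then have "(?B ^^ Suc k) ((act S ^^ i) f) = (act S ^^ (i - Suc k)) f"
      using Bk[of "Suc k" "i - Suc k" f] by simp
    also have "\<dots> \<in> I"
      using SI f by (intro cpoly.funpow_in_subspace)
    finally show "(?B ^^ Suc k) ((act S ^^ i) f) \<in> I" .
  qed
  ultimately have "cconst (c k) * ?B f \<in> I"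
    using pidealD(5)[OF I] by (simp only: eq_neg_iff_add_eq_0[symmetric])
  then have "cconst (inverse (c k)) * (cconst (c k) * ?B f) \<in> I"
    by (rule pidealD(3)[OF I])
  moreover have "cconst (inverse (c k)) * (cconst (c k) * ?B f) = ?B f"
    using k(1) by (simp flip: mult.assoc cconst_simps(4) add: cconst_simps(6))
  ultimately show ?thesis
    by (simp add: act_eq_sub matrix_inv_inv inv)
qed

text \<open>The line \<open>1 + s X\<close> in the definition of \<open>lie_algebra\<close> may
  leave the group, while \<open>exp(s X)\<close> stays inside for \<open>X\<close> in
  \<open>lieI I\<close>. The two curves agree to first order, and polynomials see only that in their
  derivative at 0.\<close>

lemma mat_eval_first_order:
  "\<exists>D. ((\<lambda>s. mat_eval p (mexp (mat_scale s X))) has_field_derivative D) (at 0) \<and>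
       ((\<lambda>s. mat_eval p (mat 1 + mat_scale s X)) has_field_derivative D) (at 0)"
proof (induction p rule: cpoly_induct)
  case (const c)
  show ?case by (intro exI[of _ 0]) (simp add: mat_eval_simps)
next
  case (var ij)
  obtain i j where ij: "ij = (i, j)" by fastforce
  have "((\<lambda>s. mexp (mat_scale s X) $ i $ j) has_field_derivative X $ i $ j) (at 0)"
    using mexp_derivative[of X i j 0] by (simp add: mexp_0)
  moreover have "((\<lambda>s. mat 1 $ i $ j + s * X $ i $ j) has_field_derivative X $ i $ j) (at 0)"
    by (auto intro!: derivative_eq_intros)
  ultimately show ?case by (auto simp: ij mat_eval_simps)
next
  case (add f g)
  then obtain D E where "((\<lambda>s. mat_eval f (mexp (mat_scale s X))) has_field_derivative D) (at 0)"
       "((\<lambda>s. mat_eval f (mat 1 + mat_scale s X)) has_field_derivative D) (at 0)"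
       "((\<lambda>s. mat_eval g (mexp (mat_scale s X))) has_field_derivative E) (at 0)"
       "((\<lambda>s. mat_eval g (mat 1 + mat_scale s X)) has_field_derivative E) (at 0)" by blast
  then show ?case by (intro exI[of _ "D + E"]) (simp add: mat_eval_simps DERIV_add)
next
  case (mult f g)
  then obtain D E where d: "((\<lambda>s. mat_eval f (mexp (mat_scale s X))) has_field_derivative D) (at 0)"
       "((\<lambda>s. mat_eval f (mat 1 + mat_scale s X)) has_field_derivative D) (at 0)"
       "((\<lambda>s. mat_eval g (mexp (mat_scale s X))) has_field_derivative E) (at 0)"
       "((\<lambda>s. mat_eval g (mat 1 + mat_scale s X)) has_field_derivative E) (at 0)" by blast
  show ?case
    using DERIV_mult[OF d(1,3)] DERIV_mult[OF d(2,4)] by (auto simp: mat_eval_simps mexp_0)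
qed

text \<open>If \<open>der X f\<close> is outside \<open>I\<close>, a functional \<open>l\<close>
  killing \<open>I\<close> but not \<open>der X f\<close> gives the polynomial
  \<open>l (sub M f)\<close> in the entries of \<open>M\<close>. It vanishes on the stabilizer by
  \<open>stabilizer_inverse\<close>, yet has derivative 1 at the identity in the direction
  \<open>X\<close>. The other inclusion follows the exponential curve.\<close>

theorem lie_algebra_stabilizer:
  assumes I: "pideal I"
  shows "lie_algebra (stabilizer I) = lieI I"
proof (intro equalityI subsetI)
  fix X assume X: "X \<in> lieI I"
  have "((\<lambda>s. mat_eval p (mat 1 + mat_scale s X)) has_field_derivative 0) (at 0)"
    if p: "\<forall>S\<in>stabilizer I. mat_eval p S = 0" for p
  proof -
    have "mexp (mat_scale s X) \<in> stabilizer I" for s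
      using act_mexp_ideal[OF I cmat.subspace_scale[OF lieI_subspace[OF I] X]]
      by (simp add: stabilizer_def invertible_mexp)
    then have z: "mat_eval p (mexp (mat_scale s X)) = 0" for s
      using p by blast
    obtain D where D: "((\<lambda>s. mat_eval p (mexp (mat_scale s X))) has_field_derivative D) (at 0)"
       "((\<lambda>s. mat_eval p (mat 1 + mat_scale s X)) has_field_derivative D) (at 0)"
      using mat_eval_first_order by blast
    have "D = 0"
      using DERIV_unique[OF D(1)[unfolded z] DERIV_const] .
    then show ?thesis using D(2) by simp
  qed
  then show "X \<in> lie_algebra (stabilizer I)" by (simp add: lie_algebra_def)
next
  fix X assume X: "X \<in> lie_algebra (stabilizer I)"
  show "X \<in> lieI I"
    unfolding lieI_def
  proof (safe, rule ccontr)
    fix f assume f: "f \<in> I" "der X f \<notin> I"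
    obtain l where l: "Vector_Spaces.linear (\<lambda>c f. cconst c * f) (*) l"
      "\<And>g. g \<in> I \<Longrightarrow> l g = 0" "l (der X f) = 1"
      using cpoly.functional_separating[OF pideal_subspace[OF I] f(2)] by metis
    interpret l: Vector_Spaces.linear "\<lambda>c f. cconst c * f" "(*)" l by fact
    obtain p where p: "\<And>M. mat_eval p M = l (sub M f)"
      using polyfam_functional[OF polyfam_sub l(1)] by (auto simp: polyfun_def)
    have "\<forall>S\<in>stabilizer I. mat_eval p S = 0"
      using stabilizer_inverse[OF I _ f(1)] by (simp add: p l(2))
    then have d0: "((\<lambda>s. mat_eval p (mat 1 + mat_scale s X)) has_field_derivative 0) (at 0)"
      using X by (simp add: lie_algebra_def)
    define n where "n = degree (eps_sub X f)"
    define q where "q = (\<Sum>i\<le>n. monom (l (coeff (eps_sub X f) i)) i)"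
    have pq: "mat_eval p (mat 1 + mat_scale s X) = poly q s" for s
    proof -
      have "sub (mat 1 + mat_scale s X) f = (\<Sum>i\<le>n. cconst (s ^ i) * coeff (eps_sub X f) i)"
        by (simp add: poly_eps_sub[symmetric] poly_altdef n_def mult.commute cconst_power)
      then show ?thesis
        by (simp add: p l.sum l.scale q_def poly_sum poly_monom mult.commute)
    qed
    have "coeff q 1 = l (coeff (eps_sub X f) 1)"
      unfolding q_def coeff_sum by (simp add: if_distrib coeff_eq_0 n_def l.zero cong: if_cong)
    then have "poly (pderiv q) 0 = 1"
      using l(3) by (simp add: poly_0_coeff_0 coeff_pderiv der_def)
    moreover have "poly (pderiv q) 0 = 0"
      using DERIV_unique[OF d0[unfolded pq] poly_DERIV] by simp
    ultimately show False by simp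
  qed
qed

section \<open>Fitting decomposition and Cartan subalgebras\<close>

text \<open>This justifies the exponent \<open>dim g\<close> in \<open>ad_kernel\<close>: it already
  captures everything that some power of \<open>ad x\<close> kills. If the least killing exponent
  were larger than the dimension, a dependence among the nonzero iterates would contradict its
  minimality.\<close>

lemma (in finite_dimensional_vector_space) funpow_dim_eq_0:
  assumes T: "Vector_Spaces.linear scale scale T" and W: "subspace W" "\<And>w. w \<in> W \<Longrightarrow> T w \<in> W"
    and w: "w \<in> W" "(T ^^ k) w = 0"
  shows "(T ^^ dim W) w = 0"
proof (rule ccontr)
  assume nz: "(T ^^ dim W) w \<noteq> 0"
  interpret T: Vector_Spaces.linear scale scale T by fact
  have Tk: "Vector_Spaces.linear scale scale (T ^^ j)" for j
    by (rule funpow_linear[OF T])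
  define n where "n = (LEAST n. (T ^^ n) w = 0)"
  have n0: "(T ^^ n) w = 0"
    unfolding n_def by (rule LeastI[of _ k]) (rule w)
  have "n > dim W"
    using nz funpow_eq_0_mono[OF T.add n0, of "dim W"] by (meson not_le)
  then obtain N where N: "n = Suc N" "dim W \<le> N" by (cases n) auto
  have nN: "(T ^^ N) w \<noteq> 0"
    using not_less_Least[of N "\<lambda>n. (T ^^ n) w = 0"] N(1) by (simp add: n_def)
  obtain B where B: "B \<subseteq> W" "independent B" "W \<subseteq> span B" "card B = dim W"
    using basis_exists by blast
  have fW: "(T ^^ j) w \<in> span B" for j
    using funpow_in_subspace[of W T w j] W(2) w(1) B(3) by blast
  obtain c where c: "\<exists>j\<le>N. c j \<noteq> 0" "(\<Sum>j\<le>N. scale (c j) ((T ^^ j) w)) = 0"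
    by (rule funpow_dependent[of B N "\<lambda>j. (T ^^ j) w"]) (use B N fW finiteI_independent in auto)
  define j where "j = (LEAST j. c j \<noteq> 0)"
  have j: "c j \<noteq> 0" "j \<le> N"
    unfolding j_def using c(1) LeastI_ex[of "\<lambda>j. c j \<noteq> 0"] Least_le[of "\<lambda>j. c j \<noteq> 0"]
    by (blast, meson order_trans)
  have j0: "c i = 0" if "i < j" for i
    using not_less_Least[of i "\<lambda>j. c j \<noteq> 0"] that by (simp add: j_def)
  interpret S: Vector_Spaces.linear scale scale "T ^^ (N - j)" by (rule Tk)
  \<comment> \<open>This power kills every term after the lowest nonzero one and turns that one into
    \<open>c j\<close> times \<open>T^N w\<close>.\<close>
  have "0 = (T ^^ (N - j)) (\<Sum>j\<le>N. scale (c j) ((T ^^ j) w))"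
    by (simp add: c(2) S.zero)
  also have "\<dots> = (\<Sum>i\<le>N. scale (c i) ((T ^^ (N - j + i)) w))"
    by (simp add: S.sum S.scale funpow_add)
  also have "\<dots> = (\<Sum>i\<le>N. if i = j then scale (c j) ((T ^^ N) w) else 0)"
  proof (rule sum.cong)
    fix i assume "i \<in> {..N}"
    consider "i < j" | "i = j" | "i > j" by linarith
    then show "scale (c i) ((T ^^ (N - j + i)) w) = (if i = j then scale (c j) ((T ^^ N) w) else 0)"
    proof cases
      case 3
      then have "(T ^^ (N - j + i)) w = 0"
        using N j(2) by (intro funpow_eq_0_mono[OF T.add n0]) auto
      then show ?thesis using 3 by simp
    qed (use j0 j in auto)
  qed simp
  also have "\<dots> = scale (c j) ((T ^^ N) w)"
    using j by simp
  finally show False using j nN by simp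
qed

section \<open>The Lie bracket and matrices depending polynomially on a matrix\<close>

lemma lie_bracket_simps:
  "lie_bracket x (u + v) = lie_bracket x u + lie_bracket x v"
  "lie_bracket x (u - v) = lie_bracket x u - lie_bracket x v"
  "lie_bracket x (mat_scale c u) = mat_scale c (lie_bracket x u)"
  "lie_bracket (mat_scale c x) u = mat_scale c (lie_bracket x u)"
  "lie_bracket (x - y) u = lie_bracket x u - lie_bracket y u"
  "lie_bracket x 0 = 0" "lie_bracket 0 x = 0" "lie_bracket x x = 0"
  by (simp_all add: lie_bracket_def mat_mul_distrib algebra_simps cmat.scale_right_diff_distrib)

lemma lie_bracket_leibniz:
  "lie_bracket x (lie_bracket u v) = lie_bracket (lie_bracket x u) v + lie_bracket u (lie_bracket x v)"
  by (simp add: lie_bracket_def mat_mul_distrib matrix_mul_assoc algebra_simps)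

lemma lie_bracket_swap: "lie_bracket x y = - lie_bracket y x"
  by (simp add: lie_bracket_def)

lemma lie_bracket_linear: "Vector_Spaces.linear mat_scale mat_scale (lie_bracket x)"
  by unfold_locales (simp_all add: lie_bracket_simps)

lemma lie_bracket_conjm:
  "invertible h \<Longrightarrow> lie_bracket (conjm h X) (conjm h Y) = conjm h (lie_bracket X Y)"
  by (simp add: lie_bracket_def conjm_linear conjm_mult)

lemma lie_bracket_funpow_conjm:
  "invertible h \<Longrightarrow> (lie_bracket (conjm h X) ^^ k) (conjm h Y) = conjm h ((lie_bracket X ^^ k) Y)"
  by (induction k) (simp_all add: lie_bracket_conjm)

lemma lie_bracket_funpow_scale: "(lie_bracket (mat_scale c x) ^^ k) y = mat_scale (c ^ k) ((lie_bracket x ^^ k) y)"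
  by (induction k) (simp_all add: lie_bracket_simps mult.commute)

definition polymat :: "('n::finite cmat \<Rightarrow> 'n cmat) \<Rightarrow> bool" where
  "polymat Z \<longleftrightarrow> (\<forall>i j. polyfun (\<lambda>x. Z x $ i $ j))"

lemma polymat_const: "polymat (\<lambda>x. Z)"
  by (simp add: polymat_def polyfun_const)

lemma polymat_add: "polymat Z \<Longrightarrow> polymat Y \<Longrightarrow> polymat (\<lambda>x. Z x + Y x)"
  by (simp add: polymat_def polyfun_add)

lemma polymat_lie_bracket: "polymat Z \<Longrightarrow> polymat (\<lambda>x. lie_bracket x (Z x))"
  unfolding polymat_def lie_bracket_def
  by (auto simp: matrix_matrix_mult_def intro!: polyfun_diff polyfun_sum polyfun_mult polyfun_nth)

lemma polymat_funpow_lie_bracket: "polymat Z \<Longrightarrow> polymat (\<lambda>x. (lie_bracket x ^^ k) (Z x))"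
  by (induction k) (simp_all add: polymat_lie_bracket)

definition matrix_unit :: "'n \<times> 'n \<Rightarrow> 'n::finite cmat" where
  "matrix_unit p = (\<chi> k l. if k = fst p \<and> l = snd p then 1 else 0)"

lemma matrix_unit_expand: "X = (\<Sum>p\<in>UNIV. mat_scale (X $ fst p $ snd p) (matrix_unit p))"
  using matrix_units_expand[of X] by (simp add: matrix_unit_def case_prod_unfold)

lemma polymat_linear:
  assumes "Vector_Spaces.linear mat_scale mat_scale p" "polymat Z"
  shows "polymat (\<lambda>x. p (Z x))"
proof -
  interpret p: Vector_Spaces.linear mat_scale mat_scale p by fact
  have "p (Z x) $ i $ j = (\<Sum>q\<in>UNIV. Z x $ fst q $ snd q * p (matrix_unit q) $ i $ j)" for x i j
    by (subst matrix_unit_expand[of "Z x"]) (simp add: p.sum p.scale sum_component)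
  then show ?thesis
    using assms(2) by (auto simp: polymat_def intro!: polyfun_sum polyfun_mult polyfun_const)
qed

text \<open>Flattening matrices to vectors indexed by pairs makes \<open>M x\<close> a square
  matrix, whose determinant is the required function.\<close>

lemma polyfun_injectivity:
  fixes M :: "'n::finite cmat \<Rightarrow> 'n cmat \<Rightarrow> 'n cmat"
  assumes lin: "\<And>x. Vector_Spaces.linear mat_scale mat_scale (M x)" and pol: "\<And>Z. polymat (\<lambda>x. M x Z)"
  obtains F where "polyfun F" "\<And>x. F x \<noteq> 0 \<longleftrightarrow> inj (M x)"
proof -
  define A :: "'n cmat \<Rightarrow> complex^('n \<times> 'n)^('n \<times> 'n)" where
    "A x = (\<chi> p q. M x (matrix_unit q) $ fst p $ snd p)" for x
  define flat :: "'n cmat \<Rightarrow> complex^('n \<times> 'n)" where "flat Z = (\<chi> p. Z $ fst p $ snd p)" for Z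
  have flat_inj: "flat Z = flat Y \<longleftrightarrow> Z = Y" for Z Y
    by (auto simp: flat_def vec_eq_iff)
  have flat_surj: "\<exists>Z. v = flat Z" for v
    by (intro exI[of _ "\<chi> i j. v $ (i, j)"]) (simp add: flat_def vec_eq_iff)
  have AM: "A x *v flat Z = flat (M x Z)" for x Z
  proof -
    interpret M: Vector_Spaces.linear mat_scale mat_scale "M x" by (rule lin)
    have "M x Z = (\<Sum>q\<in>UNIV. mat_scale (Z $ fst q $ snd q) (M x (matrix_unit q)))"
      by (subst matrix_unit_expand[of Z]) (simp add: M.sum M.scale)
    then show ?thesis
      by (simp add: flat_def A_def vec_eq_iff matrix_vector_mult_def sum_component mult.commute)
  qed
  have "inj (M x) \<longleftrightarrow> inj ((*v) (A x))" for x
  proof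
    assume i: "inj (M x)"
    show "inj ((*v) (A x))"
    proof (rule injI)
      fix u v assume e: "A x *v u = A x *v v"
      obtain Z Y where "u = flat Z" "v = flat Y" using flat_surj by metis
      then show "u = v" using e i by (simp add: AM flat_inj inj_eq)
    qed
  next
    assume i: "inj ((*v) (A x))"
    show "inj (M x)"
    proof (rule injI)
      fix Z Y assume "M x Z = M x Y"
      then have "A x *v flat Z = A x *v flat Y" by (simp add: AM)
      then show "Z = Y" using i by (simp add: inj_eq flat_inj)
    qed
  qed
  then have "det (A x) \<noteq> 0 \<longleftrightarrow> inj (M x)" for x
    by (simp add: invertible_det_nz[symmetric] invertible_left_inverse matrix_left_invertible_injective)
  moreover have "polyfun (\<lambda>x. det (A x))"
    unfolding det_def using pol
    by (auto intro!: polyfun_sum polyfun_mult polyfun_const polyfun_prod simp: A_def polymat_def)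
  ultimately show ?thesis using that by blast
qed

section \<open>Fitting components of \<open>ad x\<close> and regular elements\<close>

locale matrix_lie_algebra =
  fixes g :: "'n::finite cmat set"
  assumes subspace_g: "cmat.subspace g" and bracket_g: "\<And>X Y. X \<in> g \<Longrightarrow> Y \<in> g \<Longrightarrow> lie_bracket X Y \<in> g"
begin

abbreviation d where "d \<equiv> cmat.dim g"

lemma funpow_bracket_g: "x \<in> g \<Longrightarrow> y \<in> g \<Longrightarrow> (lie_bracket x ^^ k) y \<in> g"
  by (induction k) (auto intro: bracket_g)

lemma ad_kernel_iff: "x \<in> g \<Longrightarrow> y \<in> ad_kernel g x \<longleftrightarrow> y \<in> g \<and> (\<exists>k. (lie_bracket x ^^ k) y = 0)"
  using cmat.funpow_dim_eq_0[OF lie_bracket_linear subspace_g bracket_g] by (auto simp: ad_kernel_def)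

lemma ad_kernel_subset: "ad_kernel g x \<subseteq> g"
  by (auto simp: ad_kernel_def)

lemma ad_kernel_subspace: "cmat.subspace (ad_kernel g x)"
proof -
  interpret S: Vector_Spaces.linear mat_scale mat_scale "lie_bracket x ^^ d"
    by (intro cmat.funpow_linear lie_bracket_linear)
  show ?thesis
    unfolding ad_kernel_def
    by (rule cmat.subspaceI) (auto simp: S.zero S.add S.scale cmat.subspace_0[OF subspace_g]
        cmat.subspace_add[OF subspace_g] cmat.subspace_scale[OF subspace_g])
qed

lemma ad_kernel_bracket:
  assumes "x \<in> g" "y \<in> ad_kernel g x" "z \<in> ad_kernel g x"
  shows "lie_bracket y z \<in> ad_kernel g x"
  using funpow_leibniz_eq_0[of "lie_bracket x" lie_bracket "lie_bracket x" "lie_bracket x", OF lie_bracket_simps(1) lie_bracket_leibniz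
      lie_bracket_simps(7) lie_bracket_simps(6)]
    assms unfolding ad_kernel_iff[OF assms(1)] by (meson bracket_g)

lemma self_in_ad_kernel: "x \<in> g \<Longrightarrow> x \<in> ad_kernel g x"
  by (auto simp: ad_kernel_iff lie_bracket_simps intro!: exI[of _ 1])

text \<open>As \<open>x\<close> lies in its own \<open>ad_kernel\<close>, testing a normalizing
  \<open>y\<close> against \<open>x\<close> alone shows that a power of \<open>ad x\<close> kills
  \<open>[x, y]\<close>, hence that the next power kills \<open>y\<close>.\<close>

lemma ad_kernel_self_normalizing:
  assumes "x \<in> g"
  shows "ad_kernel g x = {y \<in> g. \<forall>z\<in>ad_kernel g x. lie_bracket y z \<in> ad_kernel g x}"
proof (intro equalityI subsetI)
  fix y assume "y \<in> {y \<in> g. \<forall>z\<in>ad_kernel g x. lie_bracket y z \<in> ad_kernel g x}"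
  then have y: "y \<in> g" "lie_bracket y x \<in> ad_kernel g x"
    using self_in_ad_kernel[OF assms] by auto
  then have "lie_bracket x y \<in> ad_kernel g x"
    using cmat.subspace_neg[OF ad_kernel_subspace] by (subst lie_bracket_swap) blast
  then obtain k where "(lie_bracket x ^^ k) (lie_bracket x y) = 0"
    using ad_kernel_iff[OF assms] by blast
  then have "(lie_bracket x ^^ Suc k) y = 0" by (simp add: funpow_swap1)
  then show "y \<in> ad_kernel g x" using y ad_kernel_iff[OF assms] by blast
qed (use ad_kernel_bracket assms ad_kernel_subset in blast)

text \<open>The Fitting one component of \<open>ad x\<close>. At the exponent \<open>d\<close> the
  kernels of the powers on \<open>g\<close> have stabilized, so for \<open>x\<close> in
  \<open>g\<close> the map \<open>ad x\<close> is injective here.\<close>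

definition ad_image :: "'n cmat \<Rightarrow> 'n cmat set" where
  "ad_image x = (lie_bracket x ^^ d) ` g"

lemma ad_image_subspace: "cmat.subspace (ad_image x)"
proof -
  interpret S: Vector_Spaces.linear mat_scale mat_scale "lie_bracket x ^^ d"
    by (intro cmat.funpow_linear lie_bracket_linear)
  show ?thesis
    unfolding ad_image_def by (rule S.subspace_image[OF subspace_g])
qed

lemma ad_image_subset: "x \<in> g \<Longrightarrow> ad_image x \<subseteq> g"
  by (auto simp: ad_image_def funpow_bracket_g)

lemma funpow_ad_image: "x \<in> g \<Longrightarrow> y \<in> ad_image x \<Longrightarrow> (lie_bracket x ^^ k) y \<in> ad_image x"
proof -
  assume x: "x \<in> g" and "y \<in> ad_image x"
  then obtain v where v: "v \<in> g" "y = (lie_bracket x ^^ d) v" by (auto simp: ad_image_def)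
  have "(lie_bracket x ^^ k) y = (lie_bracket x ^^ d) ((lie_bracket x ^^ k) v)"
    unfolding v(2) by (metis add.commute comp_apply funpow_add)
  then show ?thesis using v(1) x by (auto simp: ad_image_def funpow_bracket_g)
qed

lemma ad_image_funpow_eq_0:
  assumes "x \<in> g" "y \<in> ad_image x" "(lie_bracket x ^^ k) y = 0"
  shows "y = 0"
proof -
  obtain v where v: "v \<in> g" "y = (lie_bracket x ^^ d) v"
    using assms by (auto simp: ad_image_def)
  have "(lie_bracket x ^^ (k + d)) v = 0"
    using assms(3) by (simp add: funpow_add v(2))
  then have "v \<in> ad_kernel g x"
    using v(1) ad_kernel_iff[OF assms(1)] by blast
  then show ?thesis by (simp add: ad_kernel_def v(2))
qed

lemma ad_kernel_Int_ad_image: "x \<in> g \<Longrightarrow> ad_kernel g x \<inter> ad_image x = {0}"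
  using ad_image_funpow_eq_0 cmat.subspace_0[OF ad_kernel_subspace] cmat.subspace_0[OF ad_image_subspace]
  by (auto simp: ad_kernel_def)

text \<open>Injectivity of \<open>(ad x)^d\<close> on its image makes it onto there by dimension. So
  \<open>(ad x)^d v\<close> also comes from some \<open>w\<close> in the image, and
  \<open>v - w\<close> is in the kernel.\<close>

lemma fitting_decomposition:
  assumes "x \<in> g" "v \<in> g"
  obtains u w where "u \<in> ad_kernel g x" "w \<in> ad_image x" "v = u + w"
proof -
  let ?K = "lie_bracket x ^^ d"
  interpret S: Vector_Spaces.linear mat_scale mat_scale ?K
    by (intro cmat.funpow_linear lie_bracket_linear)
  interpret P: finite_dimensional_vector_space_pair_1 mat_scale matrix_units mat_scale ..
  have "inj_on ?K (ad_image x)"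
    using ad_image_funpow_eq_0[OF assms(1)] cmat.subspace_diff[OF ad_image_subspace]
    by (intro inj_onI) (metis S.diff eq_iff_diff_eq_0)
  then have "cmat.dim (?K ` ad_image x) = cmat.dim (ad_image x)"
    using ad_image_subspace by (intro P.dim_image_eq S.linear_axioms) (simp add: cmat.span_eq_iff[THEN iffD2])
  then have "?K ` ad_image x = ad_image x"
    using funpow_ad_image[OF assms(1)]
    by (intro cmat.subspace_dim_equal S.subspace_image ad_image_subspace) auto
  moreover have "?K v \<in> ad_image x" using assms by (auto simp: ad_image_def)
  ultimately obtain w where w: "w \<in> ad_image x" "?K v = ?K w" by blast
  have "v - w \<in> ad_kernel g x"
    using w assms ad_image_subset[OF assms(1)] by (auto simp: ad_kernel_def S.diff intro: cmat.subspace_diff[OF subspace_g])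
  then show ?thesis using w(1) that[of "v - w" w] by simp
qed

lemma fitting_projections:
  assumes "x \<in> g"
  obtains p q where "Vector_Spaces.linear mat_scale mat_scale p" "Vector_Spaces.linear mat_scale mat_scale q"
    "\<And>v. p v \<in> ad_kernel g x" "\<And>v. q v \<in> ad_image x"
    "\<And>v. v \<in> ad_kernel g x \<Longrightarrow> p v = v \<and> q v = 0" "\<And>v. v \<in> ad_image x \<Longrightarrow> p v = 0 \<and> q v = v"
    "\<And>v. v \<in> g \<Longrightarrow> v = p v + q v"
proof -
  note z = ad_kernel_Int_ad_image[OF assms]
  obtain p where p: "Vector_Spaces.linear mat_scale mat_scale p" "\<And>v. v \<in> ad_kernel g x \<Longrightarrow> p v = v"
    "\<And>w. w \<in> ad_image x \<Longrightarrow> p w = 0" "range p \<subseteq> ad_kernel g x"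
    by (rule cmat.projection_along[OF ad_kernel_subspace ad_image_subspace z]) (rule that)
  have z': "ad_image x \<inter> ad_kernel g x = {0}" using z by blast
  obtain q where q: "Vector_Spaces.linear mat_scale mat_scale q" "\<And>v. v \<in> ad_image x \<Longrightarrow> q v = v"
    "\<And>w. w \<in> ad_kernel g x \<Longrightarrow> q w = 0" "range q \<subseteq> ad_image x"
    by (rule cmat.projection_along[OF ad_image_subspace ad_kernel_subspace z']) (rule that)
  interpret p: Vector_Spaces.linear mat_scale mat_scale p by (rule p)
  interpret q: Vector_Spaces.linear mat_scale mat_scale q by (rule q)
  have "v = p v + q v" if "v \<in> g" for v
  proof -
    obtain u w where "u \<in> ad_kernel g x" "w \<in> ad_image x" "v = u + w"
      using fitting_decomposition[OF assms \<open>v \<in> g\<close>] by blast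
    then show ?thesis by (simp add: p.add q.add p q)
  qed
  then show ?thesis
    by (intro that[of p q] p(1) q(1)) (use p q in auto)
qed

text \<open>The matrix \<open>q (ad y)\<^sup>d q + (1 - q)\<close> has polynomial entries and is invertible at \<open>y = x\<close>; here
  \<open>q\<close> projects onto the Fitting one component of \<open>ad x\<close>.\<close>

lemma generic_ad_kernel:
  assumes x: "x \<in> g"
  obtains F where "polyfun F" "F x \<noteq> 0"
    "\<And>y. y \<in> g \<Longrightarrow> F y \<noteq> 0 \<Longrightarrow> cmat.dim (ad_kernel g y) \<le> cmat.dim (ad_kernel g x)"
    "\<And>y. y \<in> ad_kernel g x \<Longrightarrow> F y \<noteq> 0 \<Longrightarrow> ad_kernel g y \<subseteq> ad_kernel g x"
proof -
  obtain p q where p: "Vector_Spaces.linear mat_scale mat_scale p" and q: "Vector_Spaces.linear mat_scale mat_scale q"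
    and pq: "\<And>v. p v \<in> ad_kernel g x" "\<And>v. q v \<in> ad_image x"
    "\<And>v. v \<in> ad_kernel g x \<Longrightarrow> p v = v \<and> q v = 0" "\<And>v. v \<in> ad_image x \<Longrightarrow> p v = 0 \<and> q v = v"
    "\<And>v. v \<in> g \<Longrightarrow> v = p v + q v"
    by (rule fitting_projections[OF x]) (rule that)
  interpret p: Vector_Spaces.linear mat_scale mat_scale p by (rule p)
  interpret q: Vector_Spaces.linear mat_scale mat_scale q by (rule q)
  have qq: "q (q v) = q v" for v using pq(2,4) by blast
  define M where "M y Z = q ((lie_bracket y ^^ d) (q Z)) + (Z - q Z)" for y Z
  have lin: "Vector_Spaces.linear mat_scale mat_scale (M y)" for y
  proof -
    interpret S: Vector_Spaces.linear mat_scale mat_scale "lie_bracket y ^^ d"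
      by (intro cmat.funpow_linear lie_bracket_linear)
    show ?thesis
      by unfold_locales (simp_all add: M_def q.add q.scale S.add S.scale algebra_simps cmat.scale_right_diff_distrib)
  qed
  have pol: "polymat (\<lambda>y. M y Z)" for Z
    unfolding M_def by (intro polymat_add polymat_const polymat_linear[OF q] polymat_funpow_lie_bracket)
  obtain F where F: "polyfun F" "\<And>y. F y \<noteq> 0 \<longleftrightarrow> inj (M y)"
    by (rule polyfun_injectivity[OF lin pol]) (rule that)
  have M0: "M y 0 = 0" for y
    using module_hom.zero[OF Vector_Spaces.linear.axioms(3)[OF lin]] .
  have "Z = 0" if "M x Z = 0" for Z
  proof -
    have "q (M x Z) = (lie_bracket x ^^ d) (q Z)"
      using pq(2,4) funpow_ad_image[OF x] by (simp add: M_def q.add q.diff qq)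
    then have "(lie_bracket x ^^ d) (q Z) = 0" using that by (simp add: q.zero)
    then have "q Z = 0" using ad_image_funpow_eq_0[OF x pq(2)] by blast
    then show ?thesis
      using that by (simp add: M_def q.zero additive_funpow(2)[OF lie_bracket_simps(1)] del: funpow.simps)
  qed
  then have "inj (M x)"
    using module_hom.inj_iff_eq_0[OF Vector_Spaces.linear.axioms(3)[OF lin]] by blast
  then have "F x \<noteq> 0" by (simp add: F)
  moreover have "cmat.dim (ad_kernel g y) \<le> cmat.dim (ad_kernel g x)" if y: "y \<in> g" "F y \<noteq> 0" for y
  proof -
    \<comment> \<open>Such a \<open>v\<close> equals \<open>q v\<close> and is annihilated by
      \<open>(ad y)^d\<close>, so \<open>M y\<close> kills it. Hence \<open>p\<close> embeds
      \<open>ad_kernel g y\<close> into \<open>ad_kernel g x\<close>.\<close>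
    have "v = 0" if "v \<in> ad_kernel g y" "p v = 0" for v
    proof -
      have "v \<in> g" using that ad_kernel_subset by blast
      then have "q v = v" using pq(5)[of v] that by simp
      then have "M y v = M y 0"
        using that by (simp add: M0) (simp add: M_def ad_kernel_def q.zero)
      then show ?thesis using y(2) F(2) by (simp add: inj_eq)
    qed
    then have "inj_on p (ad_kernel g y)"
      using cmat.subspace_diff[OF ad_kernel_subspace] by (intro inj_onI) (metis p.diff eq_iff_diff_eq_0)
    then have "cmat.dim (p ` ad_kernel g y) = cmat.dim (ad_kernel g y)"
    proof -
      interpret P: finite_dimensional_vector_space_pair_1 mat_scale matrix_units mat_scale ..
      show ?thesis if "inj_on p (ad_kernel g y)"
        using that ad_kernel_subspace by (intro P.dim_image_eq p) (simp add: cmat.span_eq_iff[THEN iffD2])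
    qed
    moreover have "cmat.dim (p ` ad_kernel g y) \<le> cmat.dim (ad_kernel g x)"
      using pq(1) by (intro cmat.dim_subset) auto
    ultimately show ?thesis by simp
  qed
  moreover have "ad_kernel g y \<subseteq> ad_kernel g x" if y: "y \<in> ad_kernel g x" "F y \<noteq> 0" for y
  proof
    fix z assume z: "z \<in> ad_kernel g y"
    interpret S: Vector_Spaces.linear mat_scale mat_scale "lie_bracket y ^^ d"
      by (intro cmat.funpow_linear lie_bracket_linear)
    have "z \<in> g" using z ad_kernel_subset by blast
    then have e: "z = p z + q z" by (rule pq)
    \<comment> \<open>For \<open>y\<close> in \<open>ad_kernel g x\<close> the map
      \<open>ad y\<close> preserves that subalgebra, so the part of \<open>z\<close> in it
      contributes nothing after applying \<open>q\<close>, and \<open>M y\<close> kills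
      \<open>q z\<close>.\<close>
    have "(lie_bracket y ^^ d) (p z) \<in> ad_kernel g x"
      using pq(1) y(1) ad_kernel_bracket[OF x] by (intro cmat.funpow_in_subspace) auto
    then have "q ((lie_bracket y ^^ d) (p z)) = 0" by (simp add: pq)
    moreover have "(lie_bracket y ^^ d) (p z) + (lie_bracket y ^^ d) (q z) = 0"
      using z e by (simp add: ad_kernel_def flip: S.add)
    then have "q ((lie_bracket y ^^ d) (p z)) + q ((lie_bracket y ^^ d) (q z)) = 0"
      by (simp add: q.zero flip: q.add)
    ultimately have "M y (q z) = M y 0"
      by (simp add: M0) (simp add: M_def qq)
    then have "q z = 0" using y(2) F(2) by (simp add: inj_eq)
    then show "z \<in> ad_kernel g x" using e pq(1) by (metis add_0_right)
  qed
  ultimately show ?thesis using that F(1) by blast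
qed

definition regular :: "'n cmat \<Rightarrow> bool" where
  "regular x \<longleftrightarrow> x \<in> g \<and> (\<forall>y\<in>g. cmat.dim (ad_kernel g x) \<le> cmat.dim (ad_kernel g y))"

lemma regular_exists: "\<exists>x. regular x"
proof -
  have "0 \<in> g" by (rule cmat.subspace_0[OF subspace_g])
  then obtain x where "x \<in> g" "\<And>y. y \<in> g \<Longrightarrow> cmat.dim (ad_kernel g x) \<le> cmat.dim (ad_kernel g y)"
    using ex_has_least_nat[of "\<lambda>x. x \<in> g" 0 "\<lambda>x. cmat.dim (ad_kernel g x)"] by blast
  then show ?thesis by (auto simp: regular_def)
qed

lemma regular_in_g: "regular x \<Longrightarrow> x \<in> g"
  by (simp add: regular_def)

lemma ad_kernel_eq_if_subset:
  assumes "x \<in> g" "regular y" "ad_kernel g x \<subseteq> ad_kernel g y"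
  shows "ad_kernel g x = ad_kernel g y"
  using assms by (intro cmat.subspace_dim_equal ad_kernel_subspace) (auto simp: regular_def)

text \<open>On the line \<open>x + s y\<close>, generically \<open>ad\<^sup>d\<close> kills the Cartan candidate; the leading coefficient
  in \<open>s\<close> is \<open>(ad y)\<^sup>d\<close>.\<close>

lemma regular_ad_kernel_nilpotent:
  assumes x: "regular x" and y: "y \<in> ad_kernel g x" and z: "z \<in> ad_kernel g x"
  shows "(lie_bracket y ^^ d) z = 0"
proof -
  have xg: "x \<in> g" using x by (rule regular_in_g)
  obtain F where F: "polyfun F" "F x \<noteq> 0"
    "\<And>y. y \<in> ad_kernel g x \<Longrightarrow> F y \<noteq> 0 \<Longrightarrow> ad_kernel g y \<subseteq> ad_kernel g x"
    by (rule generic_ad_kernel[OF xg]) (rule that)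
  obtain q where q: "\<And>s. F (x + mat_scale s y) = poly q s"
    using polyfun_line[OF F(1)] by blast
  have "poly q 0 \<noteq> 0" using F(2) q[of 0] by simp
  then have q0: "q \<noteq> 0" by auto
  have kill: "(lie_bracket (x + mat_scale s y) ^^ d) z = 0" if "poly q s \<noteq> 0" for s
  proof -
    have m: "x + mat_scale s y \<in> ad_kernel g x"
      using y self_in_ad_kernel[OF xg]
      by (intro cmat.subspace_add[OF ad_kernel_subspace] cmat.subspace_scale[OF ad_kernel_subspace])
    then have "ad_kernel g (x + mat_scale s y) \<subseteq> ad_kernel g x"
      using F(3) q that by simp
    moreover have "x + mat_scale s y \<in> g" using m ad_kernel_subset by blast
    ultimately have "ad_kernel g (x + mat_scale s y) = ad_kernel g x"
      using x by (intro cmat.subspace_dim_equal ad_kernel_subspace) (auto simp: regular_def)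
    then have "z \<in> ad_kernel g (x + mat_scale s y)" using z by simp
    then show ?thesis by (simp add: ad_kernel_def)
  qed
  have "((lie_bracket y ^^ d) z) $ i $ j = 0" for i j
  proof -
    have "polyfun (\<lambda>x. ((lie_bracket x ^^ d) z) $ i $ j)"
      using polymat_funpow_lie_bracket[OF polymat_const[of z]] unfolding polymat_def by blast
    \<comment> \<open>The line is reversed through \<open>y + u x = u (x + s y)\<close> with
      \<open>s = 1 / u\<close>: the leading coefficient in \<open>s\<close> becomes the value at
      \<open>u = 0\<close>, and the polynomial vanishes at all but finitely many other
      \<open>u\<close>.\<close>
    then obtain r where r: "\<And>u. ((lie_bracket (y + mat_scale u x) ^^ d) z) $ i $ j = poly r u"
      using polyfun_line by blast
    have "poly r u = 0" if "u \<noteq> 0" "poly q (inverse u) \<noteq> 0" for u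
    proof -
      have "y + mat_scale u x = mat_scale u (x + mat_scale (inverse u) y)"
        using that by (simp add: cmat.scale_right_distrib)
      then show ?thesis
        using kill[OF that(2)] by (simp flip: r add: lie_bracket_funpow_scale)
    qed
    then have "UNIV \<subseteq> insert 0 (inverse ` {s. poly q s = 0}) \<union> {u. poly r u = 0}"
      by (auto simp: image_iff) (metis inverse_inverse_eq)
    moreover have "finite (inverse ` {s. poly q s = 0})"
      using q0 by (intro finite_imageI poly_roots_finite)
    ultimately have "infinite {u. poly r u = 0}"
      using infinite_UNIV_char_0[where 'a = complex] by (metis finite.insertI finite_UnI finite_subset)
    then have "r = 0" using poly_roots_finite by blast
    then show ?thesis using r[of 0] by simp
  qed
  then show ?thesis by (simp add: vec_eq_iff)
qed

theorem regular_cartan: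
  assumes "regular x"
  shows "cartan_subalgebra (ad_kernel g x) g"
  unfolding cartan_subalgebra_def lie_subalgebra_def
proof (intro conjI ballI exI[of _ d])
  note x = regular_in_g[OF assms]
  show "ad_kernel g x = {X \<in> g. \<forall>Y\<in>ad_kernel g x. lie_bracket X Y \<in> ad_kernel g x}"
    by (rule ad_kernel_self_normalizing[OF x])
  show "lie_bracket X Y \<in> ad_kernel g x" if "X \<in> ad_kernel g x" "Y \<in> ad_kernel g x" for X Y
    by (rule ad_kernel_bracket[OF x that])
  show "(lie_bracket X ^^ d) Y = 0" if "X \<in> ad_kernel g x" "Y \<in> ad_kernel g x" for X Y
    by (rule regular_ad_kernel_nilpotent[OF assms that])
qed (rule ad_kernel_subset ad_kernel_subspace)+

text \<open>Minimality of the dimension is an open condition: where the polynomial attached to one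
  regular element is nonzero, \<open>ad_kernel\<close> cannot be larger than for that
  element.\<close>

theorem generic_cartan:
  "\<exists>U. zariski_open_in g U \<and> U \<noteq> {} \<and> (\<forall>x\<in>U. cartan_subalgebra (ad_kernel g x) g)"
proof -
  obtain x where x: "regular x" using regular_exists by blast
  obtain F where F: "polyfun F" "F x \<noteq> 0"
    "\<And>y. y \<in> g \<Longrightarrow> F y \<noteq> 0 \<Longrightarrow> cmat.dim (ad_kernel g y) \<le> cmat.dim (ad_kernel g x)"
    by (rule generic_ad_kernel[OF regular_in_g[OF x]]) (rule that)
  obtain p where p: "\<And>X. mat_eval p X = F X" using F(1) by (auto simp: polyfun_def)
  define U where "U = {y \<in> g. F y \<noteq> 0}"
  have "g - U = {y \<in> g. \<forall>q\<in>{p}. mat_eval q y = 0}" by (auto simp: U_def p)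
  then have "zariski_open_in g U"
    unfolding zariski_open_in_def zariski_closed_in_def by (auto simp: U_def)
  moreover have "x \<in> U" using F(2) regular_in_g[OF x] by (simp add: U_def)
  moreover have "regular y" if "y \<in> U" for y
    using that F(3) x by (auto simp: regular_def U_def intro: order_trans)
  ultimately show ?thesis using regular_cartan by blast
qed

end

section \<open>Conjugacy of Cartan subalgebras\<close>

lemma mat_scale_of_real: "r *\<^sub>R X = mat_scale (of_real r) X"
  by (simp add: vec_eq_iff) (simp add: scaleR_conv_of_real)

lemma bounded_linear_cmat:
  fixes p :: "'n::finite cmat \<Rightarrow> 'n cmat"
  assumes "Vector_Spaces.linear mat_scale mat_scale p"
  shows "bounded_linear p"
proof -
  interpret p: Vector_Spaces.linear mat_scale mat_scale p by fact
  have "linear p"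
    by (rule linearI) (simp_all add: p.add p.scale mat_scale_of_real)
  then show ?thesis by (simp add: linear_conv_bounded_linear)
qed

lemma bounded_bilinear_matrix_mult: "bounded_bilinear ((**) :: 'n::finite cmat \<Rightarrow> 'n cmat \<Rightarrow> 'n cmat)"
proof -
  have "bilinear ((**) :: 'n cmat \<Rightarrow> 'n cmat \<Rightarrow> 'n cmat)"
    unfolding bilinear_def
    by (auto intro!: linearI simp: mat_mul_distrib mat_scale_of_real)
  then show ?thesis by (simp add: bilinear_conv_bounded_bilinear)
qed

lemma continuous_on_mnorm: "continuous_on UNIV (mnorm :: 'n::finite cmat \<Rightarrow> real)"
  unfolding mnorm_def[abs_def] by (intro continuous_intros)

lemma norm_le_mnorm: "norm X \<le> mnorm X"
proof -
  have "norm X \<le> (\<Sum>i\<in>UNIV. norm (X $ i))"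
    unfolding norm_vec_def[of X] by (rule L2_set_le_sum) simp
  also have "\<dots> \<le> mnorm X"
    unfolding mnorm_def
  proof (rule sum_mono)
    show "norm (X $ i) \<le> (\<Sum>j\<in>UNIV. cmod (X $ i $ j))" for i
      unfolding norm_vec_def[of "X $ i"] by (rule L2_set_le_sum) simp
  qed
  finally show ?thesis .
qed

lemma mnorm_le_norm: "mnorm (X :: 'n::finite cmat) \<le> (real CARD('n)) ^ 2 * norm X"
proof -
  have "cmod (X $ i $ j) \<le> norm X" for i j
    by (rule order_trans[OF Finite_Cartesian_Product.norm_nth_le Finite_Cartesian_Product.norm_nth_le])
  then have "mnorm X \<le> (\<Sum>i\<in>(UNIV :: 'n set). \<Sum>j\<in>(UNIV :: 'n set). norm X)"
    unfolding mnorm_def by (intro sum_mono)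
  then show ?thesis by (simp add: power2_eq_square)
qed

lemma continuous_on_mpow: "continuous_on UNIV (\<lambda>X :: 'n::finite cmat. mpow X k $ i $ j)"
proof -
  have "polyfun (\<lambda>X :: 'n cmat. mpow X k $ i $ j)"
    by (induction k arbitrary: i)
      (auto simp: mpow_simps matrix_matrix_mult_def intro!: polyfun_const polyfun_sum polyfun_mult polyfun_nth)
  then show ?thesis by (rule polyfun_continuous)
qed

text \<open>On this neighbourhood of 0 the series is dominated by \<open>1 / fact k\<close>. The
  open mapping argument takes place inside it.\<close>

lemma continuous_on_mexp: "continuous_on {X :: 'n::finite cmat. mnorm X < 1} mexp"
proof -
  have "continuous_on {X :: 'n cmat. mnorm X < 1} (\<lambda>X. suminf (\<lambda>k. mpow X k $ i $ j / fact k))" for i j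
  proof (rule uniform_limit_theorem)
    show "uniform_limit {X :: 'n cmat. mnorm X < 1} (\<lambda>n X. \<Sum>k<n. mpow X k $ i $ j / fact k)
       (\<lambda>X. suminf (\<lambda>k. mpow X k $ i $ j / fact k)) sequentially"
    proof (rule Weierstrass_m_test)
      show "summable (\<lambda>k. 1 / fact k :: real)"
        using summable_exp[of "1 :: real"] by (simp add: field_simps)
      fix k and X :: "'n cmat" assume "X \<in> {X. mnorm X < 1}"
      then have "mnorm X ^ k \<le> 1"
        by (intro power_le_one mnorm_nonneg) auto
      then have "cmod (mpow X k $ i $ j) \<le> 1"
        using mpow_bound[of X k i j] by linarith
      then show "norm (mpow X k $ i $ j / fact k) \<le> 1 / fact k"
        by (simp add: norm_divide divide_right_mono)
    qed
    show "\<forall>\<^sub>F n in sequentially. continuous_on {X :: 'n cmat. mnorm X < 1} (\<lambda>X. \<Sum>k<n. mpow X k $ i $ j / fact k)"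
      by (intro always_eventually allI continuous_intros continuous_on_subset[OF continuous_on_mpow]) auto
  qed simp
  then show ?thesis
    unfolding mexp_def by (intro continuous_on_vec_lambda)
qed

lemma mexp_remainder:
  assumes "mnorm X \<le> 1"
  shows "cmod ((mexp X - mat 1 - X) $ i $ j) \<le> exp 1 * (mnorm X)\<^sup>2"
proof -
  have s: "summable (\<lambda>k. mpow X (k + 2) $ i $ j / fact (k + 2))"
    by (rule summable_ignore_initial_segment[OF summable_mexp])
  have "suminf (\<lambda>k. mpow X k $ i $ j / fact k) = suminf (\<lambda>k. mpow X (k + 2) $ i $ j / fact (k + 2)) + (\<Sum>k<2. mpow X k $ i $ j / fact k)"
    by (rule suminf_split_initial_segment) (rule summable_mexp)
  then have e: "(mexp X - mat 1 - X) $ i $ j = suminf (\<lambda>k. mpow X (k + 2) $ i $ j / fact (k + 2))"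
    by (simp add: mexp_def numeral_2_eq_2 mpow_simps)
  have b: "norm (mpow X (k + 2) $ i $ j / fact (k + 2)) \<le> (mnorm X)\<^sup>2 * (1 / fact k)" for k
  proof -
    have "cmod (mpow X (k + 2) $ i $ j) \<le> mnorm X ^ (k + 2)" by (rule mpow_bound)
    also have "\<dots> \<le> (mnorm X)\<^sup>2"
      using assms mnorm_nonneg[of X] by (intro power_decreasing) auto
    finally have "norm (mpow X (k + 2) $ i $ j / fact (k + 2)) \<le> (mnorm X)\<^sup>2 / fact (k + 2)"
      unfolding norm_divide norm_fact by (rule divide_right_mono) (rule fact_ge_zero)
    also have "\<dots> \<le> (mnorm X)\<^sup>2 / fact k"
      by (intro divide_left_mono fact_mono) auto
    finally show ?thesis by simp
  qed
  have se: "summable (\<lambda>k. 1 / fact k :: real)" "suminf (\<lambda>k. 1 / fact k) = exp (1 :: real)"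
    using summable_exp[of "1 :: real"] by (simp_all add: field_simps exp_def scaleR_conv_of_real)
  have "cmod ((mexp X - mat 1 - X) $ i $ j) \<le> suminf (\<lambda>k. (mnorm X)\<^sup>2 * (1 / fact k))"
    unfolding e by (rule norm_suminf_le[OF b]) (rule summable_mult[OF se(1)])
  also have "\<dots> = exp 1 * (mnorm X)\<^sup>2"
    by (subst suminf_mult[OF se(1)]) (simp add: se(2))
  finally show ?thesis .
qed

text \<open>Made for \<open>sussmann_open_mapping\<close>, which asks for continuity on an open set
  and a derivative with a right inverse at one single point.\<close>

lemma mexp_has_derivative: "(mexp has_derivative (\<lambda>X. X)) (at (0 :: 'n::finite cmat))"
proof -
  define C where "C = (real CARD('n)) ^ 2"
  have C1: "C \<ge> 1"
    unfolding C_def by (simp add: Suc_leI)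
  show ?thesis
  \<comment> \<open>\<open>C\<close> bounds \<open>mnorm\<close> in terms of \<open>norm\<close>.
    One factor \<open>C\<close> counts the entries of the remainder, two come from squaring
    \<open>mnorm X \<le> C * norm X\<close>, and the radius \<open>1 / C\<close> keeps
    \<open>mnorm X\<close> at most 1.\<close>
  proof (rule has_derivativeI_sandwich[where e = "1 / C" and H = "\<lambda>X. exp 1 * C ^ 3 * norm X"])
    fix X :: "'n cmat" assume X: "X \<noteq> 0" "dist X 0 < 1 / C"
    have m: "mnorm X \<le> C * norm X" using mnorm_le_norm[of X] by (simp add: C_def)
    have "C * norm X \<le> 1" using X(2) C1 by (simp add: field_simps)
    then have m1: "mnorm X \<le> 1" using m by linarith
    have "norm (mexp X - mat 1 - X) \<le> (\<Sum>i\<in>(UNIV :: 'n set). \<Sum>j\<in>(UNIV :: 'n set). exp 1 * (mnorm X)\<^sup>2)"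
      unfolding mnorm_def[of "mexp X - mat 1 - X"]
      by (rule order_trans[OF norm_le_mnorm]) (unfold mnorm_def[of "mexp X - mat 1 - X"], intro sum_mono mexp_remainder m1)
    also have "\<dots> = C * (exp 1 * (mnorm X)\<^sup>2)"
      by (simp add: C_def power2_eq_square)
    also have "\<dots> \<le> C * (exp 1 * (C * norm X)\<^sup>2)"
      using C1 m mnorm_nonneg[of X] by (intro mult_left_mono power_mono) auto
    also have "\<dots> = exp 1 * C ^ 3 * norm X * norm X"
      by (simp add: power2_eq_square power3_eq_cube algebra_simps)
    finally have "norm (mexp X - mat 1 - X) / norm X \<le> exp 1 * C ^ 3 * norm X"
      using X(1) by (simp add: divide_le_eq)
    then show "norm ((mexp X - mexp 0) - (X - 0)) / norm (X - 0) \<le> exp 1 * C ^ 3 * norm X"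
      by (simp add: mexp_0)
  next
    show "((\<lambda>X. exp 1 * C ^ 3 * norm X) \<longlongrightarrow> 0) (at (0 :: 'n cmat))"
      by (auto intro!: tendsto_eq_intros)
  qed (use C1 in \<open>auto intro: bounded_linear_ident\<close>)
qed

text \<open>In an eigenbasis of \<open>Z\<close> the map \<open>ad Z\<close> multiplies the entry at
  \<open>i\<close>, \<open>j\<close> by \<open>d i - d j\<close>, and a power of a number vanishes
  only if the number does.\<close>

lemma diagonalizable_bracket_funpow_eq_0:
  assumes "diagonalizable_matrix Z" "(lie_bracket Z ^^ k) Y = 0"
  shows "lie_bracket Z Y = 0"
proof -
  obtain P d where P: "invertible P" "Z = conjm P (diagm d)"
    using assms(1) by (auto simp: diagonalizable_iff)
  define W where "W = conjm (matrix_inv P) Y"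
  have Y: "Y = conjm P W" by (simp add: W_def P(1))
  have e: "(lie_bracket (diagm d) ^^ k) W $ i $ j = (d i - d j) ^ k * W $ i $ j" for i j k
    by (induction k) (simp_all add: lie_bracket_def diagm_mult algebra_simps)
  have "conjm (matrix_inv P) ((lie_bracket Z ^^ k) Y) = 0"
    by (simp add: assms(2) conjm_linear)
  then have "(lie_bracket (diagm d) ^^ k) W = 0"
    by (simp add: P Y lie_bracket_funpow_conjm)
  then have "(d i - d j) ^ k * W $ i $ j = 0" for i j
    by (simp flip: e)
  then have "(lie_bracket (diagm d) ^^ 1) W $ i $ j = 0" for i j
    unfolding e by auto
  then have "lie_bracket (diagm d) W = 0" by (simp add: vec_eq_iff)
  then show ?thesis
    by (simp add: P Y lie_bracket_conjm conjm_linear)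
qed

text \<open>The link between the group and the algebra is reduced to two facts: \<open>G\<close>
  normalizes \<open>g\<close> and contains the exponentials of its elements.\<close>

locale matrix_lie_group = matrix_lie_algebra g for g :: "'n::finite cmat set" +
  fixes G :: "'n cmat set"
  assumes G_invertible: "h \<in> G \<Longrightarrow> invertible h"
    and G_mult: "h \<in> G \<Longrightarrow> k \<in> G \<Longrightarrow> h ** k \<in> G"
    and G_inv: "h \<in> G \<Longrightarrow> matrix_inv h \<in> G"
    and G_g: "h \<in> G \<Longrightarrow> X \<in> g \<Longrightarrow> conjm h X \<in> g"
    and mexp_G: "X \<in> g \<Longrightarrow> mexp X \<in> G"
begin

lemma ad_kernel_conjm:
  assumes h: "h \<in> G"
  shows "ad_kernel g (conjm h x) = conjm h ` ad_kernel g x"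
proof (intro equalityI subsetI)
  fix y assume y: "y \<in> ad_kernel g (conjm h x)"
  have yh: "y = conjm h (conjm (matrix_inv h) y)" by (simp add: G_invertible h)
  have "conjm (matrix_inv h) ((lie_bracket (conjm h x) ^^ d) y) = 0"
    using y by (simp add: ad_kernel_def conjm_linear)
  then have "(lie_bracket x ^^ d) (conjm (matrix_inv h) y) = 0"
    by (subst (asm) yh) (simp add: lie_bracket_funpow_conjm G_invertible h del: conjm_inv(1))
  then have "conjm (matrix_inv h) y \<in> ad_kernel g x"
    using y G_g[OF G_inv[OF h]] by (simp add: ad_kernel_def)
  then show "y \<in> conjm h ` ad_kernel g x" using yh by blast
next
  fix y assume "y \<in> conjm h ` ad_kernel g x"
  then show "y \<in> ad_kernel g (conjm h x)"
    using G_g[OF h] by (auto simp: ad_kernel_def lie_bracket_funpow_conjm G_invertible h conjm_linear)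
qed

lemma dim_ad_kernel_conjm:
  assumes h: "h \<in> G"
  shows "cmat.dim (ad_kernel g (conjm h x)) = cmat.dim (ad_kernel g x)"
proof -
  interpret P: finite_dimensional_vector_space_pair_1 mat_scale matrix_units mat_scale ..
  have "Vector_Spaces.linear mat_scale mat_scale (conjm h)"
    by unfold_locales (simp_all add: conjm_linear)
  moreover have "inj_on (conjm h) A" for A
    by (rule inj_on_inverseI[of _ "conjm (matrix_inv h)"]) (simp add: G_invertible h)
  ultimately show ?thesis
    unfolding ad_kernel_conjm[OF h] by (rule P.dim_image_eq)
qed

lemma regular_conjm: "h \<in> G \<Longrightarrow> x \<in> g \<Longrightarrow> regular (conjm h x) \<longleftrightarrow> regular x"
  by (simp add: regular_def dim_ad_kernel_conjm G_g)

text \<open>The map \<open>w \<mapsto> e\<^sup>q\<^sup>w (x + p w) e\<^sup>-\<^sup>q\<^sup>w + (1 - p - q) w\<close>, with \<open>p\<close> and \<open>q\<close> the Fitting projections,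
  has invertible derivative at \<open>0\<close>.\<close>

lemma local_conjugacy:
  assumes x: "x \<in> g"
  obtains e where "e > 0"
    "\<And>y. y \<in> g \<Longrightarrow> dist x y < e \<Longrightarrow> \<exists>h\<in>G. \<exists>z\<in>ad_kernel g x. y = conjm h z"
proof -
  obtain p q where p: "Vector_Spaces.linear mat_scale mat_scale p" and q: "Vector_Spaces.linear mat_scale mat_scale q"
    and pq: "\<And>v. p v \<in> ad_kernel g x" "\<And>v. q v \<in> ad_image x"
    "\<And>v. v \<in> ad_kernel g x \<Longrightarrow> p v = v \<and> q v = 0" "\<And>v. v \<in> ad_image x \<Longrightarrow> p v = 0 \<and> q v = v"
    "\<And>v. v \<in> g \<Longrightarrow> v = p v + q v"
    by (rule fitting_projections[OF x]) (rule that)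
  interpret p: Vector_Spaces.linear mat_scale mat_scale p by (rule p)
  interpret q: Vector_Spaces.linear mat_scale mat_scale q by (rule q)
  have bp: "bounded_linear p" and bq: "bounded_linear q"
    using p q by (auto intro: bounded_linear_cmat)
  note bmm = bounded_bilinear_matrix_mult[where 'n = 'n]
  define S where "S = {w. mnorm (q w) < 1}"
  \<comment> \<open>The open mapping theorem works in the space of all matrices, so the last summand
    fills up the directions outside the two Fitting components. It turns out to vanish whenever the
    value lies in \<open>g\<close>.\<close>
  define f where "f w = mexp (q w) ** (x + p w) ** mexp (- q w) + (w - p w - q w)" for w
  \<comment> \<open>The product rule at 0 gives \<open>[q w, x] + p w\<close>, and the derivative of
    the last summand cancels \<open>p w\<close>.\<close>
  define f' where "f' w = lie_bracket (q w) x + (w - q w)" for w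
  have cont_q: "continuous_on A q" "continuous_on A p" for A
    using bq bp by (auto intro: linear_continuous_on)
  have "open S"
    unfolding S_def
    by (intro open_Collect_less continuous_on_const continuous_on_compose2[OF continuous_on_mnorm cont_q(1)]) auto
  moreover have "continuous_on S f"
  proof -
    have "mnorm (- q w) < 1" if "w \<in> S" for w
      using that by (simp add: S_def mnorm_def)
    then have "continuous_on S (\<lambda>w. mexp (q w))" "continuous_on S (\<lambda>w. mexp (- q w))"
      by (auto intro!: continuous_on_compose2[OF continuous_on_mexp] continuous_on_minus cont_q simp: S_def)
    then show ?thesis
      unfolding f_def by (intro continuous_intros bounded_bilinear.continuous_on[OF bmm] cont_q)
  qed
  moreover have "0 \<in> S"
    by (simp add: S_def q.zero mnorm_def)
  moreover have "(f has_derivative f') (at 0)"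
  proof -
    have dq: "(q has_derivative q) (at 0)" "(p has_derivative p) (at 0)"
      using bq bp by (auto intro: bounded_linear_imp_has_derivative)
    have e1: "((\<lambda>w. mexp (q w)) has_derivative (\<lambda>w. q w)) (at 0)"
      by (rule has_derivative_compose[OF dq(1)]) (simp add: q.zero mexp_has_derivative)
    have e2: "((\<lambda>w. mexp (- q w)) has_derivative (\<lambda>w. - q w)) (at 0)"
      by (rule has_derivative_compose[OF has_derivative_minus[OF dq(1)]]) (simp add: q.zero mexp_has_derivative)
    have e3: "((\<lambda>w. x + p w) has_derivative (\<lambda>w. p w)) (at 0)"
      using has_derivative_add[OF has_derivative_const[of x] dq(2)] by simp
    have e4: "((\<lambda>w. w - p w - q w) has_derivative (\<lambda>w. w - p w - q w)) (at 0)"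
      by (intro has_derivative_diff has_derivative_ident dq)
    show ?thesis
      using has_derivative_add[OF bounded_bilinear.FDERIV[OF bmm bounded_bilinear.FDERIV[OF bmm e1 e3] e2] e4]
      unfolding f_def[abs_def, symmetric]
      by (rule has_derivative_eq_rhs)
        (simp add: fun_eq_iff f'_def q.zero p.zero mexp_0 lie_bracket_def mat_mul_distrib matrix_mul_assoc
          bounded_bilinear.minus_right[OF bmm])
  qed
  moreover obtain f'' where "bounded_linear f''" "f' \<circ> f'' = id"
  proof -
    have lf: "Vector_Spaces.linear mat_scale mat_scale f'"
      by unfold_locales (simp_all add: f'_def q.add q.scale lie_bracket_def mat_mul_distrib algebra_simps cmat.scale_right_diff_distrib cmat.scale_right_distrib)
    have lin: "linear f'"
      using bounded_linear_cmat[OF lf] by (simp add: linear_conv_bounded_linear)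
    have "w = 0" if "f' w = 0" for w
    proof -
      have a: "lie_bracket (q w) x \<in> ad_image x"
        using funpow_ad_image[OF x pq(2), of 1 w] cmat.subspace_neg[OF ad_image_subspace]
        by (subst lie_bracket_swap) simp
      have "q (f' w) = lie_bracket (q w) x"
        using pq(4)[OF a] pq(4)[OF pq(2)[of w]] by (simp add: f'_def q.add q.diff)
      then have "(lie_bracket x ^^ 1) (q w) = 0"
        using that lie_bracket_swap[of x "q w"] by (simp add: q.zero)
      then have "q w = 0" using ad_image_funpow_eq_0[OF x pq(2)] by blast
      then show ?thesis using that by (simp add: f'_def lie_bracket_simps)
    qed
    then have "inj f'"
      using module_hom.inj_iff_eq_0[OF Vector_Spaces.linear.axioms(3)[OF lf]] by blast
    then obtain k where "linear k" "\<And>w. f' (k w) = w"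
      using linear_injective_isomorphism[OF lin] by blast
    then show ?thesis
      using that[of k] by (auto simp: linear_conv_bounded_linear fun_eq_iff)
  qed
  ultimately have "f 0 \<in> interior (f ` S)"
    using sussmann_open_mapping[of S f 0 f' f'' S] by (simp add: interior_open)
  moreover have "f 0 = x"
    by (simp add: f_def p.zero q.zero mexp_0)
  ultimately obtain e where e: "e > 0" "ball x e \<subseteq> f ` S"
    by (auto simp: mem_interior)
  show ?thesis
  proof (rule that[OF e(1)])
    fix y assume y: "y \<in> g" "dist x y < e"
    then obtain w where w: "y = f w" using e(2) by (metis imageE mem_ball subsetD)
    have qg: "q w \<in> g" "p w \<in> g" using pq(1,2) ad_kernel_subset ad_image_subset[OF x] by blast+
    have h: "mexp (q w) \<in> G" using mexp_G qg by blast
    have z: "x + p w \<in> ad_kernel g x"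
      by (intro cmat.subspace_add[OF ad_kernel_subspace] self_in_ad_kernel x pq)
    have c: "mexp (q w) ** (x + p w) ** mexp (- q w) = conjm (mexp (q w)) (x + p w)"
      by (simp add: conjm_def invertible_mexp)
    have cg: "conjm (mexp (q w)) (x + p w) \<in> g"
      using G_g[OF h] z ad_kernel_subset by blast
    have "y - conjm (mexp (q w)) (x + p w) = w - p w - q w"
      by (simp add: w f_def c)
    \<comment> \<open>An element of \<open>g\<close> is the sum of its two Fitting projections, and
      both projections of this remainder are zero.\<close>
    then have rg: "w - p w - q w \<in> g"
      using cmat.subspace_diff[OF subspace_g y(1) cg] by simp
    then have "w - p w - q w = p (w - p w - q w) + q (w - p w - q w)" by (rule pq)
    also have "\<dots> = 0"
      using pq(3)[OF pq(1)[of w]] pq(4)[OF pq(2)[of w]] by (simp add: p.diff q.diff)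
    finally have "y = conjm (mexp (q w)) (x + p w)"
      by (simp add: w f_def c)
    then show "\<exists>h\<in>G. \<exists>z\<in>ad_kernel g x. y = conjm h z" using h z by blast
  qed
qed

text \<open>On the complex line through \<open>x\<close> and a regular \<open>a\<close>, the
  polynomial of \<open>generic_ad_kernel\<close> is nonzero at \<open>a\<close>. Its finitely many
  zeros leave regular points arbitrarily close to \<open>x\<close>.\<close>

lemma regular_dense:
  assumes x: "x \<in> g" and e: "e > 0"
  obtains y where "regular y" "dist x y < e"
proof -
  obtain a where a: "regular a" using regular_exists by blast
  obtain F where F: "polyfun F" "F a \<noteq> 0"
    "\<And>y. y \<in> g \<Longrightarrow> F y \<noteq> 0 \<Longrightarrow> cmat.dim (ad_kernel g y) \<le> cmat.dim (ad_kernel g a)"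
    by (rule generic_ad_kernel[OF regular_in_g[OF a]]) (rule that)
  obtain q where q: "\<And>s. F (x + mat_scale s (a - x)) = poly q s"
    using polyfun_line[OF F(1)] by blast
  have "poly q 1 \<noteq> 0" using F(2) q[of 1] by simp
  then have fin: "finite {s. poly q s = 0}" by (intro poly_roots_finite) auto
  \<comment> \<open>The added 1 covers the case \<open>a = x\<close>.\<close>
  define r where "r = e / (norm (a - x) + 1)"
  have r: "r > 0" using e by (simp add: r_def add_nonneg_pos)
  have "infinite (ball (0 :: complex) r)"
    using uncountable_ball[OF r] by (rule uncountable_infinite)
  then obtain s where s: "s \<in> ball 0 r" "poly q s \<noteq> 0"
    using fin by (metis (mono_tags, lifting) finite_subset mem_Collect_eq subsetI)
  let ?y = "x + mat_scale s (a - x)"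
  have "?y \<in> g"
    using x regular_in_g[OF a]
    by (intro cmat.subspace_add[OF subspace_g] cmat.subspace_scale[OF subspace_g] cmat.subspace_diff[OF subspace_g])
  then have "regular ?y"
    using F(3)[of ?y] s(2) q a unfolding regular_def by (auto dest: order_trans)
  moreover have "dist x ?y < e"
  proof -
    have "norm (mat_scale s X) = cmod s * norm X" for X :: "'n cmat"
    proof -
      have "norm (mat_scale s X $ i) = cmod s * norm (X $ i)" for i
        by (simp add: norm_vec_def norm_mult L2_set_right_distrib)
      then show ?thesis
        by (simp add: norm_vec_def[of "mat_scale s X"] norm_vec_def[of X] L2_set_right_distrib)
    qed
    then have "dist x ?y = cmod s * norm (a - x)"
      by (simp add: dist_norm)
    also have "\<dots> \<le> r * norm (a - x)"
      using s(1) by (intro mult_right_mono) auto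
    also have "\<dots> < e"
    proof -
      have "0 < norm (a - x) + 1" by (simp add: add_nonneg_pos)
      then show ?thesis using e by (simp add: r_def pos_divide_less_eq distrib_left)
    qed
    finally show ?thesis .
  qed
  ultimately show ?thesis using that by blast
qed

text \<open>A regular \<open>b\<close> near \<open>a\<close> is conjugate to some \<open>z\<close>
  in \<open>ad_kernel g a\<close>. Nilpotency of that subalgebra puts it inside
  \<open>ad_kernel g z\<close>, and minimality of the dimension gives equality.\<close>

lemma regular_near_conj:
  assumes a: "regular a"
  obtains e where "e > 0"
    "\<And>b. regular b \<Longrightarrow> dist a b < e \<Longrightarrow> \<exists>h\<in>G. ad_kernel g b = conjm h ` ad_kernel g a"
proof -
  obtain e where e: "e > 0"
    "\<And>y. y \<in> g \<Longrightarrow> dist a y < e \<Longrightarrow> \<exists>h\<in>G. \<exists>z\<in>ad_kernel g a. y = conjm h z"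
    using local_conjugacy[OF regular_in_g[OF a]] by blast
  show ?thesis
  proof (rule that[OF e(1)])
    fix b assume b: "regular b" "dist a b < e"
    then obtain h z where h: "h \<in> G" "z \<in> ad_kernel g a" "b = conjm h z"
      using e(2) regular_in_g by blast
    have zg: "z \<in> g" using h ad_kernel_subset by blast
    have z: "regular z" using b(1) regular_conjm[OF h(1) zg] h(3) by simp
    have "ad_kernel g a \<subseteq> ad_kernel g z"
      using regular_ad_kernel_nilpotent[OF a h(2)] ad_kernel_subset by (auto simp: ad_kernel_def)
    then have "ad_kernel g a = ad_kernel g z"
      by (rule ad_kernel_eq_if_subset[OF regular_in_g[OF a] z])
    then show "\<exists>h\<in>G. ad_kernel g b = conjm h ` ad_kernel g a"
      using h ad_kernel_conjm by blast
  qed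
qed

lemma regular_conj:
  assumes a: "regular a" and b: "regular b"
  obtains h where "h \<in> G" "ad_kernel g b = conjm h ` ad_kernel g a"
proof -
  obtain Fa where Fa: "polyfun Fa" "Fa a \<noteq> 0"
    "\<And>y. y \<in> g \<Longrightarrow> Fa y \<noteq> 0 \<Longrightarrow> cmat.dim (ad_kernel g y) \<le> cmat.dim (ad_kernel g a)"
    by (rule generic_ad_kernel[OF regular_in_g[OF a]]) (rule that)
  obtain Fb where Fb: "polyfun Fb" "Fb b \<noteq> 0"
    "\<And>y. y \<in> g \<Longrightarrow> Fb y \<noteq> 0 \<Longrightarrow> cmat.dim (ad_kernel g y) \<le> cmat.dim (ad_kernel g b)"
    by (rule generic_ad_kernel[OF regular_in_g[OF b]]) (rule that)
  define y where "y s = a + mat_scale s (b - a)" for s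
  have y01: "y 0 = a" "y 1 = b" by (simp_all add: y_def)
  obtain qa where qa: "\<And>s. Fa (y s) = poly qa s"
    unfolding y_def using polyfun_line[OF Fa(1)] by blast
  obtain qb where qb: "\<And>s. Fb (y s) = poly qb s"
    unfolding y_def using polyfun_line[OF Fb(1)] by blast
  \<comment> \<open>With two polynomials, one for each endpoint, both endpoints belong to
    \<open>S\<close>. The complement is finite, and removing finitely many points from the complex
    line leaves it connected.\<close>
  define S where "S = {s. Fa (y s) \<noteq> 0 \<or> Fb (y s) \<noteq> 0}"
  have S01: "0 \<in> S" "1 \<in> S" using Fa(2) Fb(2) by (simp_all add: S_def y01)
  have yg: "y s \<in> g" for s
    unfolding y_def using regular_in_g[OF a] regular_in_g[OF b]
    by (intro cmat.subspace_add[OF subspace_g] cmat.subspace_scale[OF subspace_g] cmat.subspace_diff[OF subspace_g])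
  have reg: "regular (y s)" if "s \<in> S" for s
    using that Fa(3)[OF yg] Fb(3)[OF yg] yg a b unfolding S_def regular_def by (blast intro: order_trans)
  have "poly qa 0 \<noteq> 0" using Fa(2) by (simp add: y01 flip: qa)
  then have "finite {s. poly qa s = 0}" by (intro poly_roots_finite) auto
  then have "finite (- S)"
    by (rule rev_finite_subset) (auto simp: S_def qa)
  then have "connected (- (- S))"
    by (intro path_connected_imp_connected path_connected_complement_countable countable_finite) auto
  then have conn: "connected S" by simp
  have cy: "continuous_on UNIV y"
  proof -
    have "continuous_on UNIV (\<lambda>s. mat_scale s (b - a))"
      by (simp add: mat_scale_def map_matrix_def) (intro continuous_intros)
    then show ?thesis unfolding y_def by (intro continuous_intros)
  qed
  let ?R = "\<lambda>s t. \<exists>h\<in>G. ad_kernel g (y t) = conjm h ` ad_kernel g (y s)"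
  have "?R 0 1"
  proof (rule connected_equivalence_relation[OF conn S01])
    fix s t assume "?R s t"
    then obtain h where h: "h \<in> G" "ad_kernel g (y t) = conjm h ` ad_kernel g (y s)" by blast
    then have "ad_kernel g (y s) = conjm (matrix_inv h) ` ad_kernel g (y t)"
      by (simp add: image_image G_invertible)
    then show "?R t s" using G_inv[OF h(1)] by blast
  next
    fix s t u assume "?R s t" "?R t u"
    then obtain h k where h: "h \<in> G" "ad_kernel g (y t) = conjm h ` ad_kernel g (y s)"
      and k: "k \<in> G" "ad_kernel g (y u) = conjm k ` ad_kernel g (y t)" by blast
    then have "ad_kernel g (y u) = conjm (k ** h) ` ad_kernel g (y s)"
      by (simp add: image_image conjm_conjm G_invertible)
    then show "?R s u" using G_mult[OF k(1) h(1)] by blast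
  next
    fix s assume s: "s \<in> S"
    obtain e where e: "e > 0" "\<And>b. regular b \<Longrightarrow> dist (y s) b < e \<Longrightarrow> \<exists>h\<in>G. ad_kernel g b = conjm h ` ad_kernel g (y s)"
      using regular_near_conj[OF reg[OF s]] by blast
    define T where "T = {t. dist (y s) (y t) < e}"
    have "open T"
      unfolding T_def by (intro open_Collect_less continuous_intros cy)
    then have "openin (top_of_set S) (S \<inter> T)" by (rule openin_open_Int)
    moreover have "s \<in> S \<inter> T" using s e(1) by (simp add: T_def)
    moreover have "?R s t" if "t \<in> S \<inter> T" for t
      using that e(2)[OF reg] by (auto simp: T_def)
    ultimately show "\<exists>T. openin (top_of_set S) T \<and> s \<in> T \<and> (\<forall>t\<in>T. ?R s t)" by blast
  qed
  then show ?thesis using that by (auto simp: y01)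
qed

text \<open>The test in step (3) does not tell whether \<open>x\<close> itself is regular. A regular
  element near \<open>x\<close> is conjugate to some \<open>z\<close> in the accepted subalgebra;
  nilpotency puts this subalgebra inside \<open>ad_kernel g z\<close>, and minimality of the
  dimension closes the gap.\<close>

lemma cartan_regular_element:
  assumes x: "x \<in> g" and c: "cartan_subalgebra (ad_kernel g x) g"
  obtains y where "regular y" "ad_kernel g y = ad_kernel g x"
proof -
  obtain e where e: "e > 0"
    "\<And>y. y \<in> g \<Longrightarrow> dist x y < e \<Longrightarrow> \<exists>h\<in>G. \<exists>z\<in>ad_kernel g x. y = conjm h z"
    using local_conjugacy[OF x] by blast
  obtain y where y: "regular y" "dist x y < e" using regular_dense[OF x e(1)] by blast
  then obtain h z where h: "h \<in> G" "z \<in> ad_kernel g x" "y = conjm h z"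
    using e(2) regular_in_g by blast
  have zg: "z \<in> g" using h ad_kernel_subset by blast
  have z: "regular z" using y(1) regular_conjm[OF h(1) zg] h(3) by simp
  obtain m where "\<And>X Y. X \<in> ad_kernel g x \<Longrightarrow> Y \<in> ad_kernel g x \<Longrightarrow> (lie_bracket X ^^ m) Y = 0"
    using c unfolding cartan_subalgebra_def by metis
  then have "ad_kernel g x \<subseteq> ad_kernel g z"
    using h(2) ad_kernel_subset ad_kernel_iff[OF zg] by blast
  then have "ad_kernel g x = ad_kernel g z"
    by (rule ad_kernel_eq_if_subset[OF x z])
  then show ?thesis using that z by simp
qed

text \<open>A regular element near \<open>z\<close> is conjugate to a \<open>w\<close> in
  \<open>ad_kernel g z\<close>, which for diagonalizable \<open>z\<close> is the centralizer. So
  \<open>z\<close> commutes with \<open>w\<close> and lies in the Cartan subalgebra of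
  \<open>w\<close>, which is conjugate to the given one.\<close>

theorem diagonalizable_conj_into_cartan:
  assumes x: "x \<in> g" and c: "cartan_subalgebra (ad_kernel g x) g"
    and z: "z \<in> g" "diagonalizable_matrix z"
  obtains h where "h \<in> G" "conjm h z \<in> ad_kernel g x"
proof -
  obtain a where a: "regular a" "ad_kernel g a = ad_kernel g x"
    using cartan_regular_element[OF x c] by blast
  obtain e where e: "e > 0"
    "\<And>y. y \<in> g \<Longrightarrow> dist z y < e \<Longrightarrow> \<exists>h\<in>G. \<exists>w\<in>ad_kernel g z. y = conjm h w"
    using local_conjugacy[OF z(1)] by blast
  obtain y where y: "regular y" "dist z y < e" using regular_dense[OF z(1) e(1)] by blast
  then obtain h w where h: "h \<in> G" "w \<in> ad_kernel g z" "y = conjm h w"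
    using e(2) regular_in_g by blast
  have wg: "w \<in> g" using h ad_kernel_subset by blast
  have w: "regular w" using y(1) regular_conjm[OF h(1) wg] h(3) by simp
  have "lie_bracket z w = 0"
    using diagonalizable_bracket_funpow_eq_0[OF z(2)] h(2) by (auto simp: ad_kernel_def)
  then have "(lie_bracket w ^^ 1) z = 0"
    using lie_bracket_swap[of w z] by simp
  then have zw: "z \<in> ad_kernel g w"
    using z(1) ad_kernel_iff[OF wg] by blast
  obtain k where "k \<in> G" "ad_kernel g a = conjm k ` ad_kernel g w"
    using regular_conj[OF w a(1)] by blast
  then show ?thesis using that zw a(2) by blast
qed

end

section \<open>Binomial ideals and weights\<close>

abbreviation xpow :: "('k \<Rightarrow>\<^sub>0 nat) \<Rightarrow> 'k::finite cpoly" where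
  "xpow a \<equiv> Poly_Mapping.single a 1"

definition weight :: "('n::finite \<Rightarrow> complex) \<Rightarrow> ('n \<Rightarrow>\<^sub>0 nat) \<Rightarrow> complex" where
  "weight w a = (\<Sum>i\<in>UNIV. of_nat (Poly_Mapping.lookup a i) * w i)"

lemma der_eigen_mult:
  "der X f = cconst l * f \<Longrightarrow> der X g = cconst m * g \<Longrightarrow> der X (f * g) = cconst (l + m) * (f * g)"
  by (simp add: der_simps cconst_simps algebra_simps)

lemma der_eigen_1: "der X 1 = cconst 0 * 1"
  using der_simps(3)[of X 1] by (simp add: cconst_simps)

lemma der_diagm_mono: "der (diagm w) (xpow a) = cconst (weight w a) * xpow a"
proof -
  have v: "der (diagm w) (cvar i) = cconst (w i) * cvar i" for i
  proof -
    have "lin (diagm w $ i) = (\<Sum>j\<in>UNIV. if j = i then cconst (w i) * cvar i else 0)"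
      unfolding lin_def by (rule sum.cong) (auto simp: diagm_def cconst_simps)
    then show ?thesis by (simp add: der_simps)
  qed
  have p: "der (diagm w) (cvar i ^ k) = cconst (of_nat k * w i) * cvar i ^ k" for i k
  proof (induction k)
    case (Suc k)
    show ?case
      using der_eigen_mult[OF v Suc, of i] by (simp add: algebra_simps)
  qed (use der_eigen_1 in simp)
  have "der (diagm w) (\<Prod>i\<in>A. cvar i ^ Poly_Mapping.lookup a i)
      = cconst (\<Sum>i\<in>A. of_nat (Poly_Mapping.lookup a i) * w i) * (\<Prod>i\<in>A. cvar i ^ Poly_Mapping.lookup a i)"
    if "finite A" for A
    using that
  proof (induction A)
    case (insert i A)
    then show ?case using der_eigen_mult[OF p insert.IH, of i] by simp
  qed (use der_eigen_1 in simp)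
  then show ?thesis
    unfolding mono_eq_prod weight_def by simp
qed

lemma lookup_cconst_mult: "Poly_Mapping.lookup (cconst c * f) a = c * Poly_Mapping.lookup f a"
  using arg_cong[OF mult_map_scale_conv_mult[of c f], of "\<lambda>p. Poly_Mapping.lookup p a"]
  by (simp add: cconst_def Poly_Mapping.map.rep_eq when_def split: if_splits)

lemma der_eigen_keys:
  assumes "der (diagm w) f = cconst l * f" "a \<in> Poly_Mapping.keys f"
  shows "weight w a = l"
proof -
  have "der (diagm w) f = der (diagm w) (\<Sum>b\<in>Poly_Mapping.keys f. cconst (Poly_Mapping.lookup f b) * xpow b)"
    by (rule arg_cong[OF cpoly_expand])
  also have "\<dots> = (\<Sum>b\<in>Poly_Mapping.keys f. cconst (Poly_Mapping.lookup f b * weight w b) * xpow b)"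
    by (simp only: der_sum der_cmult der_diagm_mono cconst_simps(4) mult.assoc)
  also have "Poly_Mapping.lookup \<dots> a = (\<Sum>b\<in>Poly_Mapping.keys f. if b = a then Poly_Mapping.lookup f a * weight w a else 0)"
    unfolding lookup_sum by (rule sum.cong) (auto simp: lookup_cconst_mult lookup_single when_def)
  finally have "Poly_Mapping.lookup (der (diagm w) f) a = Poly_Mapping.lookup f a * weight w a"
    using assms(2) by simp
  then show ?thesis
    unfolding assms(1) lookup_cconst_mult using assms(2) by (simp add: in_keys_iff)
qed

definition weight_part :: "('n::finite \<Rightarrow> complex) \<Rightarrow> 'n cpoly \<Rightarrow> complex \<Rightarrow> 'n cpoly" where
  "weight_part w f l = (\<Sum>a\<in>{a \<in> Poly_Mapping.keys f. weight w a = l}. cconst (Poly_Mapping.lookup f a) * xpow a)"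

lemma sum_weight_part: "f = (\<Sum>l\<in>weight w ` Poly_Mapping.keys f. weight_part w f l)"
  unfolding weight_part_def
  by (rule trans[OF cpoly_expand sum.image_gen]) simp

lemma der_weight_part: "der (diagm w) (weight_part w f l) = cconst l * weight_part w f l"
  unfolding weight_part_def der_sum sum_distrib_left
  by (rule sum.cong) (auto simp: der_cmult der_diagm_mono mult.left_commute)

lemma weight_part_in_ideal:
  assumes J: "pideal J" and w: "diagm w \<in> lieI J" and f: "f \<in> J" and l: "l \<in> weight w ` Poly_Mapping.keys f"
  shows "weight_part w f l \<in> J"
proof (rule cpoly.gev_components_in_subspace[OF der_linear pideal_subspace[OF J], of "diagm w"])
  show "der (diagm w) g \<in> J" if "g \<in> J" for g using w that by (auto simp: lieI_def)
  show "gev (\<lambda>c f. cconst c * f) (der (diagm w)) m (weight_part w f m)" for m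
    unfolding gev_def by (intro exI[of _ 1]) (simp add: shift_def der_weight_part)
  show "(\<Sum>l\<in>weight w ` Poly_Mapping.keys f. weight_part w f l) \<in> J"
    using f sum_weight_part[of f w] by simp
qed (use l in auto)

text \<open>All weight spaces of the quotient by \<open>J\<close> have dimension at most one.\<close>

definition multiplicity_free :: "('n::finite \<Rightarrow> complex) \<Rightarrow> 'n cpoly set \<Rightarrow> bool" where
  "multiplicity_free w J \<longleftrightarrow>
     (\<forall>l. \<exists>u. \<forall>f. der (diagm w) f = cconst l * f \<longrightarrow> (\<exists>k. f - cconst k * u \<in> J))"

lemma cconst_mult_inverse: "c \<noteq> 0 \<Longrightarrow> cconst (inverse c) * (cconst c * f) = f"
  by (simp flip: mult.assoc cconst_simps(4) add: cconst_simps(6))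

text \<open>\<open>J\<close> is compared with the ideal generated by its own binomials, one weight
  component at a time. Modulo these binomials every monomial of the component becomes a multiple of
  one fixed monomial, and what remains is a single term that lies in \<open>J\<close>.\<close>

lemma binomial_ideal_if_multiplicity_free:
  assumes J: "pideal J" and w: "diagm w \<in> lieI J" and mf: "multiplicity_free w J"
  shows "binomial_ideal J"
proof -
  define B where "B = {f \<in> J. binomial_poly f}"
  let ?I = "Idl\<^bsub>poly_ring\<^esub> B"
  note I = Idl_pideal[of B]
  have B: "xpow a - cconst k * xpow b \<in> ?I" if "xpow a - cconst k * xpow b \<in> J" for a b k
  proof -
    have "binomial_poly (xpow a - cconst k * xpow b)"
      unfolding binomial_poly_def single_eq_cconst_mult[of b k, symmetric] by blast
    then show ?thesis
      using that Idl_superset[of B] by (auto simp: B_def)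
  qed
  have "weight_part w f l \<in> ?I" if f: "f \<in> J" and l: "l \<in> weight w ` Poly_Mapping.keys f" for f l
  proof -
    let ?K = "{a \<in> Poly_Mapping.keys f. weight w a = l}"
    obtain u where "\<And>g. der (diagm w) g = cconst l * g \<Longrightarrow> \<exists>k. g - cconst k * u \<in> J"
      using mf unfolding multiplicity_free_def by metis
    then have ex: "\<exists>k. xpow a - cconst k * u \<in> J" if "weight w a = l" for a
      using that by (simp add: der_diagm_mono)
    define k where "k a = (SOME k. xpow a - cconst k * u \<in> J)" for a
    have k: "xpow a - cconst (k a) * u \<in> J" if "weight w a = l" for a
      unfolding k_def by (rule someI_ex[OF ex[OF that]])
    show ?thesis
    proof (cases "\<exists>b. weight w b = l \<and> k b \<noteq> 0")
      case False
      \<comment> \<open>Here every monomial of weight \<open>l\<close> lies in \<open>J\<close> and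
        is itself a binomial, with coefficient 0.\<close>
      have "xpow a \<in> ?I" if "weight w a = l" for a
        using k[OF that] B[of a 0 0] False that by (simp add: cconst_simps)
      then show ?thesis
        unfolding weight_part_def by (intro pideal_sum[OF I] pidealD(3)[OF I]) auto
    next
      case True
      then obtain b where b: "weight w b = l" "k b \<noteq> 0" by blast
      \<comment> \<open>The coefficient that eliminates \<open>u\<close> between the relations for
        \<open>a\<close> and \<open>b\<close>.\<close>
      define r where "r a = k a / k b" for a
      have m: "xpow a - cconst (r a) * xpow b \<in> J" if "weight w a = l" for a
      proof -
        have "(xpow a - cconst (k a) * u) - cconst (r a) * (xpow b - cconst (k b) * u) \<in> J"
          by (intro pidealD[OF J] k that b)
        also have "(xpow a - cconst (k a) * u) - cconst (r a) * (xpow b - cconst (k b) * u) = xpow a - cconst (r a) * xpow b"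
          using b(2) by (simp add: right_diff_distrib r_def flip: mult.assoc cconst_simps(4))
        finally show ?thesis .
      qed
      define c where "c = (\<Sum>a\<in>?K. Poly_Mapping.lookup f a * r a)"
      have e: "weight_part w f l = (\<Sum>a\<in>?K. cconst (Poly_Mapping.lookup f a) * (xpow a - cconst (r a) * xpow b)) + cconst c * xpow b"
      proof -
        have "(\<Sum>a\<in>?K. cconst (Poly_Mapping.lookup f a) * (xpow a - cconst (r a) * xpow b)) = weight_part w f l - cconst c * xpow b"
          by (simp only: weight_part_def c_def cconst_sum cconst_simps(4) sum_distrib_right right_diff_distrib sum_subtractf mult.assoc)
        then show ?thesis by simp
      qed
      have "weight_part w f l - (\<Sum>a\<in>?K. cconst (Poly_Mapping.lookup f a) * (xpow a - cconst (r a) * xpow b)) \<in> J"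
        by (rule pidealD(6)[OF J weight_part_in_ideal[OF J w f l] pideal_sum[OF J pidealD(3)[OF J m]]]) auto
      then have cb: "cconst c * xpow b \<in> J" by (simp add: e)
      have "cconst c * xpow b \<in> ?I"
      proof (cases "c = 0")
        case False
        have "xpow b \<in> J"
          using pidealD(3)[OF J cb, of "cconst (inverse c)"] False by (simp add: cconst_mult_inverse)
        then show ?thesis
          using B[of b 0 0] by (intro pidealD(3)[OF I]) (simp add: cconst_simps)
      qed (use pidealD(1)[OF I] in \<open>simp add: cconst_simps\<close>)
      then show ?thesis
        unfolding e by (intro pidealD(2)[OF I pideal_sum[OF I pidealD(3)[OF I B[OF m]]]]) auto
    qed
  qed
  then have "f \<in> ?I" if "f \<in> J" for f
    using that by (subst sum_weight_part[of f w]) (intro pideal_sum[OF I])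
  moreover have "?I \<subseteq> J"
    by (rule Idl_minimal[OF J]) (auto simp: B_def)
  ultimately have "J = ?I" by blast
  then show ?thesis
    unfolding binomial_ideal_def by (intro exI[of _ B]) (auto simp: B_def)
qed

lemma multiplicity_free_act_ideal:
  assumes mf: "multiplicity_free w J" and R: "invertible R" and v: "conjm R (diagm w) = diagm v"
  shows "multiplicity_free v (act_ideal R J)"
  unfolding multiplicity_free_def
proof
  fix l
  obtain u where u: "\<And>g. der (diagm w) g = cconst l * g \<Longrightarrow> \<exists>k. g - cconst k * u \<in> J"
    using mf unfolding multiplicity_free_def by metis
  have "\<exists>k. f - cconst k * act R u \<in> act_ideal R J" if f: "der (diagm v) f = cconst l * f" for f
  proof -
    let ?f = "act (matrix_inv R) f"
    have "act (matrix_inv R) (der (diagm v) f) = der (diagm w) ?f"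
      using act_der[of "matrix_inv R" "diagm v" f] R by (simp add: invertible_inv flip: v)
    then have "der (diagm w) ?f = cconst l * ?f"
      by (simp add: f act_simps)
    then obtain k where "?f - cconst k * u \<in> J" using u by blast
    then have "f - cconst k * act R u \<in> act_ideal R J"
      by (simp add: mem_act_ideal_iff R act_simps)
    then show ?thesis by blast
  qed
  then show "\<exists>u. \<forall>f. der (diagm v) f = cconst l * f \<longrightarrow> (\<exists>k. f - cconst k * u \<in> act_ideal R J)"
    by blast
qed

section \<open>Prime binomial ideals\<close>

text \<open>The homogenization \<open>Y\<^sup>k p(X / Y)\<close> of a univariate polynomial \<open>p\<close> splits into linear factors.\<close>

lemma prime_linear_factor:
  assumes J: "primeideal J poly_ring"
  shows "p \<noteq> 0 \<Longrightarrow> degree p = k \<Longrightarrow> (\<Sum>i\<le>k. cconst (coeff p i) * X ^ i * Y ^ (k - i)) \<in> J \<Longrightarrow>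
    \<exists>m. X - cconst m * Y \<in> J"
proof (induction k arbitrary: p)
  case 0
  have I: "pideal J" "J \<noteq> UNIV" using J by (auto simp: primeideal_iff)
  have c: "coeff p 0 \<noteq> 0" using 0 by (metis leading_coeff_0_iff)
  have "cconst (coeff p 0) * 1 \<in> J" using 0 by simp
  then have "cconst (inverse (coeff p 0)) * (cconst (coeff p 0) * 1) \<in> J"
    by (rule pidealD(3)[OF I(1)])
  then have "1 \<in> J" by (simp only: cconst_mult_inverse[OF c])
  then have "f \<in> J" for f using pidealD(3)[OF I(1), of 1 f] by simp
  then show ?case using I(2) by blast
next
  case (Suc k)
  obtain r where "poly p r = 0"
    using Suc.prems fundamental_theorem_of_algebra[of p] by (auto simp: constant_degree)
  then obtain q where q: "p = [:-r, 1:] * q"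
    by (auto simp: poly_eq_0_iff_dvd)
  have q0: "q \<noteq> 0" using Suc.prems q by auto
  then have dq: "degree q = k"
    using Suc.prems(2) q degree_mult_eq[of "[:-r, 1:]" q] by simp
  let ?H = "\<Sum>i\<le>k. cconst (coeff q i) * X ^ i * Y ^ (k - i)"
  have "(\<Sum>i\<le>Suc k. cconst (coeff p i) * X ^ i * Y ^ (Suc k - i))
      = (\<Sum>i\<le>Suc k. cconst (coeff (pCons 0 q) i) * X ^ i * Y ^ (Suc k - i))
        - cconst r * (\<Sum>i\<le>Suc k. cconst (coeff q i) * X ^ i * Y ^ (Suc k - i))"
    by (simp add: q sum_subtractf[symmetric] sum_distrib_left cconst_simps algebra_simps del: sum.atMost_Suc)
  also have "(\<Sum>i\<le>Suc k. cconst (coeff (pCons 0 q) i) * X ^ i * Y ^ (Suc k - i)) = X * ?H"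
    by (subst sum.atMost_Suc_shift) (simp add: cconst_simps sum_distrib_left algebra_simps)
  also have "(\<Sum>i\<le>Suc k. cconst (coeff q i) * X ^ i * Y ^ (Suc k - i)) = Y * ?H"
    by (auto simp: coeff_eq_0 dq cconst_simps sum_distrib_left Suc_diff_le algebra_simps intro!: sum.cong)
  finally have "X * ?H - cconst r * (Y * ?H) \<in> J"
    using Suc.prems(3) by (simp only:)
  then have "(X - cconst r * Y) * ?H \<in> J"
    by (simp only: left_diff_distrib mult.assoc)
  then have "X - cconst r * Y \<in> J \<or> ?H \<in> J"
    using J by (auto simp: primeideal_iff)
  then show ?case using Suc.IH[OF q0 dq] by blast
qed

lemma prime_power_difference:
  assumes J: "primeideal J poly_ring" and k: "k > 0" and m: "X ^ k - cconst l * Y ^ k \<in> J"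
  shows "\<exists>m. X - cconst m * Y \<in> J"
proof (rule prime_linear_factor[OF J])
  let ?p = "monom 1 k - [:l:] :: complex poly"
  show d: "degree ?p = k"
    unfolding diff_conv_add_uminus
    by (subst degree_add_eq_left) (use k in \<open>simp_all add: degree_monom_eq\<close>)
  then show "?p \<noteq> 0" using k by force
  have "(\<Sum>i\<le>k. cconst (coeff ?p i) * X ^ i * Y ^ (k - i)) =
      (\<Sum>i\<le>k. (if i = k then X ^ k else 0) - (if i = 0 then cconst l * Y ^ k else 0))"
    by (rule sum.cong) (use k in \<open>auto simp: coeff_pCons cconst_simps split: nat.splits\<close>)
  then show "(\<Sum>i\<le>k. cconst (coeff ?p i) * X ^ i * Y ^ (k - i)) \<in> J"
    using m by (simp add: sum_subtractf)
qed

text \<open>Exponents are placed in a rational vector space so that the saturation of a lattice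
  becomes a subspace.\<close>

definition expvec :: "('n::finite \<Rightarrow>\<^sub>0 nat) \<Rightarrow> rat^'n" where
  "expvec a = (\<chi> i. of_nat (Poly_Mapping.lookup a i))"

lemma expvec_add: "expvec (a + b) = expvec a + expvec b"
  by (simp add: expvec_def vec_eq_iff lookup_add)

lemma expvec_inj: "expvec a = expvec b \<longleftrightarrow> a = b"
  by (auto simp: expvec_def vec_eq_iff intro: poly_mapping_eqI)

lemma mono_add: "xpow (a + b) = xpow a * xpow b"
  by (simp add: mult_single)

lemma mono_power: "\<exists>c. xpow a ^ k = xpow c \<and> expvec c = of_nat k *s expvec a"
proof (induction k)
  case 0
  show ?case by (intro exI[of _ 0]) (simp add: expvec_def vec_eq_iff)
next
  case (Suc k)
  then obtain c where "xpow a ^ k = xpow c" "expvec c = of_nat k *s expvec a" by blast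
  then show ?case
    by (intro exI[of _ "a + c"]) (simp add: mono_add expvec_add vec.scale_left_distrib)
qed

text \<open>Two monomials in \<open>J\<close> are trivially proportional modulo \<open>J\<close> and
  would contribute arbitrary differences. The conditions \<open>l \<noteq> 0\<close> and
  \<open>xpow a \<notin> J\<close> keep only relations between monomials that are nonzero in the
  quotient.\<close>

definition binomial_lattice :: "'n::finite cpoly set \<Rightarrow> (rat^'n) set" where
  "binomial_lattice J = {expvec a - expvec b | a b l. l \<noteq> 0 \<and> xpow a \<notin> J \<and> xpow a - cconst l * xpow b \<in> J}"

text \<open>Relations are multiplied and inverted. Primeness ensures that a product of monomials
  outside \<open>J\<close> stays outside.\<close>

lemma binomial_lattice_closed:
  assumes J: "primeideal J poly_ring"
  shows "0 \<in> binomial_lattice J"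
    "x \<in> binomial_lattice J \<Longrightarrow> y \<in> binomial_lattice J \<Longrightarrow> x + y \<in> binomial_lattice J"
    "x \<in> binomial_lattice J \<Longrightarrow> - x \<in> binomial_lattice J"
proof -
  have I: "pideal J" "J \<noteq> UNIV" and prime: "\<And>f g. f * g \<in> J \<Longrightarrow> f \<in> J \<or> g \<in> J"
    using J by (auto simp: primeideal_iff)
  have "1 \<notin> J" using I(2) pidealD(3)[OF I(1), of 1] by auto
  then have "(1 :: complex) \<noteq> 0 \<and> xpow 0 \<notin> J \<and> xpow 0 - cconst 1 * xpow 0 \<in> J"
    using pidealD(1)[OF I(1)] by (simp add: cconst_simps)
  then show "0 \<in> binomial_lattice J"
    unfolding binomial_lattice_def by (intro CollectI exI[of _ 0] exI[of _ 1]) (simp add: expvec_def)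
  show "x + y \<in> binomial_lattice J" if xy: "x \<in> binomial_lattice J" "y \<in> binomial_lattice J"
  proof -
    obtain a b l where a: "x = expvec a - expvec b" "l \<noteq> 0" "xpow a \<notin> J" "xpow a - cconst l * xpow b \<in> J"
      using xy by (auto simp: binomial_lattice_def)
    obtain c d m where c: "y = expvec c - expvec d" "m \<noteq> 0" "xpow c \<notin> J" "xpow c - cconst m * xpow d \<in> J"
      using xy by (auto simp: binomial_lattice_def)
    have "xpow c * (xpow a - cconst l * xpow b) + cconst l * xpow b * (xpow c - cconst m * xpow d) \<in> J"
      by (intro pidealD[OF I(1)] a c)
    also have "xpow c * (xpow a - cconst l * xpow b) + cconst l * xpow b * (xpow c - cconst m * xpow d)
      = xpow (a + c) - cconst (l * m) * xpow (b + d)"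
      unfolding mono_add cconst_simps by (simp add: algebra_simps del: mult_single)
    finally have "xpow (a + c) - cconst (l * m) * xpow (b + d) \<in> J" .
    moreover have "xpow (a + c) \<notin> J"
      using prime[of "xpow a" "xpow c"] a c unfolding mono_add by blast
    moreover have "x + y = expvec (a + c) - expvec (b + d)"
      by (simp add: a c expvec_add)
    ultimately show ?thesis
      using a(2) c(2) unfolding binomial_lattice_def by (metis (mono_tags, lifting) mem_Collect_eq mult_eq_0_iff)
  qed
  show "- x \<in> binomial_lattice J" if x: "x \<in> binomial_lattice J"
  proof -
    obtain a b l where a: "x = expvec a - expvec b" "l \<noteq> 0" "xpow a \<notin> J" "xpow a - cconst l * xpow b \<in> J"
      using x by (auto simp: binomial_lattice_def)
    have "xpow b \<notin> J"
    proof
      assume "xpow b \<in> J"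
      then have "(xpow a - cconst l * xpow b) + cconst l * xpow b \<in> J" by (intro pidealD[OF I(1)] a)
      then show False using a by simp
    qed
    moreover have "cconst (- inverse l) * (xpow a - cconst l * xpow b) \<in> J"
      by (intro pidealD[OF I(1)] a)
    then have "xpow b - cconst (inverse l) * xpow a \<in> J"
      using cconst_mult_inverse[OF a(2), of "xpow b"] by (simp add: cconst_simps right_diff_distrib)
    moreover have "- x = expvec b - expvec a" by (simp add: a)
    ultimately show ?thesis
      using a(2) unfolding binomial_lattice_def by (metis (mono_tags, lifting) mem_Collect_eq inverse_zero_imp_zero)
  qed
qed

lemma rational_saturation_subspace:
  fixes L :: "(rat^'n::finite) set"
  assumes 0: "0 \<in> L" and add: "\<And>x y. x \<in> L \<Longrightarrow> y \<in> L \<Longrightarrow> x + y \<in> L" and neg: "\<And>x. x \<in> L \<Longrightarrow> - x \<in> L"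
  shows "vec.subspace {v. \<exists>k>0. of_nat k *s v \<in> L}"
proof (rule vec.subspaceI)
  have mul: "of_nat k *s x \<in> L" if "x \<in> L" for k x
    by (induction k) (simp_all add: 0 add that vec.scale_left_distrib)
  show "0 \<in> {v. \<exists>k>0. of_nat k *s v \<in> L}" using 0 by (auto intro: exI[of _ 1])
  fix x y :: "rat^'n" and c :: rat
  assume "x \<in> {v. \<exists>k>0. of_nat k *s v \<in> L}"
  then obtain k where k: "k > 0" "of_nat k *s x \<in> L" by blast
  show "c *s x \<in> {v. \<exists>k>0. of_nat k *s v \<in> L}"
  proof -
    obtain p q where c: "c = of_int p / of_int q" "q > 0"
      by (metis Fract_of_int_quotient Rat_cases)
    have "of_nat (nat \<bar>p\<bar>) *s (of_nat k *s x) \<in> L" by (rule mul) (rule k)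
    then have "of_int p *s (of_nat k *s x) \<in> L"
      using neg[of "of_nat (nat \<bar>p\<bar>) *s (of_nat k *s x)"] by (cases "p \<ge> 0") simp_all
    moreover have "of_nat (nat q * k) *s (c *s x) = of_int p *s (of_nat k *s x)"
    proof -
      have "of_nat (nat q * k) * c = of_int p * of_nat k" using c by simp
      then show ?thesis by (simp only: vec.scale_scale)
    qed
    ultimately have "of_nat (nat q * k) *s (c *s x) \<in> L" by (simp only:)
    then show ?thesis using c(2) k(1) by (intro CollectI exI[of _ "nat q * k"]) (simp only: nat_0_less_mult_iff zero_less_nat_eq simp_thms)
  qed
  assume "y \<in> {v. \<exists>k>0. of_nat k *s v \<in> L}"
  then obtain j where j: "j > 0" "of_nat j *s y \<in> L" by blast
  have "of_nat j *s (of_nat k *s x) + of_nat k *s (of_nat j *s y) \<in> L"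
    by (intro add mul k j)
  also have "of_nat j *s (of_nat k *s x) + of_nat k *s (of_nat j *s y) = of_nat (j * k) *s (x + y)"
    by (simp add: vec.scale_right_distrib mult.commute)
  finally show "x + y \<in> {v. \<exists>k>0. of_nat k *s v \<in> L}"
    using k j by (intro CollectI exI[of _ "j * k"]) auto
qed

lemma (in vector_space) linear_with_kernel:
  assumes "subspace V"
  shows "\<exists>p. Vector_Spaces.linear scale scale p \<and> (\<forall>v. p v = 0 \<longleftrightarrow> v \<in> V)"
proof -
  interpret p: vector_space_pair scale scale ..
  obtain B where B: "B \<subseteq> V" "independent B" "V \<subseteq> span B"
    using maximal_independent_subset by blast
  obtain C where C: "B \<subseteq> C" "C \<subseteq> UNIV" "independent C" "UNIV \<subseteq> span C"
    by (rule maximal_independent_subset_extend[OF subset_UNIV B(2)]) (rule that)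
  have sB: "span B = V" using B assms by (simp add: span_subspace)
  have "\<exists>p. Vector_Spaces.linear scale scale p \<and> (\<forall>x\<in>C. p x = (if x \<in> B then 0 else x))"
    by (rule p.linear_independent_extend[OF C(3)])
  then obtain p where p: "Vector_Spaces.linear scale scale p" and pC: "\<forall>x\<in>C. p x = (if x \<in> B then 0 else x)"
    by (elim exE conjE) (rule that)
  interpret l: Vector_Spaces.linear scale scale p by fact
  have 0: "p v = 0" if "v \<in> span B" for v
    using that
  proof (induction rule: span_induct_alt)
    case (step c x y)
    then show ?case using pC C(1) by (auto simp: l.add l.scale)
  qed (simp add: l.zero)
  have 1: "p v = v" if "v \<in> span (C - B)" for v
    using that
    by (induction rule: span_induct_alt) (auto simp: l.add l.scale l.zero pC)
  have "p v = 0 \<longleftrightarrow> v \<in> V" for v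
  proof
    assume v: "p v = 0"
    have "v \<in> span (B \<union> (C - B))"
      using C(1,4) by (auto simp: Un_absorb1)
    then obtain x y where xy: "v = x + y" "x \<in> span B" "y \<in> span (C - B)"
      unfolding span_Un by blast
    then have "y = 0" using v 0[OF xy(2)] 1[OF xy(3)] by (simp add: l.add)
    then show "v \<in> V" using xy sB by simp
  qed (use 0 sB in simp)
  then show ?thesis using p by (intro exI[of _ p]) simp
qed

text \<open>Nonzero rational vectors give countably many nonzero polynomials, with countably many
  roots in total. Any \<theta> outside them has powers at the distinct exponents \<open>e i\<close>
  that are linearly independent over the rationals.\<close>

lemma rational_embedding:
  obtains \<theta> :: complex and e :: "'n::finite \<Rightarrow> nat"
  where "\<And>v :: rat^'n. (\<Sum>i\<in>UNIV. of_rat (v $ i) * \<theta> ^ e i) = 0 \<Longrightarrow> v = 0"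
proof -
  obtain e :: "'n \<Rightarrow> nat" where e: "inj e"
    using finite_imp_inj_to_nat_seg[of "UNIV :: 'n set"] by auto
  define q :: "rat^'n \<Rightarrow> complex poly" where "q v = (\<Sum>i\<in>UNIV. monom (of_rat (v $ i)) (e i))" for v
  have cq: "coeff (q v) (e i) = of_rat (v $ i)" for v i
  proof -
    have "coeff (q v) (e i) = (\<Sum>j\<in>UNIV. if j = i then of_rat (v $ i) else 0)"
      unfolding q_def coeff_sum by (rule sum.cong) (use e in \<open>auto simp: inj_eq\<close>)
    then show ?thesis by simp
  qed
  have "q v \<noteq> 0" if "v \<noteq> 0" for v
  proof
    assume "q v = 0"
    then have "of_rat (v $ i) = (0 :: complex)" for i using cq[of v i] by simp
    then show False using that by (simp add: vec_eq_iff)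
  qed
  then have "finite {z. poly (q v) z = 0}" if "v \<noteq> 0" for v
    using that poly_roots_finite by blast
  moreover have "countable (UNIV :: (rat^'n) set)"
    by (rule countableI_type)
  ultimately have "countable (\<Union>v\<in>-{0}. {z. poly (q v) z = 0})"
    by (intro countable_UN) (auto intro: countable_finite countable_subset)
  then obtain \<theta> where "\<theta> \<notin> (\<Union>v\<in>-{0}. {z. poly (q v) z = 0})"
    using uncountable_ball[of 1 "0 :: complex"] by (metis UNIV_eq_I countable_subset subset_UNIV zero_less_one)
  then have "(\<Sum>i\<in>UNIV. of_rat (v $ i) * \<theta> ^ e i) = 0 \<Longrightarrow> v = 0" for v :: "rat^'n"
    by (auto simp: q_def poly_sum poly_monom)
  then show ?thesis using that by blast
qed

text \<open>The weight is a rational linear map whose kernel is the saturation of the lattice,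
  followed by the embedding into the complex numbers. Equal weights thus put some multiple of
  \<open>a - b\<close> into the lattice; this gives a relation between \<open>k\<close>-th powers,
  from which \<open>prime_power_difference\<close> extracts a root.\<close>

lemma prime_binomial_weights:
  assumes J: "primeideal J poly_ring"
  obtains w where
    "\<And>a b. expvec a - expvec b \<in> binomial_lattice J \<Longrightarrow> weight w a = weight w b"
    "\<And>a b. xpow a \<notin> J \<Longrightarrow> weight w a = weight w b \<Longrightarrow> \<exists>m. xpow a - cconst m * xpow b \<in> J"
proof -
  have I: "pideal J" and prime: "\<And>f g. f * g \<in> J \<Longrightarrow> f \<in> J \<or> g \<in> J"
    using J by (auto simp: primeideal_iff)
  let ?L = "binomial_lattice J"
  let ?V = "{v. \<exists>k>0. of_nat k *s v \<in> ?L}"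
  have sub: "vec.subspace ?V"
    by (rule rational_saturation_subspace) (use binomial_lattice_closed[OF J] in auto)
  obtain p :: "rat^'a \<Rightarrow> rat^'a" where p: "Vector_Spaces.linear (*s) (*s) p" and pV: "\<forall>v. p v = 0 \<longleftrightarrow> v \<in> ?V"
    using vec.linear_with_kernel[OF sub] by (elim exE conjE) (rule that)
  interpret p: Vector_Spaces.linear "(*s)" "(*s)" p by fact
  obtain \<theta> :: complex and e :: "'a \<Rightarrow> nat" where \<theta>: "\<And>v. (\<Sum>i\<in>UNIV. of_rat (v $ i) * \<theta> ^ e i) = 0 \<Longrightarrow> v = 0"
    using rational_embedding by blast
  define \<beta> where "\<beta> v = (\<Sum>i\<in>UNIV. of_rat (v $ i) * \<theta> ^ e i)" for v :: "rat^'a"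
  have \<beta>: "\<beta> (x + y) = \<beta> x + \<beta> y" "\<beta> (x - y) = \<beta> x - \<beta> y" "\<beta> (c *s x) = of_rat c * \<beta> x" "\<beta> 0 = 0" for x y c
    by (simp_all add: \<beta>_def of_rat_add of_rat_diff of_rat_mult algebra_simps sum.distrib sum_subtractf sum_distrib_left)
  have \<beta>_sum: "\<beta> (sum f A) = (\<Sum>i\<in>A. \<beta> (f i))" for f :: "'a \<Rightarrow> _" and A
    by (induction A rule: infinite_finite_induct) (simp_all add: \<beta>)
  define w where "w i = \<beta> (p (axis i 1))" for i
  have w: "weight w a = \<beta> (p (expvec a))" for a
  proof -
    have "expvec a = (\<Sum>i\<in>UNIV. of_nat (Poly_Mapping.lookup a i) *s axis i 1)"
      by (simp add: vec_eq_iff expvec_def axis_def sum_component if_distrib cong: if_cong)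
    then show ?thesis
      by (simp add: weight_def w_def p.sum p.scale \<beta>_sum \<beta>)
  qed
  have iff: "weight w a = weight w b \<longleftrightarrow> expvec a - expvec b \<in> ?V" for a b
  proof -
    have "weight w a = weight w b \<longleftrightarrow> \<beta> (p (expvec a - expvec b)) = 0"
      by (simp add: w p.diff \<beta>)
    also have "\<dots> \<longleftrightarrow> p (expvec a - expvec b) = 0"
      using \<theta> by (auto simp: \<beta>_def)
    finally show ?thesis using pV by simp
  qed
  show ?thesis
  proof (rule that)
    show "weight w a = weight w b" if "expvec a - expvec b \<in> ?L" for a b
      unfolding iff using that by (intro CollectI exI[of _ 1]) simp
    fix a b assume a: "xpow a \<notin> J" and "weight w a = weight w b"
    then obtain k where k: "k > 0" "of_nat k *s (expvec a - expvec b) \<in> ?L"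
      unfolding iff by blast
    obtain c d l where c: "of_nat k *s (expvec a - expvec b) = expvec c - expvec d" "l \<noteq> 0" "xpow c \<notin> J" "xpow c - cconst l * xpow d \<in> J"
      using k(2) by (auto simp: binomial_lattice_def)
    obtain a' where a': "xpow a ^ k = xpow a'" "expvec a' = of_nat k *s expvec a" using mono_power by blast
    obtain b' where b': "xpow b ^ k = xpow b'" "expvec b' = of_nat k *s expvec b" using mono_power by blast
    \<comment> \<open>The lattice relation with the terms moved across, so that all exponents are
      natural numbers and can be read as monomials.\<close>
    have "expvec (d + a') = expvec (c + b')"
      using c(1) by (simp add: expvec_add a' b' vec.scale_right_diff_distrib algebra_simps)
    then have e: "xpow d * xpow a ^ k = xpow c * xpow b ^ k"
      unfolding a' b' expvec_inj by (simp flip: mono_add)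
    have "xpow a ^ k * (xpow c - cconst l * xpow d) \<in> J"
      by (intro pidealD(3)[OF I] c)
    also have "xpow a ^ k * (xpow c - cconst l * xpow d) = xpow c * xpow a ^ k - cconst l * (xpow d * xpow a ^ k)"
      by (simp add: algebra_simps del: mult_single)
    also have "\<dots> = xpow c * (xpow a ^ k - cconst l * xpow b ^ k)"
      unfolding e by (simp add: algebra_simps del: mult_single)
    finally have "xpow a ^ k - cconst l * xpow b ^ k \<in> J"
      using prime c(3) by blast
    then show "\<exists>m. xpow a - cconst m * xpow b \<in> J"
      using prime_power_difference[OF J k(1)] by blast
  qed
qed

text \<open>Invariance of \<open>J\<close> is checked on generators, because the members of
  \<open>J\<close> that the derivation maps into \<open>J\<close> form an ideal. A generating
  binomial either has both terms in \<open>J\<close>, or its monomials have equal weight and it is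
  an eigenvector.\<close>

theorem prime_binomial_torus:
  assumes J: "primeideal J poly_ring" and B: "binomial_ideal J"
  obtains w where "diagm w \<in> lieI J" "multiplicity_free w J"
proof -
  have I: "pideal J" using J by (auto simp: primeideal_iff)
  obtain w where w: "\<And>a b. expvec a - expvec b \<in> binomial_lattice J \<Longrightarrow> weight w a = weight w b"
    "\<And>a b. xpow a \<notin> J \<Longrightarrow> weight w a = weight w b \<Longrightarrow> \<exists>m. xpow a - cconst m * xpow b \<in> J"
    by (rule prime_binomial_weights[OF J]) (rule that)
  obtain F where F: "\<And>f. f \<in> F \<Longrightarrow> binomial_poly f" "J = Idl\<^bsub>poly_ring\<^esub> F"
    using B by (auto simp: binomial_ideal_def)
  let ?D = "der (diagm w)"
  have "pideal {f \<in> J. ?D f \<in> J}"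
    unfolding pideal_def by (auto simp: der_simps der_0 intro: pidealD[OF I])
  moreover have "F \<subseteq> {f \<in> J. ?D f \<in> J}"
  proof
    fix f assume f: "f \<in> F"
    then have fJ: "f \<in> J" using Idl_superset F(2) by blast
    obtain a b l where "f = xpow a - Poly_Mapping.single b l"
      using F(1)[OF f] by (auto simp: binomial_poly_def)
    then have fe: "f = xpow a - cconst l * xpow b" by (simp only: single_eq_cconst_mult[of b l])
    have D: "?D f = cconst (weight w a) * xpow a - cconst (weight w b) * (cconst l * xpow b)"
      unfolding fe by (simp add: der_diff der_cmult der_diagm_mono algebra_simps)
    have "?D f \<in> J"
    proof (cases "xpow a \<in> J")
      case True
      have "xpow a - f \<in> J" by (intro pidealD(6)[OF I] True fJ)
      then have "cconst l * xpow b \<in> J" by (simp add: fe)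
      then show ?thesis
        unfolding D by (intro pidealD(6)[OF I pidealD(3)[OF I True] pidealD(3)[OF I]])
    next
      case False
      then have "l \<noteq> 0" using fJ fe by (auto simp: cconst_simps)
      then have wab: "weight w a = weight w b"
        using False fJ fe by (intro w(1)) (auto simp: binomial_lattice_def)
      have "?D f = cconst (weight w a) * f"
        unfolding D wab by (subst fe) (simp only: right_diff_distrib)
      then show ?thesis using pidealD(3)[OF I fJ] by simp
    qed
    then show "f \<in> {f \<in> J. ?D f \<in> J}" using fJ by blast
  qed
  ultimately have "J \<subseteq> {f \<in> J. ?D f \<in> J}"
    using Idl_minimal F(2) by blast
  then have "diagm w \<in> lieI J" by (auto simp: lieI_def)
  moreover have "multiplicity_free w J"
    unfolding multiplicity_free_def
  proof
    fix l
    \<comment> \<open>Any monomial of weight \<open>l\<close> outside \<open>J\<close> represents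
      the weight space; if there is none, 0 does.\<close>
    obtain u where u: "\<And>a. weight w a = l \<Longrightarrow> \<exists>k. xpow a - cconst k * u \<in> J"
    proof (cases "\<exists>b. xpow b \<notin> J \<and> weight w b = l")
      case True
      then obtain b where b: "xpow b \<notin> J" "weight w b = l" by blast
      have "\<exists>k. xpow a - cconst k * xpow b \<in> J" if "weight w a = l" for a
      proof (cases "xpow a \<in> J")
        case True
        then show ?thesis by (intro exI[of _ 0]) (simp add: cconst_simps)
      next
        case False
        then show ?thesis using w(2) that b by simp
      qed
      then show ?thesis using that by blast
    next
      case False
      then show ?thesis using that[of 0] by auto
    qed
    define k where "k a = (SOME k. xpow a - cconst k * u \<in> J)" for a
    have k: "xpow a - cconst (k a) * u \<in> J" if "weight w a = l" for a
      unfolding k_def by (rule someI_ex[OF u[OF that]])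
    have "\<exists>k. f - cconst k * u \<in> J" if f: "?D f = cconst l * f" for f
    proof -
      have "(\<Sum>a\<in>Poly_Mapping.keys f. cconst (Poly_Mapping.lookup f a) * (xpow a - cconst (k a) * u)) \<in> J"
        using k der_eigen_keys[OF f] by (intro pideal_sum[OF I] pidealD(3)[OF I]) auto
      also have "(\<Sum>a\<in>Poly_Mapping.keys f. cconst (Poly_Mapping.lookup f a) * (xpow a - cconst (k a) * u))
        = f - cconst (\<Sum>a\<in>Poly_Mapping.keys f. Poly_Mapping.lookup f a * k a) * u"
        by (simp only: right_diff_distrib sum_subtractf cconst_sum cconst_simps(4) sum_distrib_right mult.assoc cpoly_expand[of f, symmetric])
      finally show ?thesis by blast
    qed
    then show "\<exists>u. \<forall>f. ?D f = cconst l * f \<longrightarrow> (\<exists>k. f - cconst k * u \<in> J)" by blast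
  qed
  ultimately show ?thesis using that by blast
qed

section \<open>Jordan decomposition in the Lie algebra of an ideal\<close>

lemma gev_der_mult:
  assumes "gev (\<lambda>c f. cconst c * f) (der X) l f" "gev (\<lambda>c f. cconst c * f) (der X) m g"
  shows "gev (\<lambda>c f. cconst c * f) (der X) (l + m) (f * g)"
proof -
  let ?s = "\<lambda>l. shift (\<lambda>c f. cconst c * f) (der X) l"
  obtain i j where "(?s l ^^ i) f = 0" "(?s m ^^ j) g = 0"
    using assms by (auto simp: gev_def)
  then have "(?s (l + m) ^^ (i + j)) (f * g) = 0"
    by (rule funpow_leibniz_eq_0[where \<beta> = "(*)", rotated 4])
      (simp_all add: shift_def der_simps cconst_simps algebra_simps)
  then show ?thesis by (auto simp: gev_def)
qed

text \<open>The polynomials on which \<open>S\<close> acts by \<open>l\<close> and which are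
  generalized eigenvectors of \<open>der X\<close> for \<open>l\<close> span a subalgebra, and it
  contains all linear forms. So every \<open>f\<close> in \<open>I\<close> splits into such
  components; invariance under \<open>X\<close> keeps them in \<open>I\<close>, and \<open>S\<close>
  merely scales them.\<close>

lemma lieI_semisimple_part:
  fixes P :: "'n::finite cmat" and d :: "'n \<Rightarrow> complex"
  defines "S \<equiv> conjm P (diagm d)"
  assumes I: "pideal I" and X: "X \<in> lieI I" and P: "invertible P"
    and N: "nilpotent_matrix (X - S)" and comm: "X ** S = S ** X"
  shows "S \<in> lieI I"
proof -
  let ?c = "\<lambda>c (f :: 'n cpoly). cconst c * f"
  define N where "N = X - S"
  define Q where "Q = matrix_inv P"
  define E where "E l = {f. der S f = cconst l * f \<and> gev ?c (der X) l f}" for l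
  have subE: "cpoly.subspace (E l)" for l
  proof -
    have "cpoly.subspace {f. der S f = cconst l * f}"
      by (rule cpoly.subspaceI) (simp_all add: der_0 der_simps distrib_left mult.left_commute)
    then have "cpoly.subspace ({f. der S f = cconst l * f} \<inter> {f. gev ?c (der X) l f})"
      by (intro cpoly.subspace_inter cpoly.gev_subspace der_linear)
    then show ?thesis by (simp add: E_def Collect_conj_eq)
  qed
  let ?A = "cpoly.span (\<Union>l. E l)"
  have EA: "f \<in> ?A" if "f \<in> E l" for f l
    using that by (intro cpoly.span_base) blast
  have E_mult: "f * g \<in> E (l + m)" if "f \<in> E l" "g \<in> E m" for f g l m
    using that der_eigen_mult gev_der_mult by (auto simp: E_def)
  have mult: "f * g \<in> ?A" if "f \<in> ?A" "g \<in> ?A" for f g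
    using that(1)
  proof (induction rule: cpoly.span_induct_alt)
    case base
    then show ?case by (simp add: cpoly.span_zero)
  next
    case (step c x y)
    then obtain l where l: "x \<in> E l" by blast
    have "x * g \<in> ?A"
      using that(2)
    proof (induction rule: cpoly.span_induct_alt)
      case base
      then show ?case by (simp add: cpoly.span_zero)
    next
      case (step b u v)
      then obtain m where m: "u \<in> E m" by blast
      have "x * (cconst b * u + v) = cconst b * (x * u) + x * v"
        by (simp add: algebra_simps)
      then show ?case
        using EA[OF E_mult[OF l m]] step by (simp add: cpoly.span_add cpoly.span_scale)
    qed
    moreover have "(cconst c * x + y) * g = cconst c * (x * g) + y * g"
      by (simp add: algebra_simps)
    ultimately show ?case
      using step by (simp add: cpoly.span_add cpoly.span_scale)
  qed
  have NS: "N ** S = S ** N"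
    by (simp add: N_def mat_mul_distrib comm)
  have NkS: "mpow N k ** S = S ** mpow N k" for k
  proof (induction k)
    case (Suc k)
    have "mpow N (Suc k) ** S = N ** (mpow N k ** S)"
      by (simp add: mpow_simps matrix_mul_assoc)
    also have "\<dots> = (N ** S) ** mpow N k"
      by (simp add: Suc matrix_mul_assoc)
    finally show ?case by (simp add: NS mpow_simps matrix_mul_assoc)
  qed (simp add: mpow_simps)
  have QS: "Q ** S = diagm d ** Q"
  proof -
    have "Q ** S = (Q ** P) ** diagm d ** Q"
      by (simp add: S_def conjm_def Q_def matrix_mul_assoc)
    then show ?thesis by (simp add: Q_def invertible_inv P)
  qed
  have row: "(diagm d ** M) $ i = d i *s M $ i" for M :: "'n cmat" and i
    by (simp add: diagm_mult vec_eq_iff)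
  \<comment> \<open>The rows of \<open>Q\<close> are left eigenvectors of \<open>S\<close>, so on
    the corresponding linear form \<open>der X - d i\<close> acts as right multiplication of the row
    by \<open>N\<close>.\<close>
  have shifts: "(shift ?c (der X) (d i) ^^ k) (lin (Q $ i)) = lin ((Q ** mpow N k) $ i)" for i k
  proof (induction k)
    case (Suc k)
    have "Q ** mpow N k ** X = Q ** mpow N k ** N + Q ** (mpow N k ** S)"
      by (simp add: N_def mat_mul_distrib matrix_mul_assoc)
    also have "Q ** (mpow N k ** S) = diagm d ** (Q ** mpow N k)"
      unfolding NkS by (simp add: matrix_mul_assoc QS)
    finally have e: "(Q ** mpow N k ** X) $ i = (Q ** mpow N k ** N) $ i + d i *s (Q ** mpow N k) $ i"
      by (simp add: row)
    have "(shift ?c (der X) (d i) ^^ Suc k) (lin (Q $ i)) = lin ((Q ** mpow N k ** N) $ i)"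
      by (simp add: Suc shift_def der_lin vector_matrix_row e lin_simps)
    then show ?case
      by (simp add: mpow_simps mpow_commute matrix_mul_assoc[symmetric])
  qed (simp add: mpow_simps)
  obtain K where K: "mpow N K = 0"
    using N by (auto simp: nilpotent_matrix_def mpow_def N_def)
  have lin: "lin (Q $ i) \<in> E (d i)" for i
  proof -
    have "der S (lin (Q $ i)) = cconst (d i) * lin (Q $ i)"
      by (simp add: der_lin vector_matrix_row QS row lin_simps)
    moreover have "(shift ?c (der X) (d i) ^^ K) (lin (Q $ i)) = 0"
      unfolding shifts K by (simp add: mat_mul_distrib lin_simps)
    ultimately show ?thesis by (auto simp: E_def gev_def)
  qed
  \<comment> \<open>The change of coordinates sends the variables to the forms just treated, and it
    is onto.\<close>
  have "sub Q f \<in> ?A" for f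
  proof (induction f rule: cpoly_induct)
    case (const c)
    have "cconst c \<in> E 0"
      unfolding E_def gev_def
      by (auto simp: der_simps cconst_simps shift_def intro!: exI[of _ 1])
    then show ?case by (simp add: sub_simps EA)
  qed (simp_all add: sub_simps EA[OF lin] cpoly.span_add mult)
  then have span: "f \<in> ?A" for f
    using sub_sub[of Q P f] by (metis Q_def P invertible_inv(1) sub_mat1)
  have "der S f \<in> I" if f: "f \<in> I" for f
  proof -
    obtain L u where u: "finite L" "\<And>l. l \<in> L \<Longrightarrow> u l \<in> E l" "f = (\<Sum>l\<in>L. u l)"
      by (rule cpoly.span_Union_decompose[OF subE span[of f]]) (rule that)
    have "u l \<in> I" if "l \<in> L" for l
      by (rule cpoly.gev_components_in_subspace[OF der_linear pideal_subspace[OF I] _ u(1), of X u l])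
        (use X u f that in \<open>auto simp: lieI_def E_def\<close>)
    moreover have "der S f = (\<Sum>l\<in>L. cconst l * u l)"
      unfolding u(3) der_sum by (rule sum.cong) (use u(2) in \<open>auto simp: E_def\<close>)
    ultimately show ?thesis
      by (simp add: pideal_sum[OF I] pidealD[OF I])
  qed
  then show ?thesis by (simp add: lieI_def)
qed

section \<open>Diagonalizable and nilpotent elements of a Cartan subalgebra\<close>

lemma funpow_right_mult: "((\<lambda>Y. Y ** N) ^^ k) Y = Y ** mpow N k" for N :: "'n::finite cmat"
  by (induction k) (simp_all add: mpow_simps mpow_commute matrix_mul_assoc)

text \<open>\<open>ad N\<close> is the difference of left and right multiplication by
  \<open>N\<close>, which commute and are both nilpotent.\<close>

lemma nilpotent_lie_bracket:
  fixes N :: "'n::finite cmat"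
  assumes "nilpotent_matrix N"
  shows "\<exists>k. \<forall>Y. (lie_bracket N ^^ k) Y = 0"
proof -
  obtain k where k: "mpow N k = 0"
    using assms by (auto simp: nilpotent_matrix_def mpow_def)
  have "(lie_bracket N ^^ (k + k)) Y = 0" for Y
  proof (rule funpow_commuting_diff_eq_0[where A = "(**) N" and B = "\<lambda>Y. Y ** N"])
    show "((**) N ^^ k) Y = 0"
      using funpow_matrix_mult[of k N Y] k by (simp add: mpow_def mat_mul_distrib)
    show "((\<lambda>Y. Y ** N) ^^ k) Y = 0"
      by (simp add: funpow_right_mult k mat_mul_distrib)
  qed (simp_all add: lie_bracket_def mat_mul_distrib matrix_mul_assoc)
  then show ?thesis by blast
qed

lemma nilpotent_mult_commuting:
  fixes X Q :: "'n::finite cmat"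
  assumes "nilpotent_matrix X" "X ** Q = Q ** X"
  shows "nilpotent_matrix (X ** Q)"
proof -
  have c: "Q ** mpow X k = mpow X k ** Q" for k
  proof (induction k)
    case (Suc k)
    have "Q ** mpow X (Suc k) = (Q ** X) ** mpow X k"
      by (simp add: mpow_simps matrix_mul_assoc)
    also have "\<dots> = X ** (Q ** mpow X k)"
      by (simp add: assms(2)[symmetric] matrix_mul_assoc)
    finally show ?case by (simp add: Suc mpow_simps matrix_mul_assoc)
  qed (simp add: mpow_simps)
  have "mpow (X ** Q) k = mpow X k ** mpow Q k" for k
  proof (induction k)
    case (Suc k)
    have "mpow (X ** Q) (Suc k) = X ** (Q ** mpow X k) ** mpow Q k"
      by (simp add: mpow_simps Suc matrix_mul_assoc)
    also have "\<dots> = mpow X (Suc k) ** mpow Q (Suc k)"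
      unfolding c by (simp add: mpow_simps matrix_mul_assoc)
    finally show ?case .
  qed (simp add: mpow_simps)
  moreover obtain k where "mpow X k = 0"
    using assms by (auto simp: nilpotent_matrix_def mpow_def)
  ultimately have "mpow (X ** Q) k = 0" by (simp add: mat_mul_distrib)
  then show ?thesis by (auto simp: nilpotent_matrix_def mpow_def)
qed

lemma diagm_simps:
  "diagm d + diagm e = diagm (\<lambda>i. d i + e i)" "mat_scale c (diagm d) = diagm (\<lambda>i. c * d i)"
  "diagm d ** diagm e = diagm (\<lambda>i. d i * e i)" "diagm (\<lambda>i. 0) = 0" "diagm (\<lambda>i. 1) = mat 1"
  by (auto simp: diagm_def vec_eq_iff matrix_matrix_mult_def mat_def if_distrib[where f = "\<lambda>x. x * _"] cong: if_cong)

lemma conjm_identity: "invertible P \<Longrightarrow> conjm P (mat 1) = mat 1"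
  by (simp add: conjm_def invertible_inv)

lemma mpow_conjm: "invertible P \<Longrightarrow> mpow (conjm P X) k = conjm P (mpow X k)"
  by (induction k) (simp_all add: mpow_simps conjm_mult conjm_identity)

lemma mpow_diagm: "mpow (diagm d) k = diagm (\<lambda>i. d i ^ k)"
  by (induction k) (simp_all add: mpow_simps diagm_simps)

lemma diagonalizable_nilpotent_eq_0:
  assumes "diagonalizable_matrix X" "nilpotent_matrix X"
  shows "X = 0"
proof -
  obtain P d where P: "invertible P" "X = conjm P (diagm d)"
    using assms(1) by (auto simp: diagonalizable_iff)
  obtain k where "mpow X k = 0"
    using assms(2) by (auto simp: nilpotent_matrix_def mpow_def)
  then have "conjm (matrix_inv P) (conjm P (diagm (\<lambda>i. d i ^ k))) = 0"
    by (simp add: P mpow_conjm mpow_diagm conjm_linear)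
  then have "diagm (\<lambda>i. d i ^ k) $ i $ i = 0" for i
    by (simp add: P(1))
  then have "d i = 0" for i by (simp add: diagm_def)
  then have "d = (\<lambda>i. 0)" by blast
  then show ?thesis by (simp add: P(2) diagm_simps conjm_linear)
qed

lemma diagonalizable_conjm: "invertible h \<Longrightarrow> diagonalizable_matrix X \<Longrightarrow> diagonalizable_matrix (conjm h X)"
  unfolding diagonalizable_iff by (metis conjm_conjm invertible_mul(1))

text \<open>Commuting with a diagonal matrix depends only on which diagonal entries coincide, and
  complex conjugation preserves these coincidences.\<close>

lemma conjm_diagm_commute_cnj:
  assumes P: "invertible P" and W: "W ** conjm P (diagm d) = conjm P (diagm d) ** W"
  shows "W ** conjm P (diagm (\<lambda>i. cnj (d i))) = conjm P (diagm (\<lambda>i. cnj (d i))) ** W"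
proof -
  define V where "V = conjm (matrix_inv P) W"
  have WV: "W = conjm P V" by (simp add: V_def P)
  have "conjm P (V ** diagm d) = conjm P (diagm d ** V)"
    using W by (simp add: WV conjm_mult P)
  then have "V ** diagm d = diagm d ** V"
    by (metis conjm_inv(2) P)
  then have "V $ i $ j * d j = d i * V $ i $ j" for i j
    by (simp add: diagm_mult vec_eq_iff)
  then have "V $ i $ j = 0 \<or> d j = d i" for i j by (simp add: mult.commute)
  then have "V $ i $ j * cnj (d j) = cnj (d i) * V $ i $ j" for i j
    by (metis mult.commute mult_zero_left)
  then have "V ** diagm (\<lambda>i. cnj (d i)) = diagm (\<lambda>i. cnj (d i)) ** V"
    by (simp add: diagm_mult vec_eq_iff)
  then show ?thesis
    by (simp add: WV flip: conjm_mult[OF P])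
qed

locale matrix_lie_algebra_jordan = matrix_lie_algebra +
  assumes semisimple_part: "\<And>X P d. X \<in> g \<Longrightarrow> invertible P \<Longrightarrow> nilpotent_matrix (X - conjm P (diagm d)) \<Longrightarrow>
    X ** conjm P (diagm d) = conjm P (diagm d) ** X \<Longrightarrow> conjm P (diagm d) \<in> g"
begin

context
  fixes c
  assumes c: "cartan_subalgebra c g"
begin

lemma cartanD:
  "cmat.subspace c" "X \<in> c \<Longrightarrow> X \<in> g" "\<exists>m. \<forall>X\<in>c. \<forall>Y\<in>c. (lie_bracket X ^^ m) Y = 0"
  "X \<in> g \<Longrightarrow> (\<And>Y. Y \<in> c \<Longrightarrow> lie_bracket X Y \<in> c) \<Longrightarrow> X \<in> c"
proof -
  have *: "cmat.subspace c" "c \<subseteq> g" "\<exists>m. \<forall>X\<in>c. \<forall>Y\<in>c. (lie_bracket X ^^ m) Y = 0"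
    "c = {X \<in> g. \<forall>Y\<in>c. lie_bracket X Y \<in> c}"
    using c unfolding cartan_subalgebra_def lie_subalgebra_def by auto
  show "cmat.subspace c" "\<exists>m. \<forall>X\<in>c. \<forall>Y\<in>c. (lie_bracket X ^^ m) Y = 0" by fact+
  show "X \<in> c \<Longrightarrow> X \<in> g" using *(2) by blast
  show "X \<in> c" if "X \<in> g" "\<And>Y. Y \<in> c \<Longrightarrow> lie_bracket X Y \<in> c"
    by (subst *(4)) (use that in blast)
qed

lemma cartan_diagonalizable_central:
  assumes "X \<in> c" "diagonalizable_matrix X" "Y \<in> c"
  shows "lie_bracket X Y = 0"
  using cartanD(3) assms diagonalizable_bracket_funpow_eq_0 by blast

text \<open>On \<open>c\<close> the map \<open>ad S = ad X - ad N\<close> is a difference of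
  commuting nilpotent maps, yet \<open>S\<close> is diagonalizable, so it annihilates
  \<open>c\<close>. Thus \<open>S\<close> normalizes \<open>c\<close> and belongs to it.\<close>

lemma cartan_jordan:
  assumes X: "X \<in> c"
  obtains P d where "invertible P" "conjm P (diagm d) \<in> c" "nilpotent_matrix (X - conjm P (diagm d))"
    "X - conjm P (diagm d) \<in> c"
proof -
  obtain P d where P: "invertible P" "nilpotent_matrix (X - conjm P (diagm d))"
    "X ** conjm P (diagm d) = conjm P (diagm d) ** X"
    by (rule jordan_decomposition[of X]) (rule that)
  define S where "S = conjm P (diagm d)"
  define N where "N = X - S"
  have Sg: "S \<in> g"
    unfolding S_def using semisimple_part[OF cartanD(2)[OF X] P] .
  have Sd: "diagonalizable_matrix S"
    using P(1) by (auto simp: S_def diagonalizable_iff)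
  obtain k where k: "\<And>Y. (lie_bracket N ^^ k) Y = 0"
    using nilpotent_lie_bracket[of N] P(2) by (auto simp: N_def S_def)
  obtain m where m: "\<And>X Y. X \<in> c \<Longrightarrow> Y \<in> c \<Longrightarrow> (lie_bracket X ^^ m) Y = 0"
    using cartanD(3) by blast
  have XS: "X ** S = S ** X" using P(3) by (simp add: S_def)
  have "lie_bracket X N = 0"
    by (simp add: N_def lie_bracket_def mat_mul_distrib XS)
  then have comm: "lie_bracket X (lie_bracket N Y) = lie_bracket N (lie_bracket X Y)" for Y
    using lie_bracket_leibniz[of X N Y] by (simp add: lie_bracket_simps)
  have SY: "lie_bracket S Y = 0" if Y: "Y \<in> c" for Y
  proof -
    have "(lie_bracket S ^^ (m + k)) Y = 0"
      by (rule funpow_commuting_diff_eq_0[OF lie_bracket_simps(1) lie_bracket_simps(1) comm _ m[OF X Y] k])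
        (simp add: N_def lie_bracket_simps)
    then show ?thesis by (rule diagonalizable_bracket_funpow_eq_0[OF Sd])
  qed
  have Sc: "S \<in> c"
    by (rule cartanD(4)[OF Sg]) (simp add: SY cmat.subspace_0[OF cartanD(1)])
  show ?thesis
    by (rule that[OF P(1)]) (use Sc P(2) cmat.subspace_diff[OF cartanD(1) X Sc] in \<open>auto simp: S_def\<close>)
qed

lemma cartan_diagonalizable_commute:
  assumes "X \<in> c" "diagonalizable_matrix X" "Y \<in> c"
  shows "X ** Y = Y ** X"
  using cartan_diagonalizable_central[OF assms] by (simp add: lie_bracket_def)

lemma cartan_torus_diagonalized:
  "\<exists>S :: 'a cmat. invertible S \<and> (\<forall>X\<in>{X \<in> c. diagonalizable_matrix X}. diagonal_matrix (S ** X ** matrix_inv S))"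
proof -
  obtain P where P: "invertible P" "\<And>X. X \<in> {X \<in> c. diagonalizable_matrix X} \<Longrightarrow> \<exists>d. X = conjm P (diagm d)"
    by (rule simultaneous_diagonalization[of "{X \<in> c. diagonalizable_matrix X}"])
      (use cartan_diagonalizable_commute in auto)
  have D: "diagonal_matrix (matrix_inv P ** X ** matrix_inv (matrix_inv P))" if X: "X \<in> {X \<in> c. diagonalizable_matrix X}" for X
  proof -
    obtain d where "X = conjm P (diagm d)" using P(2)[OF X] by blast
    then have "conjm (matrix_inv P) X = diagm d" by (simp add: P(1))
    then show ?thesis by (auto simp: conjm_def diagonal_matrix_iff)
  qed
  show ?thesis
    by (intro exI[of _ "matrix_inv P"] conjI ballI invertible_inv(3)[OF P(1)] D)
qed

text \<open>If \<open>Z = X + Y\<close> with \<open>X\<close>, \<open>Y\<close> nilpotent has semisimple part \<open>P diag(d) P\<^sup>-\<^sup>1\<close>, then pairing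
  with \<open>P diag(cnj d) P\<^sup>-\<^sup>1\<close> under the trace form gives \<open>\<Sum> \<bar>d\<^sub>i\<bar>\<^sup>2 = 0\<close>.\<close>

lemma cartan_nilpotent_add:
  assumes X: "X \<in> c" "nilpotent_matrix X" and Y: "Y \<in> c" "nilpotent_matrix Y"
  shows "nilpotent_matrix (X + Y)"
proof -
  have Z: "X + Y \<in> c" by (intro cmat.subspace_add[OF cartanD(1)] X Y)
  obtain P d where P: "invertible P" "conjm P (diagm d) \<in> c" "nilpotent_matrix (X + Y - conjm P (diagm d))"
    "X + Y - conjm P (diagm d) \<in> c"
    using cartan_jordan[OF Z] by blast
  define S where "S = conjm P (diagm d)"
  define Q where "Q = conjm P (diagm (\<lambda>i. cnj (d i)))"
  define N where "N = X + Y - S"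
  have Sd: "diagonalizable_matrix S"
    using P(1) by (auto simp: S_def diagonalizable_iff)
  \<comment> \<open>\<open>Q\<close> is not claimed to lie in \<open>c\<close>. It commutes with
    \<open>W\<close> because \<open>S\<close> does, and this already makes \<open>W ** Q\<close>
    nilpotent.\<close>
  have tr: "trace (W ** Q) = 0" if "W \<in> c" "nilpotent_matrix W" for W
  proof -
    have "W ** S = S ** W"
      using cartan_diagonalizable_commute[of S W] P(2) Sd that(1) by (simp add: S_def)
    then have "W ** Q = Q ** W"
      unfolding S_def Q_def by (rule conjm_diagm_commute_cnj[OF P(1)])
    then show ?thesis by (intro trace_nilpotent nilpotent_mult_commuting that)
  qed
  have "S ** Q = X ** Q + Y ** Q - N ** Q"
    by (simp add: N_def mat_mul_distrib algebra_simps)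
  then have "trace (S ** Q) = 0"
    using tr[OF X] tr[OF Y] tr[OF P(4,3)] by (simp add: trace_add trace_sub N_def S_def)
  moreover have "S ** Q = conjm P (diagm (\<lambda>i. d i * cnj (d i)))"
    by (simp add: S_def Q_def diagm_simps flip: conjm_mult[OF P(1)])
  ultimately have "(\<Sum>i\<in>UNIV. d i * cnj (d i)) = 0"
    by (simp add: trace_conjm P(1)) (simp add: trace_def diagm_def)
  then have "of_real (\<Sum>i\<in>UNIV. (cmod (d i))\<^sup>2) = (0 :: complex)"
    by (simp only: of_real_sum complex_norm_square)
  then have "(\<Sum>i\<in>UNIV. (cmod (d i))\<^sup>2) = 0"
    by (simp only: of_real_eq_0_iff)
  then have "d i = 0" for i
    by (simp add: sum_nonneg_eq_0_iff)
  then have "d = (\<lambda>i. 0)" by blast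
  then have "S = 0" by (simp add: S_def diagm_simps conjm_linear)
  then show ?thesis using P(3) by (simp add: S_def)
qed

theorem cartan_direct_sum:
  "direct_sum c {X \<in> c. diagonalizable_matrix X} {X \<in> c. nilpotent_matrix X}"
proof -
  note s = cartanD(1)
  have d0: "diagonalizable_matrix (0 :: 'a cmat)"
    unfolding diagonalizable_iff
    by (intro exI[of _ "mat 1"] exI[of _ "\<lambda>i. 0"]) (auto simp: conjm_mat1 diagm_simps invertible_def)
  have n0: "nilpotent_matrix (0 :: 'a cmat)"
    unfolding nilpotent_matrix_def by (intro exI[of _ 1]) (simp add: mat_mul_distrib)
  have "cmat.subspace {X \<in> c. diagonalizable_matrix X}"
  proof (rule cmat.subspaceI)
    show "0 \<in> {X \<in> c. diagonalizable_matrix X}" using d0 cmat.subspace_0[OF s] by simp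
    fix X Y and a :: complex assume X: "X \<in> {X \<in> c. diagonalizable_matrix X}"
    have "diagonalizable_matrix (mat_scale a X)"
    proof -
      obtain P d where P: "invertible P" "X = conjm P (diagm d)" using X by (auto simp: diagonalizable_iff)
      then have "mat_scale a X = conjm P (diagm (\<lambda>i. a * d i))"
        by (simp add: conjm_linear flip: diagm_simps(2))
      then show ?thesis using P(1) by (auto simp: diagonalizable_iff)
    qed
    then show "mat_scale a X \<in> {X \<in> c. diagonalizable_matrix X}"
      using X cmat.subspace_scale[OF s] by simp
    assume Y: "Y \<in> {X \<in> c. diagonalizable_matrix X}"
    obtain P where P: "invertible P" "\<And>Z. Z \<in> {X, Y} \<Longrightarrow> \<exists>d. Z = conjm P (diagm d)"
      by (rule simultaneous_diagonalization[of "{X, Y}"])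
        (use X Y cartan_diagonalizable_commute in auto)
    obtain d e where "X = conjm P (diagm d)" "Y = conjm P (diagm e)" using P(2) by blast
    then have "X + Y = conjm P (diagm (\<lambda>i. d i + e i))"
      by (simp flip: diagm_simps add: conjm_linear)
    then have "diagonalizable_matrix (X + Y)" using P(1) by (auto simp: diagonalizable_iff)
    then show "X + Y \<in> {X \<in> c. diagonalizable_matrix X}"
      using X Y cmat.subspace_add[OF s] by simp
  qed
  moreover have "cmat.subspace {X \<in> c. nilpotent_matrix X}"
  proof (rule cmat.subspaceI)
    show "0 \<in> {X \<in> c. nilpotent_matrix X}" using n0 cmat.subspace_0[OF s] by simp
    fix X Y and a :: complex assume X: "X \<in> {X \<in> c. nilpotent_matrix X}"
    then obtain k where "mpow X k = 0" by (auto simp: nilpotent_matrix_def mpow_def)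
    then have "mpow (mat_scale a X) k = 0" by (simp add: mpow_scale)
    then have "nilpotent_matrix (mat_scale a X)" by (auto simp: nilpotent_matrix_def mpow_def)
    then show "mat_scale a X \<in> {X \<in> c. nilpotent_matrix X}"
      using X cmat.subspace_scale[OF s] by simp
    assume "Y \<in> {X \<in> c. nilpotent_matrix X}"
    then show "X + Y \<in> {X \<in> c. nilpotent_matrix X}"
      using X cmat.subspace_add[OF s] cartan_nilpotent_add by simp
  qed
  moreover have "{X \<in> c. diagonalizable_matrix X} \<inter> {X \<in> c. nilpotent_matrix X} = {0}"
    using d0 n0 cmat.subspace_0[OF s] diagonalizable_nilpotent_eq_0 by auto
  moreover have "c = {X + Y | X Y. X \<in> {X \<in> c. diagonalizable_matrix X} \<and> Y \<in> {X \<in> c. nilpotent_matrix X}}"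
  proof (intro equalityI subsetI)
    fix Z assume Z: "Z \<in> c"
    obtain P d where P: "invertible P" "conjm P (diagm d) \<in> c" "nilpotent_matrix (Z - conjm P (diagm d))"
      "Z - conjm P (diagm d) \<in> c"
      using cartan_jordan[OF Z] by blast
    then show "Z \<in> {X + Y | X Y. X \<in> {X \<in> c. diagonalizable_matrix X} \<and> Y \<in> {X \<in> c. nilpotent_matrix X}}"
      by (intro CollectI exI[of _ "conjm P (diagm d)"] exI[of _ "Z - conjm P (diagm d)"])
        (auto simp: diagonalizable_iff)
  qed (use cmat.subspace_add[OF s] in auto)
  ultimately show ?thesis unfolding direct_sum_def by blast
qed

end

end

section \<open>The stabilizer of an ideal and its Cartan subalgebras\<close>

text \<open>Equality in place of the inclusion in \<open>stabilizer\<close> makes closure under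
  inverses immediate.\<close>

definition ideal_group :: "'n::finite cpoly set \<Rightarrow> 'n cmat set" where
  "ideal_group I = {h. invertible h \<and> act_ideal h I = I}"

lemma act_ideal_inv: "invertible S \<Longrightarrow> act_ideal (matrix_inv S) (act_ideal S I) = I"
  by (simp add: act_ideal_def image_image)

lemma lieI_jordan:
  assumes I: "pideal I"
  shows "matrix_lie_algebra_jordan (lieI I)"
  by unfold_locales
    (use lieI_subspace[OF I] lieI_lie_bracket[OF I] lieI_semisimple_part[OF I] in auto)

lemma lieI_group:
  assumes I: "pideal I"
  shows "matrix_lie_group (lieI I) (ideal_group I)"
proof -
  interpret matrix_lie_algebra_jordan "lieI I" by (rule lieI_jordan[OF I])
  show ?thesis
  proof unfold_locales
    fix h X assume h: "h \<in> ideal_group I"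
    then show "invertible h" by (simp add: ideal_group_def)
    show "matrix_inv h \<in> ideal_group I"
      using h act_ideal_inv[of h I] by (simp add: ideal_group_def invertible_inv)
    show "conjm h X \<in> lieI I" if "X \<in> lieI I"
      using conjm_lieI[of h X I] that h by (simp add: ideal_group_def)
    show "h ** k \<in> ideal_group I" if "k \<in> ideal_group I" for k
      using h that act_ideal_act_ideal[of h k I] by (simp add: ideal_group_def invertible_mul)
  next
    fix X assume "X \<in> lieI I"
    then show "mexp X \<in> ideal_group I"
      by (simp add: ideal_group_def invertible_mexp act_mexp_ideal[OF I])
  qed
qed

text \<open>With \<open>h\<close> moving the torus element of \<open>S'.I\<close>, carried back to
  \<open>I\<close>, into the Cartan subalgebra, the matrix \<open>R = S h S'^-1\<close> takes
  \<open>S'.I\<close> to \<open>S.I\<close> and the diagonal matrix of \<open>w\<close> to that of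
  \<open>v\<close>. Multiplicity freeness travels along \<open>R\<close>.\<close>

theorem cartan_diagonalization_binomial:
  assumes I: "pideal I" and x: "x \<in> lieI I" and c: "cartan_subalgebra (ad_kernel (lieI I) x) (lieI I)"
    and S: "invertible S" "\<And>X. X \<in> ad_kernel (lieI I) x \<Longrightarrow> diagonalizable_matrix X \<Longrightarrow> diagonal_matrix (S ** X ** matrix_inv S)"
    and S': "invertible S'" "primeideal (act_ideal S' I) poly_ring" "binomial_ideal (act_ideal S' I)"
  shows "binomial_ideal (act_ideal S I)" "primeideal (act_ideal S I) poly_ring"
proof -
  define J where "J = act_ideal S' I"
  have IJ: "I = act_ideal (matrix_inv S') J" by (simp add: J_def act_ideal_inv S'(1))
  have inv': "invertible (matrix_inv S')" by (rule invertible_inv(3)[OF S'(1)])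
  have prime: "primeideal I poly_ring"
    using primeideal_act_ideal[OF inv' S'(2)[folded J_def]] unfolding IJ[symmetric] .
  show "primeideal (act_ideal S I) poly_ring"
    by (rule primeideal_act_ideal[OF S(1) prime])
  interpret matrix_lie_group "lieI I" "ideal_group I" by (rule lieI_group[OF I])
  obtain w where w: "diagm w \<in> lieI J" "multiplicity_free w J"
    by (rule prime_binomial_torus[OF S'(2,3), folded J_def]) (rule that)
  define z where "z = conjm (matrix_inv S') (diagm w)"
  have z: "z \<in> lieI I"
    using conjm_lieI[OF inv' w(1)] by (simp add: z_def flip: IJ)
  have zd: "diagonalizable_matrix z"
    using inv' by (auto simp: z_def diagonalizable_iff)
  obtain h where h: "h \<in> ideal_group I" "conjm h z \<in> ad_kernel (lieI I) x"
    by (rule diagonalizable_conj_into_cartan[OF x c z zd]) (rule that)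
  have hi: "invertible h" "act_ideal h I = I" using h(1) by (auto simp: ideal_group_def)
  have "diagonal_matrix (conjm S (conjm h z))"
    using S(2)[OF h(2) diagonalizable_conjm[OF hi(1) zd]] by (simp add: conjm_def)
  then obtain v where v: "conjm S (conjm h z) = diagm v" by (auto simp: diagonal_matrix_iff)
  define R where "R = S ** (h ** matrix_inv S')"
  have R: "invertible R" by (simp add: R_def invertible_mul S(1) hi(1) inv')
  have Rw: "conjm R (diagm w) = diagm v"
    using v by (simp add: R_def z_def conjm_conjm invertible_mul S(1) hi(1) inv')
  have RJ: "act_ideal R J = act_ideal S I"
    using hi(2) by (simp add: R_def IJ[symmetric] invertible_mul S(1) hi(1) inv' flip: act_ideal_act_ideal)
  have "diagm v \<in> lieI (act_ideal S I)"
    using conjm_lieI[OF R w(1)] by (simp add: Rw RJ)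
  moreover have "multiplicity_free v (act_ideal S I)"
    using multiplicity_free_act_ideal[OF w(2) R Rw] by (simp add: RJ)
  ultimately show "binomial_ideal (act_ideal S I)"
    by (intro binomial_ideal_if_multiplicity_free pideal_act_ideal I S(1))
qed

section \<open>Runs of the procedure\<close>

definition accepted :: "'n::finite cpoly set \<Rightarrow> (nat \<Rightarrow> 'n cmat) \<Rightarrow> 'n cmat set \<Rightarrow> bool" where
  "accepted I xs c \<longleftrightarrow> (\<exists>k. c = ad_kernel (lie_algebra (stabilizer I)) (xs k)) \<and>
     cartan_subalgebra c (lie_algebra (stabilizer I))"

definition diagonalizer :: "'n::finite cpoly set \<Rightarrow> (nat \<Rightarrow> 'n cmat) \<Rightarrow> 'n cmat \<Rightarrow> bool" where
  "diagonalizer I xs S \<longleftrightarrow> invertible S \<and>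
     (\<exists>c. accepted I xs c \<and> (\<forall>X\<in>c. diagonalizable_matrix X \<longrightarrow> diagonal_matrix (S ** X ** matrix_inv S)))"

primrec run_invariant :: "'n::finite cpoly set \<Rightarrow> (nat \<Rightarrow> 'n cmat) \<Rightarrow> 'n cmat state \<Rightarrow> bool" where
  "run_invariant I xs Compute_Lie_Algebra = True"
| "run_invariant I xs (Sample k h) = (h = lie_algebra (stabilizer I))"
| "run_invariant I xs (Test k h c) = (h = lie_algebra (stabilizer I) \<and> c = ad_kernel h (xs k))"
| "run_invariant I xs (Decompose c) = accepted I xs c"
| "run_invariant I xs (Diagonalize t) = (\<exists>c. accepted I xs c \<and> t = {X \<in> c. diagonalizable_matrix X})"
| "run_invariant I xs (Check_Binomial S) = diagonalizer I xs S"
| "run_invariant I xs (Check_Prime S) = (diagonalizer I xs S \<and> binomial_ideal (act_ideal S I))"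
| "run_invariant I xs (Return_Matrix S) =
    (diagonalizer I xs S \<and> binomial_ideal (act_ideal S I) \<and> primeideal (act_ideal S I) poly_ring)"
| "run_invariant I xs (Done r) =
    (\<exists>S. diagonalizer I xs S \<and>
      r = (if binomial_ideal (act_ideal S I) \<and> primeideal (act_ideal S I) poly_ring then Some S else None))"

lemma run_invariant_step:
  assumes "step I xs s s'" "run_invariant I xs s"
  shows "run_invariant I xs s'"
  using assms
proof cases
  case (return_matrix S)
  then show ?thesis using assms(2) by (auto intro!: exI[of _ S])
qed (auto simp: accepted_def diagonalizer_def)

lemma run_invariant_reachable:
  "(step I xs)\<^sup>*\<^sup>* Compute_Lie_Algebra s \<Longrightarrow> run_invariant I xs s"
  by (induction rule: rtranclp_induct) (auto intro: run_invariant_step)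

text \<open>Only \<open>Decompose\<close> and \<open>Diagonalize\<close> could be stuck; the
  decomposition of Cartan subalgebras and the simultaneous diagonalization of the torus exclude
  this.\<close>

lemma run_progress:
  fixes I :: "'n::finite cpoly set"
  assumes I: "pideal I" and inv: "run_invariant I xs s"
  shows "(\<exists>s'. step I xs s s') \<or> (\<exists>r. s = Done r)"
proof -
  interpret matrix_lie_algebra_jordan "lieI I" by (rule lieI_jordan[OF I])
  have cartan: "cartan_subalgebra c (lieI I)" if "accepted I xs c" for c
    using that by (simp add: accepted_def lie_algebra_stabilizer[OF I])
  show ?thesis
  proof (cases s)
    case (Test k h c)
    then show ?thesis by (cases "cartan_subalgebra c h") (auto intro: step.intros)
  next
    case (Decompose c)
    then show ?thesis using inv cartan_direct_sum[OF cartan] by (auto intro: step.intros)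
  next
    case (Diagonalize t)
    then obtain c where c: "accepted I xs c" "t = {X \<in> c. diagonalizable_matrix X}" using inv by auto
    then show ?thesis
      using cartan_torus_diagonalized[OF cartan[OF c(1)]] Diagonalize by (auto intro: step.diagonalize)
  next
    case (Check_Binomial S)
    then show ?thesis by (cases "binomial_ideal (act_ideal S I)") (auto intro: step.intros)
  next
    case (Check_Prime S)
    then show ?thesis by (cases "primeideal (act_ideal S I) poly_ring") (auto intro: step.intros)
  qed (auto intro: step.intros)
qed

section \<open>Almost sure termination and correctness of the answer\<close>

fun steps_left :: "'m state \<Rightarrow> nat" where
  "steps_left Compute_Lie_Algebra = 8"
| "steps_left (Sample k h) = 7"
| "steps_left (Test k h c) = 6"
| "steps_left (Decompose c) = 5"
| "steps_left (Diagonalize t) = 4"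
| "steps_left (Check_Binomial S) = 3"
| "steps_left (Check_Prime S) = 2"
| "steps_left (Return_Matrix S) = 1"
| "steps_left (Done r) = 0"

fun first_draw :: "'m state \<Rightarrow> bool" where
  "first_draw (Sample k h) = (k = 0)"
| "first_draw (Test k h c) = (k = 0)"
| "first_draw s = True"

text \<open>Rejection is the only step that increases \<open>steps_left\<close>, and it cannot occur
  at the first draw. Looking at one draw suffices because an individual draw is already accepted
  with probability 1.\<close>

lemma terminates_if_first_draw_accepted:
  assumes I: "pideal I"
    and c: "cartan_subalgebra (ad_kernel (lie_algebra (stabilizer I)) (xs 0)) (lie_algebra (stabilizer I))"
  shows "terminates I xs"
proof -
  have dec: "first_draw s' \<and> run_invariant I xs s' \<and> steps_left s' < steps_left s"
    if "step I xs s s'" "first_draw s" "run_invariant I xs s" for s s'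
  proof -
    have "first_draw s' \<and> steps_left s' < steps_left s"
      using that(1)
    proof cases
      case (reject c g k)
      then show ?thesis using that assms(2) by auto
    qed (use that in auto)
    then show ?thesis using run_invariant_step[OF that(1,3)] by blast
  qed
  have "\<not> (s 0 = Compute_Lie_Algebra \<and> (\<forall>i. step I xs (s i) (s (Suc i))))" for s
  proof
    assume s: "s 0 = Compute_Lie_Algebra \<and> (\<forall>i. step I xs (s i) (s (Suc i)))"
    have "first_draw (s i) \<and> run_invariant I xs (s i) \<and> steps_left (s i) + i \<le> 8" for i
    proof (induction i)
      case (Suc i)
      then show ?case using dec[of "s i" "s (Suc i)"] s by auto
    qed (use s in simp)
    \<comment> \<open>The measure starts at 8 and drops at every step, so there is no ninth
      step.\<close>
    from this[of 9] show False by simp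
  qed
  then show ?thesis
    unfolding terminates_def using run_progress[OF I run_invariant_reachable] by blast
qed

text \<open>Provides the measurability needed to pull a null set of the distribution
  \<open>D\<close> back along a draw.\<close>

lemma zariski_closed_in_borel:
  assumes "zariski_closed_in g Z"
  shows "Z \<in> sets (restrict_space borel g)"
proof -
  obtain F where F: "Z = {X \<in> g. \<forall>p\<in>F. mat_eval p X = 0}"
    using assms by (auto simp: zariski_closed_in_def)
  have "closed {X. mat_eval p X = 0}" for p :: "('a \<times> 'a) cpoly"
    by (intro closed_Collect_eq polyfun_continuous continuous_on_const) (auto simp: polyfun_def)
  then have "closed (\<Inter>p\<in>F. {X. mat_eval p X = 0})" by blast
  moreover have "Z = (\<Inter>p\<in>F. {X. mat_eval p X = 0}) \<inter> g" by (auto simp: F)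
  ultimately show ?thesis
    by (auto simp: sets_restrict_space intro!: image_eqI)
qed

lemma random_draw_generic:
  assumes X: "random_draws g P X" and U: "zariski_open_in g U" "U \<noteq> {}"
  shows "AE \<omega> in P. X k \<omega> \<in> U"
proof -
  obtain D where P: "prob_space P" and D: "sets D = sets (restrict_space borel g)"
    "\<And>Z. zariski_closed_in g Z \<Longrightarrow> Z \<noteq> g \<Longrightarrow> emeasure D Z = 0"
    "prob_space.indep_vars P (\<lambda>_. D) X UNIV" "\<And>k. distr P D (X k) = D"
    using X by (auto simp: random_draws_def)
  have m: "X k \<in> measurable P D"
    using D(3) by (simp add: prob_space.indep_vars_def[OF P])
  have sp: "space D = g"
    using sets_eq_imp_space_eq[OF D(1)] by (simp add: space_restrict_space)
  have Z: "zariski_closed_in g (g - U)" "g - U \<noteq> g"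
    using U by (auto simp: zariski_open_in_def)
  have "g - U \<in> sets D" using zariski_closed_in_borel[OF Z(1)] D(1) by simp
  then have "emeasure P (X k -` (g - U) \<inter> space P) = 0"
    using emeasure_distr[OF m, of "g - U"] D(2)[OF Z] D(4)[of k] by simp
  moreover have "X k -` (g - U) \<inter> space P \<in> sets P"
    using m \<open>g - U \<in> sets D\<close> by (rule measurable_sets)
  ultimately have "X k -` (g - U) \<inter> space P \<in> null_sets P" by auto
  then show ?thesis
    by (rule AE_I') (use measurable_space[OF m] sp in auto)
qed

lemma returns_correct:
  fixes I :: "'n::finite cpoly set"
  assumes I: "pideal I" and xs: "\<And>k. xs k \<in> lie_algebra (stabilizer I)" and r: "returns I xs r"
    and S': "invertible S'" "primeideal (act_ideal S' I) poly_ring" "binomial_ideal (act_ideal S' I)"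
  shows "\<exists>S. r = Some S \<and> invertible S \<and> primeideal (act_ideal S I) poly_ring \<and> binomial_ideal (act_ideal S I)"
proof -
  note L = lie_algebra_stabilizer[OF I]
  have "run_invariant I xs (Done r)"
    by (rule run_invariant_reachable[OF r[unfolded returns_def]])
  then obtain S where S: "diagonalizer I xs S"
    "r = (if binomial_ideal (act_ideal S I) \<and> primeideal (act_ideal S I) poly_ring then Some S else None)"
    by auto
  obtain k where k: "cartan_subalgebra (ad_kernel (lieI I) (xs k)) (lieI I)" "invertible S"
    "\<And>X. X \<in> ad_kernel (lieI I) (xs k) \<Longrightarrow> diagonalizable_matrix X \<Longrightarrow> diagonal_matrix (S ** X ** matrix_inv S)"
    using S(1) unfolding diagonalizer_def accepted_def L by blast
  have "xs k \<in> lieI I" using xs by (simp add: L)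
  then show ?thesis
    using cartan_diagonalization_binomial[OF I _ k(1) k(2,3) S'] S(2) k(2) by simp
qed

lemma returns_Some:
  assumes "returns I xs (Some S)"
  shows "invertible S \<and> primeideal (act_ideal S I) poly_ring \<and> binomial_ideal (act_ideal S I)"
  using run_invariant_reachable[of I xs "Done (Some S)"] assms
  by (auto simp: returns_def diagonalizer_def split: if_splits)

theorem mainTheorem1:
  fixes I :: "('n::finite) cpoly set" and g :: "'n cmat set"
  assumes "homogeneous_ideal I"
    and "g = lie_algebra (stabilizer I)"
  shows
    "(\<exists>U. zariski_open_in g U \<and> U \<noteq> {} \<and> (\<forall>x\<in>U. cartan_subalgebra (ad_kernel g x) g)) \<and>
     (\<forall>(P :: 'w measure) X. random_draws g P X \<longrightarrow>
        (AE \<omega> in P. terminates I (\<lambda>k. X k \<omega>))) \<and>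
     (\<forall>xs. (\<forall>k. xs k \<in> g) \<longrightarrow>
        ((\<exists>S'. invertible S' \<and> primeideal (act_ideal S' I) poly_ring \<and>
               binomial_ideal (act_ideal S' I)) \<longrightarrow>
           (\<forall>r. returns I xs r \<longrightarrow>
              (\<exists>S. r = Some S \<and> invertible S \<and> primeideal (act_ideal S I) poly_ring \<and>
                   binomial_ideal (act_ideal S I)))) \<and>
        ((\<nexists>S'. invertible S' \<and> primeideal (act_ideal S' I) poly_ring \<and>
               binomial_ideal (act_ideal S' I)) \<longrightarrow>
           (\<forall>r. returns I xs r \<longrightarrow> r = None)))"
proof -
  have I: "pideal I"
    using assms(1) Idl_pideal by (auto simp: homogeneous_ideal_def)
  note g = assms(2)
  interpret matrix_lie_algebra_jordan "lieI I" by (rule lieI_jordan[OF I])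
  obtain U where U: "zariski_open_in g U" "U \<noteq> {}" "\<And>x. x \<in> U \<Longrightarrow> cartan_subalgebra (ad_kernel g x) g"
    using generic_cartan unfolding g lie_algebra_stabilizer[OF I] by blast
  have "AE \<omega> in P. terminates I (\<lambda>k. X k \<omega>)" if X: "random_draws g P X" for P :: "'w measure" and X
    using random_draw_generic[OF X U(1,2), of 0]
    by eventually_elim (use U(3) in \<open>auto simp: g intro!: terminates_if_first_draw_accepted[OF I]\<close>)
  moreover have "\<exists>S. r = Some S \<and> invertible S \<and> primeideal (act_ideal S I) poly_ring \<and> binomial_ideal (act_ideal S I)"
    if "\<forall>k. xs k \<in> g" "returns I xs r"
      "\<exists>S'. invertible S' \<and> primeideal (act_ideal S' I) poly_ring \<and> binomial_ideal (act_ideal S' I)" for xs r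
    using that returns_correct[OF I] g by blast
  moreover have "r = None"
    if "returns I xs r"
      "\<nexists>S'. invertible S' \<and> primeideal (act_ideal S' I) poly_ring \<and> binomial_ideal (act_ideal S' I)" for xs r
    using that returns_Some by (cases r) blast+
  ultimately show ?thesis using U by blast
qed

end
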